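(* Let $1<p<6<q$, $c>0$, and let $f\in C^1(\mathbb{C},\mathbb{R})$ satisfy: (i) $f(0)=0$; (ii) there exists $M>0$ such that $f(M)>0$; (iii) $|f'(\xi)|\le c\,\min(|\xi|^{p-1},|\xi|^{q-1})$ for all $\xi\in\mathbb{C}$; (iv) $f(e^{i\alpha}\rho)=f(\rho)$ for all $\xi=e^{i\alpha}\rho\in\mathbb{C}$. Then there exists a sequence $(v^n)_{n\in\mathbb{Z}}$ of complex-valued solutions of $$-\Delta v=f'(v)\qquad\text{in }\mathbb{R}^3,$$ such that, for every $n\in\mathbb{Z}$, $v^n(x,y,z)=u^n(r,z)\,e^{in\theta}$ with $u^n$ real-valued, where $(r,z,\theta)$ are the cylindrical coordinates of $(x,y,z)$.
   Context: $\mathbb{C}$ is identified with $\mathbb{R}^2$; $f\in C^1(\mathbb{C},\mathbb{R})$ means $C^1$ in the real sense, and $f'(\xi)$ denotes the real gradient of $f$ at $\xi$, viewed as an element of $\mathbb{C}$. In (iv), $\rho\ge 0$ and $\alpha\in\mathbb{R}$ are polar coordinates of $\xi$. Cylindrical coordinates: $r=\sqrt{x^2+y^2}$, and $x=r\cos\theta$, $y=r\sin\theta$. The space $\mathcal{D}^{1,2}(\mathbb{R}^3)$ is the completion of $C_0^\infty(\mathbb{R}^3)$ with respect to the norm $\|u\|=\left(\int_{\mathbb{R}^3}|\nabla u|^2\,dx\right)^{1/2}$ (here for complex-valued functions), and solutions are understood in the weak sense in this space. *)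

theory Defs
  imports "HOL-Analysis.Analysis"
begin

fun C_diff :: "nat \<Rightarrow> (real^3 \<Rightarrow> complex) \<Rightarrow> bool" where
  "C_diff 0 \<phi> \<longleftrightarrow> continuous_on UNIV \<phi>"
| "C_diff (Suc k) \<phi> \<longleftrightarrow> (\<forall>x. \<phi> differentiable (at x)) \<and>
     (\<forall>i. C_diff k (\<lambda>x. frechet_derivative \<phi> (at x) (axis i 1)))"

definition test_function :: "(real^3 \<Rightarrow> complex) \<Rightarrow> bool" where
  "test_function \<phi> \<longleftrightarrow> (\<forall>k. C_diff k \<phi>) \<and> compact (closure {x. \<phi> x \<noteq> 0})"

definition grad :: "(real^3 \<Rightarrow> complex) \<Rightarrow> real^3 \<Rightarrow> complex^3" where
  "grad \<phi> x = (\<chi> i. frechet_derivative \<phi> (at x) (axis i 1))"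

text \<open>
  The completion of the test functions in the norm of the gradient, realised as a space of
  functions: by the Sobolev inequality on three-dimensional space, a sequence of test functions
  that is Cauchy in this norm also converges in \<open>L\<^sup>6\<close>, and the limit determines the class of the
  sequence.  So \<open>v\<close> belongs to the space iff it is the \<open>L\<^sup>6\<close> limit of test functions whose gradients
  converge in \<open>L\<^sup>2\<close>; the limit \<open>G\<close> of the gradients, unique up to a null set, is the gradient
  of \<open>v\<close>.  Nonnegative integrals are used since the Bochner integral of a non-integrable
  function is 0.
\<close>

definition has_D12_gradient :: "(real^3 \<Rightarrow> complex) \<Rightarrow> (real^3 \<Rightarrow> complex^3) \<Rightarrow> bool" where
  "has_D12_gradient v G \<longleftrightarrow>
     v \<in> borel_measurable lborel \<and> G \<in> borel_measurable lborel \<and>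
     (\<exists>\<phi>. (\<forall>k::nat. test_function (\<phi> k)) \<and>
        (\<lambda>k. \<integral>\<^sup>+ x. ennreal (norm (\<phi> k x - v x) ^ 6) \<partial>lborel) \<longlonglongrightarrow> 0 \<and>
        (\<lambda>k. \<integral>\<^sup>+ x. ennreal ((norm (grad (\<phi> k) x - G x))\<^sup>2) \<partial>lborel) \<longlonglongrightarrow> 0)"

text \<open>
  Weak solutions of \<open>- \<Delta> v = g v\<close> in this space.  On \<open>complex\<close> and on \<open>complex^3\<close> the inner
  product is the real one, \<open>z \<bullet> w = Re (z * cnj w)\<close> summed over components, in accordance with
  the identification of the complex numbers with the real plane; replacing \<open>h\<close> by \<open>\<i> * h\<close>
  recovers the complex-valued equation.
\<close>

definition weak_solution :: "(complex \<Rightarrow> complex) \<Rightarrow> (real^3 \<Rightarrow> complex) \<Rightarrow> bool" where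
  "weak_solution g v \<longleftrightarrow>
     (\<exists>G. has_D12_gradient v G \<and>
        (\<forall>h H. has_D12_gradient h H \<longrightarrow>
           integrable lborel (\<lambda>x. G x \<bullet> H x) \<and>
           integrable lborel (\<lambda>x. g (v x) \<bullet> h x) \<and>
           (\<integral>x. G x \<bullet> H x \<partial>lborel) = (\<integral>x. g (v x) \<bullet> h x \<partial>lborel)))"

end

theory Submission
  imports Defs "HOL-Complex_Analysis.Great_Picard"
begin

text \<open>
  Put \<open>F v = \<integral> f v\<close> and \<open>T v = \<integral> |\<nabla> v|\<^sup>2\<close>, and let \<open>V\<close> be the functions of the space that have the
  symmetry \<open>u(r,z) e\<^sup>i\<^sup>n\<^sup>\<theta>\<close> with \<open>u\<close> real. The quotient \<open>F / T\<^sup>3\<close> is invariant under dilations, bounded by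
  the Sobolev inequality since \<open>|f \<xi>| \<le> c |\<xi>|\<^sup>6\<close>, and positive for some smooth function supported near a
  torus. Let \<open>S\<close> be its supremum over \<open>V\<close> and take a maximising sequence with \<open>T = 1\<close>. As \<open>f\<close> is subcritical
  at infinity and supercritical at 0, its members stay large on sets of fixed measure; these cannot
  be dispersed, because \<open>\<parallel>v(\<cdot> + h) - v\<parallel>\<^sub>2\<close> is controlled by \<open>|h| \<parallel>\<nabla> v\<parallel>\<^sub>2\<close>, nor lie far from the axis,
  because of the rotational symmetry, so that after translations along the axis a weak limit
  \<open>v \<noteq> 0\<close> exists. By the Brezis--Lieb splitting, \<open>S \<le> S (\<tau>\<^sup>3 + (1 - \<tau>)\<^sup>3)\<close> with \<open>\<tau> = T v > 0\<close>, hence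
  \<open>\<tau> = 1\<close> and \<open>v\<close> is a maximiser. Its Euler--Lagrange equation extends from \<open>V\<close> to the whole space by
  symmetric criticality, and a dilation removes the multiplier.
\<close>

section \<open>Measure-theoretic preliminaries\<close>

text \<open>The cube in \<open>F / T ^ 3\<close> comes from scaling: x -> \<sigma> x divides F by
  \<open>\<sigma> ^ 3\<close> and T by \<sigma>. Growth exactly like |xi|^6 would add a second
  dilation, acting on amplitudes too, under which maximising sequences could concentrate or flatten
  out; the strict inequalities p < 6 < q exclude this, because outside a band of moduli f is then
  small against |xi|^6. The symmetry is encoded as invariance, up to null sets, under pairs of a
  linear isometry of the values and one of space. Rotations paired with a phase produce the angular
  factor, and conjugation paired with a reflection makes u real. This encoding survives real linear
  combinations, limits, dilations and shifts along the axis. Members of the space are accessible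
  only through approximating test functions. The limit function is therefore found by minimising
  energy over shrinking convex neighbourhoods of a pointwise limit; this yields only a lower bound
  for the limit of the products of its gradient with those of the sequence, but that bound is
  exactly what the splitting argument uses. Symmetric criticality reuses the same minimisation, in
  place of an average over a group.\<close>

lemma lborel_distr_orthogonal:
  fixes A :: "real^'n::{finite,wellorder} \<Rightarrow> real^'n::_"
  assumes A: "orthogonal_transformation A"
  shows "distr lborel borel A = lborel"
proof -
  have lin: "linear A" using A by (simp add: orthogonal_transformation_def)
  have bij: "bij A" using A by (rule orthogonal_transformation_bij)
  have contA: "continuous_on UNIV A" using lin by (rule linear_continuous_on_compose[of UNIV "\<lambda>x. x" A, simplified])
  then have [measurable]: "A \<in> borel_measurable borel" by (rule borel_measurable_continuous_onI)
  have oi: "orthogonal_transformation (inv A)"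
    using A by (simp add: orthogonal_transformation_inv)
  show ?thesis
  proof (rule lborel_eqI[symmetric])
    fix l u :: "real^'n::_"
    assume lu: "\<And>b. b \<in> Basis \<Longrightarrow> l \<bullet> b \<le> u \<bullet> b"
    have "emeasure (distr lborel borel A) (box l u) = emeasure lborel (A -` box l u)"
      by (subst emeasure_distr) auto
    also have "A -` box l u = inv A ` box l u"
      using bij by (rule bij_vimage_eq_inv_image)
    also have "emeasure lborel (inv A ` box l u) = emeasure lebesgue (inv A ` box l u)"
    proof -
      have "open (A -` box l u)" using contA open_vimage by blast
      then have "inv A ` box l u \<in> sets borel" using bij_vimage_eq_inv_image[OF bij, of "box l u"] by auto
      then show ?thesis by simp
    qed
    also have "\<dots> = ennreal (measure lebesgue (inv A ` box l u))"
    proof (rule emeasure_eq_measure2)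
      show "inv A ` box l u \<in> lmeasurable"
        using oi by (intro measurable_orthogonal_image) auto
    qed
    also have "measure lebesgue (inv A ` box l u) = measure lebesgue (box l u)"
      using oi by (simp add: measure_orthogonal_image)
    also have "ennreal \<dots> = ennreal (\<Prod>b\<in>Basis. (u - l) \<bullet> b)"
      using lu by (simp add: measure_lborel_box_eq)
    finally show "emeasure (distr lborel borel A) (box l u) = ennreal (\<Prod>b\<in>Basis. (u - l) \<bullet> b)" .
  qed simp
qed

lemma orthogonal_transformation_measurable:
  fixes A :: "real^'n::{finite,wellorder} \<Rightarrow> real^'n::_"
  shows "orthogonal_transformation A \<Longrightarrow> A \<in> borel_measurable borel"
  by (intro borel_measurable_continuous_onI linear_continuous_on_compose[of UNIV "\<lambda>x. x" A, simplified])
     (simp_all add: orthogonal_transformation_def)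

text \<open>Translations, dilations and rotations are all of the form \<sigma> A x + a, so this
  single change of variables serves the symmetries, the rescalings and the averages over balls
  alike.\<close>

lemma nn_integral_similarity:
  fixes A :: "real^'n::{finite,wellorder} \<Rightarrow> real^'n::_" and g :: "real^'n::_ \<Rightarrow> ennreal"
  assumes A: "orthogonal_transformation A" and "\<sigma> > 0" and g[measurable]: "g \<in> borel_measurable borel"
  shows "(\<integral>\<^sup>+x. g x \<partial>lborel) = ennreal (\<sigma> ^ CARD('n)) * (\<integral>\<^sup>+x. g (\<sigma> *\<^sub>R A x + a) \<partial>lborel)"
proof -
  note [measurable] = orthogonal_transformation_measurable[OF A]
  have "(\<integral>\<^sup>+x. g x \<partial>lborel) = (\<integral>\<^sup>+x. g x \<partial>density (distr lborel borel (\<lambda>x. a + \<sigma> *\<^sub>R x)) (\<lambda>_. \<bar>\<sigma>\<bar>^DIM(real^'n::_)))"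
    using \<open>\<sigma> > 0\<close> by (intro arg_cong[where f="\<lambda>M. nn_integral M g"] lborel_affine) simp
  also have "\<dots> = ennreal (\<sigma> ^ CARD('n)) * (\<integral>\<^sup>+x. g (a + \<sigma> *\<^sub>R x) \<partial>lborel)"
    apply (subst nn_integral_density)
      apply measurable
    apply (subst nn_integral_distr)
      apply measurable
    using \<open>\<sigma> > 0\<close> apply (simp add: nn_integral_cmult)
    done
  also have "(\<integral>\<^sup>+x. g (a + \<sigma> *\<^sub>R x) \<partial>lborel) = (\<integral>\<^sup>+x. g (a + \<sigma> *\<^sub>R A x) \<partial>lborel)"
    apply (subst lborel_distr_orthogonal[OF A, symmetric])
    apply (subst nn_integral_distr)
      apply measurable
    done
  finally show ?thesis by (simp only: add.commute)
qed

lemma measurable_vector3[measurable]: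
  "(\<lambda>(a, b, c). vector [a, b, c] :: real^3) \<in> borel_measurable borel"
proof -
  have "(\<lambda>(a, b, c). vector [a, b, c] :: real^3) =
    (\<lambda>p::real\<times>real\<times>real. fst p *\<^sub>R axis 1 1 + fst (snd p) *\<^sub>R axis 2 1 + snd (snd p) *\<^sub>R axis 3 1)"
    by (auto simp: vec_eq_iff forall_3 axis_def)
  also have "\<dots> \<in> borel_measurable borel"
    by (intro borel_measurable_continuous_onI continuous_intros)
  finally show ?thesis .

qed

text \<open>Carries iterated integrals over three lines to \<open>real^3\<close>; the slicewise
  proof of the Sobolev inequality rests on it. Boxes correspond to boxes, and they determine the
  measure.\<close>

lemma lborel_distr_vector3:
  "distr lborel borel (\<lambda>(a, b, c). vector [a, b, c] :: real^3) = lborel" (is "distr _ _ ?v = _")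
proof (rule lborel_eqI[symmetric])
  fix l u :: "real^3"
  assume lu: "\<And>b. b \<in> Basis \<Longrightarrow> l \<bullet> b \<le> u \<bullet> b"
  have le: "l $ i \<le> u $ i" for i using lu[of "axis i 1"] by (simp add: axis_in_Basis_iff inner_axis)
  have "?v -` box l u = box (l$1, l$2, l$3) (u$1, u$2, u$3)"
        by (rule set_eqI) (simp add: split_paired_all mem_box_cart forall_3
      box_prod[of "(l$1, l$2, l$3)"] box_prod[of "(l$2, l$3)"])
  then have "emeasure (distr lborel borel ?v) (box l u) = emeasure lborel (box (l$1, l$2, l$3) (u$1, u$2, u$3))"
    by (subst emeasure_distr) auto
  also have "\<dots> = ennreal (\<Prod>b\<in>Basis. ((u$1, u$2, u$3) - (l$1, l$2, l$3)) \<bullet> b)"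
    using le by (subst emeasure_lborel_box) (auto simp: Basis_prod_def)
  also have "\<dots> = ennreal (\<Prod>b\<in>Basis. (u - l) \<bullet> b)"
  proof (rule arg_cong[where f=ennreal])
    have "(\<Prod>b\<in>Basis. ((u$1, u$2, u$3) - (l$1, l$2, l$3)) \<bullet> b) = (u$1-l$1)*((u$2-l$2)*(u$3-l$3))"
      unfolding Basis_prod_def
      apply (subst prod.union_disjoint)
         apply (auto simp: prod.reindex inj_on_def)
      done
    moreover have "(\<Prod>i\<in>UNIV. (u - l) $ i) = (u$1-l$1)*((u$2-l$2)*(u$3-l$3))"
      unfolding UNIV_3 by simp
    moreover have "(\<Prod>i\<in>UNIV. (u - l) $ i) = (\<Prod>b\<in>Basis. (u - l) \<bullet> b)"
      apply (simp add: Basis_vec_def UNION_singleton_eq_range)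
      apply (subst prod.reindex)
       apply (simp add: inj_on_def axis_eq_axis)
      apply (simp add: inner_axis)
      done
    ultimately show "(\<Prod>b\<in>Basis. ((u$1, u$2, u$3) - (l$1, l$2, l$3)) \<bullet> b) = (\<Prod>b\<in>Basis. (u - l) \<bullet> b)"
      by (simp only:)
  qed
  finally show "emeasure (distr lborel borel ?v) (box l u) = ennreal (\<Prod>b\<in>Basis. (u - l) \<bullet> b)" .
qed simp

lemma nn_integral_vector3:
  fixes g :: "real^3 \<Rightarrow> ennreal"
  assumes g[measurable]: "g \<in> borel_measurable borel"
  shows "(\<integral>\<^sup>+x. g x \<partial>lborel) = (\<integral>\<^sup>+a. \<integral>\<^sup>+b. \<integral>\<^sup>+c. g (vector [a, b, c]) \<partial>lborel \<partial>lborel \<partial>lborel)"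
proof -
  let ?v = "\<lambda>(a, b, c). vector [a, b, c] :: real^3"
  have m: "(\<lambda>p. g (?v p)) \<in> borel_measurable (lborel \<Otimes>\<^sub>M (lborel \<Otimes>\<^sub>M lborel))"
    using measurable_compose[OF measurable_vector3 g] by (simp add: lborel_prod)
  have "(\<integral>\<^sup>+x. g x \<partial>lborel) = (\<integral>\<^sup>+p. g (?v p) \<partial>lborel)"
    by (subst lborel_distr_vector3[symmetric], subst nn_integral_distr) simp_all
  also have "\<dots> = (\<integral>\<^sup>+p. g (?v p) \<partial>(lborel \<Otimes>\<^sub>M (lborel \<Otimes>\<^sub>M lborel)))"
    by (simp only: lborel_prod)
  also have "\<dots> = (\<integral>\<^sup>+a. \<integral>\<^sup>+q. g (?v (a, q)) \<partial>(lborel \<Otimes>\<^sub>M lborel) \<partial>lborel)"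
    by (rule sigma_finite_measure.nn_integral_fst[symmetric, OF _ m]) (simp only: lborel_prod sigma_finite_lborel)
  also have "\<dots> = (\<integral>\<^sup>+a. \<integral>\<^sup>+b. \<integral>\<^sup>+c. g (?v (a, b, c)) \<partial>lborel \<partial>lborel \<partial>lborel)"
    by (intro nn_integral_cong lborel.nn_integral_fst[symmetric] measurable_compose[OF _ m] measurable_Pair1') simp
  finally show ?thesis by (simp only: prod.case)
qed

lemma lborel_distr_similarity:
  fixes A :: "real^'n::{finite,wellorder} \<Rightarrow> real^'n::_"
  assumes A: "orthogonal_transformation A" and "\<sigma> > 0"
  shows "distr lborel borel (\<lambda>x. \<sigma> *\<^sub>R A x + a) = density lborel (\<lambda>_. ennreal (1 / \<sigma> ^ CARD('n)))"
proof (rule measure_eqI)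
  note [measurable] = orthogonal_transformation_measurable[OF A]
  fix X assume "X \<in> sets (distr lborel borel (\<lambda>x. \<sigma> *\<^sub>R A x + a))"
  then have X[measurable]: "X \<in> sets borel" by simp
  let ?I = "\<integral>\<^sup>+x. indicator X (\<sigma> *\<^sub>R A x + a) \<partial>lborel"
  have "emeasure (distr lborel borel (\<lambda>x. \<sigma> *\<^sub>R A x + a)) X = ?I"
    by (subst nn_integral_indicator[symmetric], simp, subst nn_integral_distr) simp_all
  moreover have "emeasure lborel X = ennreal (\<sigma> ^ CARD('n)) * ?I"
    using nn_integral_similarity[OF assms, of "indicator X" a] by simp
  moreover have "ennreal (1 / \<sigma> ^ CARD('n)) * ennreal (\<sigma> ^ CARD('n)) = 1"
    using \<open>\<sigma> > 0\<close> by (simp add: ennreal_mult[symmetric] del: ennreal_1 )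
  ultimately show "emeasure (distr lborel borel (\<lambda>x. \<sigma> *\<^sub>R A x + a)) X =
      emeasure (density lborel (\<lambda>_. ennreal (1 / \<sigma> ^ CARD('n)))) X"
    by (simp add: emeasure_density nn_integral_cmult mult.assoc[symmetric])
qed simp

lemma integral_similarity:
  fixes A :: "real^'n::{finite,wellorder} \<Rightarrow> real^'n::_"
    and g :: "real^'n::_ \<Rightarrow> 'b::{banach, second_countable_topology}"
  assumes A: "orthogonal_transformation A" and "\<sigma> > 0" and g[measurable]: "g \<in> borel_measurable borel"
  shows "(\<integral>x. g (\<sigma> *\<^sub>R A x + a) \<partial>lborel) = (\<integral>x. g x \<partial>lborel) /\<^sub>R \<sigma> ^ CARD('n)"
proof -
  note [measurable] = orthogonal_transformation_measurable[OF A]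
  have "(\<integral>x. g (\<sigma> *\<^sub>R A x + a) \<partial>lborel) = (\<integral>x. g x \<partial>distr lborel borel (\<lambda>x. \<sigma> *\<^sub>R A x + a))"
    by (subst integral_distr) simp_all
  then show ?thesis
    unfolding lborel_distr_similarity[OF A \<open>\<sigma> > 0\<close>, of a] using \<open>\<sigma> > 0\<close> by (simp add: integral_density divide_inverse)
qed

lemma AE_similarity:
  fixes A :: "real^'n::{finite,wellorder} \<Rightarrow> real^'n::_"
  assumes A: "orthogonal_transformation A" and "\<sigma> > 0" and P: "AE x in lborel. P x"
  shows "AE x in lborel. P (\<sigma> *\<^sub>R A x + a)"
proof -
  note [measurable] = orthogonal_transformation_measurable[OF A]
  obtain N where N: "N \<in> null_sets lborel" "{x. \<not> P x} \<subseteq> N"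
    using P by (auto simp: eventually_ae_filter)
  then have "AE x in lborel. x \<notin> N" by (simp add: AE_not_in)
  then have "AE x in distr lborel borel (\<lambda>x. \<sigma> *\<^sub>R A x + a). x \<notin> N"
    unfolding lborel_distr_similarity[OF A \<open>\<sigma> > 0\<close>] using N
    by (subst AE_density) auto
  then have "AE x in lborel. \<sigma> *\<^sub>R A x + a \<notin> N"
    using N by (subst (asm) AE_distr_iff) (auto simp: null_sets_def)
  then show ?thesis using N(2) by (auto elim: AE_mp)
qed

text \<open>Riesz-Fischer, by Chebyshev and Borel-Cantelli along a fast subsequence and then Fatou.
  Distances are kept as integrals of p-th powers, here and below, so that no roots have to be
  taken.\<close>

lemma Lp_complete:
  fixes u :: "nat \<Rightarrow> 'a \<Rightarrow> 'b::{banach, second_countable_topology}" and p :: nat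
  assumes u[measurable]: "\<And>k. u k \<in> borel_measurable M" and "p > 0"
    and C: "\<And>e. e > 0 \<Longrightarrow> \<exists>N. \<forall>k\<ge>N. \<forall>l\<ge>N. (\<integral>\<^sup>+x. ennreal (norm (u k x - u l x) ^ p) \<partial>M) \<le> ennreal e"
  obtains r v where "strict_mono r" "v \<in> borel_measurable M" "AE x in M. (\<lambda>k. u (r k) x) \<longlonglongrightarrow> v x"
    "(\<lambda>k. \<integral>\<^sup>+x. ennreal (norm (u k x - v x) ^ p) \<partial>M) \<longlonglongrightarrow> 0"
proof -
  \<comment> \<open>Chebyshev at height \<open>(1/2) ^ k\<close> costs a factor
    \<open>2 ^ (k * p)\<close>, so this tolerance leaves the summable bound \<open>(1/2) ^ k\<close>
    for the exceptional sets.\<close>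
  let ?e = "\<lambda>k::nat. (1/2::real) ^ (k * Suc p)"
  have "\<forall>k. \<exists>N. \<forall>i\<ge>N. \<forall>j\<ge>N. (\<integral>\<^sup>+x. ennreal (norm (u i x - u j x) ^ p) \<partial>M) \<le> ennreal (?e k)"
    by (intro allI C) simp
  from choice[OF this] obtain N where
    N: "\<And>k i j. i \<ge> N k \<Longrightarrow> j \<ge> N k \<Longrightarrow> (\<integral>\<^sup>+x. ennreal (norm (u i x - u j x) ^ p) \<partial>M) \<le> ennreal (?e k)"
    by blast
  \<comment> \<open>Partial sums make the indices strictly increasing while keeping
    \<open>r k\<close> above \<open>N k\<close>.\<close>
  define r where "r k = (\<Sum>i\<le>k. Suc (N i))" for k
  have r: "strict_mono r" by (simp add: strict_mono_Suc_iff r_def)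
  have rN: "r k \<ge> N k" for k
    unfolding r_def using member_le_sum[of k "{..k}" "\<lambda>i. Suc (N i)"] by simp
  define A where "A k = {x \<in> space M. (1/2) ^ k \<le> norm (u (r (Suc k)) x - u (r k) x)}" for k
  have A[measurable]: "A k \<in> sets M" for k unfolding A_def by measurable
  have mA: "emeasure M (A k) \<le> ennreal ((1/2)^k)" for k
  proof -
    have "emeasure M (A k) = (\<integral>\<^sup>+x. indicator (A k) x \<partial>M)" by simp
    also have "\<dots> \<le> (\<integral>\<^sup>+x. ennreal (2 ^ (k*p)) * ennreal (norm (u (r (Suc k)) x - u (r k) x) ^ p) \<partial>M)"
    proof (rule nn_integral_mono)
      fix x assume "x \<in> space M"
      show "indicator (A k) x \<le> ennreal (2 ^ (k*p)) * ennreal (norm (u (r (Suc k)) x - u (r k) x) ^ p)"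
      proof (cases "x \<in> A k")
        case True
        then have "((1/2)^k)^p \<le> norm (u (r (Suc k)) x - u (r k) x) ^ p"
          by (intro power_mono) (auto simp: A_def)
        then have "1 \<le> 2 ^ (k*p) * norm (u (r (Suc k)) x - u (r k) x) ^ p"
          by (simp add: power_mult[symmetric] power_one_over field_simps)
        then show ?thesis using True by (simp add: ennreal_mult[symmetric] flip: ennreal_1)
      qed simp
    qed
    also have "\<dots> = ennreal (2 ^ (k*p)) * (\<integral>\<^sup>+x. ennreal (norm (u (r (Suc k)) x - u (r k) x) ^ p) \<partial>M)"
      by (rule nn_integral_cmult) measurable
    also have "\<dots> \<le> ennreal (2 ^ (k*p)) * ennreal (?e k)"
      by (intro mult_left_mono N order_trans[OF rN] monoD[OF strict_mono_mono[OF r]]) auto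
    also have "\<dots> = ennreal ((1/2)^k)"
      by (simp add: ennreal_mult[symmetric] power_add power_mult power_one_over field_simps)
    finally show ?thesis .
  qed
  have "AE x in M. eventually (\<lambda>k. x \<in> space M - A k) sequentially"
  proof (rule borel_cantelli_AE1)
    show "emeasure M (A k) < \<infinity>" for k using mA[of k] by (auto intro: le_less_trans)
    show "summable (\<lambda>k. measure M (A k))"
    proof (rule summable_comparison_test')
      show "summable (\<lambda>k. (1/2::real)^k)" by (rule summable_geometric) simp
      show "norm (measure M (A k)) \<le> (1/2)^k" if "0 \<le> k" for k
        using mA[of k] by (simp add: measure_def enn2real_leI)
    qed
  qed simp
  then have cv: "AE x in M. convergent (\<lambda>k. u (r k) x)"
  proof (rule AE_mp, intro AE_I2 impI)
    fix x assume "x \<in> space M" "eventually (\<lambda>k. x \<in> space M - A k) sequentially"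
    then have "eventually (\<lambda>k. norm (u (r (Suc k)) x - u (r k) x) \<le> (1/2)^k) sequentially"
      by (auto elim!: eventually_mono simp: A_def)
    then have "summable (\<lambda>k. u (r (Suc k)) x - u (r k) x)"
      by (rule summable_comparison_test_ev) (rule summable_geometric, simp)
    then have "convergent (\<lambda>n. \<Sum>k<n. u (r (Suc k)) x - u (r k) x)"
      by (simp add: summable_iff_convergent)
    then have "convergent (\<lambda>n. u (r n) x - u (r 0) x)" by (simp add: sum_lessThan_telescope[of "\<lambda>k. u (r k) x"])
    from convergent_add[OF this convergent_const[of "u (r 0) x"]] show "convergent (\<lambda>k. u (r k) x)" by simp
  qed
  define v where "v x = lim (\<lambda>k. u (r k) x)" for x
  have v[measurable]: "v \<in> borel_measurable M" unfolding v_def by measurable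
  have AEv: "AE x in M. (\<lambda>k. u (r k) x) \<longlonglongrightarrow> v x"
    using cv by (auto simp: v_def convergent_LIMSEQ_iff)
  have "(\<lambda>k. \<integral>\<^sup>+x. ennreal (norm (u k x - v x) ^ p) \<partial>M) \<longlonglongrightarrow> 0"
  proof (rule tendsto_zero_ennreal)
    fix e :: real assume "e > 0"
    then obtain N where N: "\<And>k l. k \<ge> N \<Longrightarrow> l \<ge> N \<Longrightarrow> (\<integral>\<^sup>+x. ennreal (norm (u k x - u l x) ^ p) \<partial>M) \<le> ennreal (e/2)"
      using C[of "e/2"] by auto
    have "(\<integral>\<^sup>+x. ennreal (norm (u k x - v x) ^ p) \<partial>M) < ennreal e" if "k \<ge> N" for k
    proof -
      have "(\<integral>\<^sup>+x. ennreal (norm (u k x - v x) ^ p) \<partial>M) =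
        (\<integral>\<^sup>+x. liminf (\<lambda>j. ennreal (norm (u k x - u (r j) x) ^ p)) \<partial>M)"
      proof (rule nn_integral_cong_AE, rule AE_mp[OF AEv], intro AE_I2 impI)
        fix x assume "(\<lambda>k. u (r k) x) \<longlonglongrightarrow> v x"
        then have "(\<lambda>j. ennreal (norm (u k x - u (r j) x) ^ p)) \<longlonglongrightarrow> ennreal (norm (u k x - v x) ^ p)"
          by (intro tendsto_ennrealI tendsto_intros)
        then show "ennreal (norm (u k x - v x) ^ p) = liminf (\<lambda>j. ennreal (norm (u k x - u (r j) x) ^ p))"
          by (rule lim_imp_Liminf[symmetric, rotated]) simp
      qed
      also have "\<dots> \<le> liminf (\<lambda>j. \<integral>\<^sup>+x. ennreal (norm (u k x - u (r j) x) ^ p) \<partial>M)"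
        by (rule nn_integral_liminf) measurable
      also have "\<dots> \<le> ennreal (e/2)"
      proof (rule Liminf_le)
        show "\<forall>\<^sub>F j in sequentially. (\<integral>\<^sup>+x. ennreal (norm (u k x - u (r j) x) ^ p) \<partial>M) \<le> ennreal (e/2)"
          using that strict_mono_imp_increasing[OF r]
          by (intro eventually_sequentiallyI[of N] N) (auto intro: order_trans)
      qed simp
      also have "\<dots> < ennreal e" using \<open>e > 0\<close> by (simp add: ennreal_less_iff)
      finally show ?thesis .
    qed
    then show "\<forall>\<^sub>F k in sequentially. (\<integral>\<^sup>+x. ennreal (norm (u k x - v x) ^ p) \<partial>M) < ennreal e"
      by (auto simp: eventually_sequentially)
  qed
  then show ?thesis using r v AEv that by blast
qed

section \<open>Test functions and the Sobolev inequality\<close>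

lemma C_diff_differentiable: "C_diff (Suc k) \<phi> \<Longrightarrow> \<phi> differentiable (at x)"
  by simp

lemma C_diff_continuous: "C_diff k \<phi> \<Longrightarrow> continuous_on UNIV \<phi>"
  by (cases k) (auto intro!: differentiable_imp_continuous_on simp: differentiable_on_def differentiable_at_imp_differentiable_on)

lemma C_diff_const: "C_diff k (\<lambda>x. c)"
  by (induction k arbitrary: c) (auto simp: frechet_derivative_const)

lemma C_diff_add:
  "C_diff k \<phi> \<Longrightarrow> C_diff k \<psi> \<Longrightarrow> C_diff k (\<lambda>x. \<phi> x + \<psi> x)"
proof (induction k arbitrary: \<phi> \<psi>)
  case 0
  then show ?case by (auto intro: continuous_intros)
next
  case (Suc k)
  have "frechet_derivative (\<lambda>x. \<phi> x + \<psi> x) (at x) = (\<lambda>h. frechet_derivative \<phi> (at x) h + frechet_derivative \<psi> (at x) h)" for x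
    using Suc.prems by (intro frechet_derivative_at[symmetric] derivative_intros) (auto simp: frechet_derivative_works)
  then show ?case using Suc by (auto intro: differentiable_add)
qed

lemma C_diff_sum:
  "finite I \<Longrightarrow> (\<And>i. i \<in> I \<Longrightarrow> C_diff k (\<phi> i)) \<Longrightarrow> C_diff k (\<lambda>x. \<Sum>i\<in>I. \<phi> i x)"
  by (induction I rule: finite_induct) (auto intro: C_diff_add C_diff_const)

lemma frechet_derivative_affine_compose:
  fixes \<phi> :: "'a::euclidean_space \<Rightarrow> 'b::euclidean_space" and L :: "'b \<Rightarrow> 'c::euclidean_space"
    and B :: "'d::euclidean_space \<Rightarrow> 'a"
  assumes "\<And>x. \<phi> differentiable (at x)" "linear L" "linear B"
  shows "((\<lambda>x. L (\<phi> (B x + a))) has_derivative (\<lambda>h. L (frechet_derivative \<phi> (at (B x + a)) (B h)))) (at x)"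
proof -
  have "(B has_derivative B) (at x)" using \<open>linear B\<close> by (rule linear_imp_has_derivative)
  then have "((\<lambda>x. B x + a) has_derivative (\<lambda>h. B h + 0)) (at x)"
    by (intro derivative_intros)
  then have 1: "((\<lambda>x. B x + a) has_derivative B) (at x)" by simp
  have 2: "(\<phi> has_derivative frechet_derivative \<phi> (at (B x + a))) (at (B x + a))"
    using assms(1) frechet_derivative_works by blast
  have "((\<lambda>x. \<phi> (B x + a)) has_derivative (\<lambda>h. frechet_derivative \<phi> (at (B x + a)) (B h))) (at x)"
    using has_derivative_compose[OF 1 2] by simp
  from has_derivative_compose[OF this linear_imp_has_derivative[OF \<open>linear L\<close>]]
  show ?thesis by simp
qed

lemma frechet_derivative_axis_sum:
  fixes \<phi> :: "real^'n \<Rightarrow> 'b::euclidean_space"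
  assumes "\<phi> differentiable (at x)"
  shows "frechet_derivative \<phi> (at x) h = (\<Sum>j\<in>UNIV. (h $ j) *\<^sub>R frechet_derivative \<phi> (at x) (axis j 1))"
proof -
  have l: "linear (frechet_derivative \<phi> (at x))" using assms by (rule linear_frechet_derivative)
  have "h = (\<Sum>j\<in>UNIV. (h $ j) *\<^sub>R axis j 1)"
    using basis_expansion[of h] by (simp add: scalar_mult_eq_scaleR)
  then have "frechet_derivative \<phi> (at x) h = frechet_derivative \<phi> (at x) (\<Sum>j\<in>UNIV. (h $ j) *\<^sub>R axis j 1)" by simp
  also have "\<dots> = (\<Sum>j\<in>UNIV. (h $ j) *\<^sub>R frechet_derivative \<phi> (at x) (axis j 1))"
    using l by (simp add: linear_sum linear_cmul)
  finally show ?thesis .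
qed

text \<open>\<open>L\<close> must vary in the induction: by the chain rule a partial derivative of
  the composite is a sum of terms of the same shape, in which \<open>L\<close> is rescaled by an
  entry of \<open>B\<close>.\<close>

lemma C_diff_affine:
  assumes "C_diff k \<phi>" "linear L" "linear B"
  shows "C_diff k (\<lambda>x. L (\<phi> (B x + a)))"
  using assms(1,2)
proof (induction k arbitrary: \<phi> L)
  case 0
  have "continuous_on UNIV (\<lambda>x. B x + a)"
    using \<open>linear B\<close> by (intro continuous_intros linear_continuous_on linear_conv_bounded_linear[THEN iffD1])
  moreover have "continuous_on UNIV L"
    using \<open>linear L\<close> by (intro linear_continuous_on linear_conv_bounded_linear[THEN iffD1])
  ultimately show ?case using 0
    by (auto intro!: continuous_on_compose2[of UNIV L] continuous_on_compose2[of UNIV \<phi>])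
next
  case (Suc k)
  have d: "\<phi> differentiable (at x)" for x using Suc.prems by simp
  note D = frechet_derivative_affine_compose[OF d \<open>linear L\<close> \<open>linear B\<close>, of a]
  have "frechet_derivative (\<lambda>x. L (\<phi> (B x + a))) (at x) (axis i 1) =
      (\<Sum>j\<in>UNIV. (B (axis i 1) $ j) *\<^sub>R L (frechet_derivative \<phi> (at (B x + a)) (axis j 1)))" for x i
    unfolding frechet_derivative_at[OF D, symmetric]
    using Suc.prems(2) by (subst frechet_derivative_axis_sum[OF d]) (simp add: linear_sum linear_cmul)
  moreover have "C_diff k (\<lambda>x. \<Sum>j\<in>UNIV. (B (axis i 1) $ j) *\<^sub>R L (frechet_derivative \<phi> (at (B x + a)) (axis j 1)))" for i
  proof (intro C_diff_sum)
    fix j :: 3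
    have "linear (\<lambda>z. (B (axis i 1) $ j) *\<^sub>R L z)"
      using Suc.prems(2) by (intro linear_compose_scale_right)
    from Suc.IH[OF _ this, of "\<lambda>x. frechet_derivative \<phi> (at x) (axis j 1)"] Suc.prems(1)
    show "C_diff k (\<lambda>x. (B (axis i 1) $ j) *\<^sub>R L (frechet_derivative \<phi> (at (B x + a)) (axis j 1)))" by simp
  qed simp
  moreover have "(\<lambda>x. L (\<phi> (B x + a))) differentiable (at x)" for x
    using D[of x] by (rule differentiableI)
  ultimately show ?case by simp
qed

lemma test_function_differentiable: "test_function \<phi> \<Longrightarrow> \<phi> differentiable (at x)"
  unfolding test_function_def using C_diff_differentiable by blast

lemma test_function_continuous: "test_function \<phi> \<Longrightarrow> continuous_on UNIV \<phi>"
  unfolding test_function_def using C_diff_continuous by blast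

lemma test_function_iff: "test_function \<phi> \<longleftrightarrow> (\<forall>k. C_diff k \<phi>) \<and> bounded {x. \<phi> x \<noteq> 0}"
  by (auto simp: test_function_def)

lemma test_function_add:
  assumes "test_function \<phi>" "test_function \<psi>"
  shows "test_function (\<lambda>x. \<phi> x + \<psi> x)"
proof -
  have "{x. \<phi> x + \<psi> x \<noteq> 0} \<subseteq> {x. \<phi> x \<noteq> 0} \<union> {x. \<psi> x \<noteq> 0}" by auto
  then show ?thesis using assms C_diff_add
    by (auto simp: test_function_iff intro: bounded_subset[of "{x. \<phi> x \<noteq> 0} \<union> {x. \<psi> x \<noteq> 0}"])
qed

lemma test_function_similarity:
  assumes "test_function \<phi>" "linear L" "orthogonal_transformation A" "\<sigma> > 0"
  shows "test_function (\<lambda>x. L (\<phi> (\<sigma> *\<^sub>R A x + a)))"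
proof -
  have lin: "linear (\<lambda>x. \<sigma> *\<^sub>R A x)"
    using assms(3) by (intro linear_compose_scale_right orthogonal_transformation_linear)
  obtain R where R: "\<And>x. \<phi> x \<noteq> 0 \<Longrightarrow> norm x \<le> R" using assms(1) by (auto simp: test_function_iff bounded_iff)
  have "norm x \<le> (R + norm a) / \<sigma>" if "L (\<phi> (\<sigma> *\<^sub>R A x + a)) \<noteq> 0" for x
  proof -
    have "\<phi> (\<sigma> *\<^sub>R A x + a) \<noteq> 0" using that linear_0[OF assms(2)] by metis
    then have "norm (\<sigma> *\<^sub>R A x + a) \<le> R" by (rule R)
    moreover have "norm (\<sigma> *\<^sub>R A x) \<le> norm (\<sigma> *\<^sub>R A x + a) + norm a"
      by (metis add_diff_cancel_right' norm_triangle_ineq4)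
    ultimately have "\<sigma> * norm x \<le> R + norm a"
      using assms(3,4) by (simp add: orthogonal_transformation_norm)
    then show ?thesis using \<open>\<sigma> > 0\<close> by (simp add: field_simps)
  qed
  then have "bounded {x. L (\<phi> (\<sigma> *\<^sub>R A x + a)) \<noteq> 0}" by (auto simp: bounded_iff)
  then show ?thesis using assms(1) C_diff_affine[OF _ assms(2) lin] by (auto simp: test_function_iff)
qed

text \<open>The action of a pair of linear maps on gradients: the gradient of x -> L (\<phi> (A x))
  at x is \<open>pull L A\<close> of the gradient of \<phi> at A x. The coefficients are the matrix
  entries of \<open>A\<close>.\<close>

definition pull :: "(complex \<Rightarrow> complex) \<Rightarrow> (real^3 \<Rightarrow> real^3) \<Rightarrow> complex^3 \<Rightarrow> complex^3" where
  "pull L A W = (\<chi> i. \<Sum>j\<in>UNIV. (A (axis i 1) $ j) *\<^sub>R L (W $ j))"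

lemma linear_pull: "linear L \<Longrightarrow> linear (pull L A)"
  by (rule linearI) (auto simp: pull_def vec_eq_iff linear_add linear_cmul scaleR_add_right sum.distrib
      scaleR_sum_right mult.commute)

text \<open>The entries \<open>A (axis i 1) $ j\<close> form an orthogonal matrix, whose rows are
  orthonormal, so the cross terms cancel after summation over i; \<open>L\<close> preserves the
  remaining products of components.\<close>

lemma inner_pull:
  assumes L: "orthogonal_transformation L" and A: "orthogonal_transformation A"
  shows "pull L A V \<bullet> pull L A W = V \<bullet> W"
proof -
  have m: "(\<Sum>i\<in>UNIV. A (axis i 1) $ j * A (axis i 1) $ k) = (if j = k then 1 else 0)" for j k
  proof -
    have "orthogonal_matrix (matrix A)" using A by (simp add: orthogonal_transformation_matrix)
    then have "(matrix A ** transpose (matrix A)) $ j $ k = mat 1 $ j $ k"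
      by (simp add: orthogonal_matrix_def)
    then show ?thesis by (simp add: matrix_matrix_mult_def transpose_def matrix_def mat_def)
  qed
  have "pull L A V \<bullet> pull L A W = (\<Sum>i\<in>UNIV. \<Sum>j\<in>UNIV. \<Sum>k\<in>UNIV. (A (axis i 1) $ j * A (axis i 1) $ k) * (V $ k \<bullet> W $ j))"
    using L by (simp add: pull_def inner_vec_def inner_sum_left inner_sum_right orthogonal_transformation_def
        mult.assoc sum_distrib_left)
  also have "\<dots> = (\<Sum>j\<in>UNIV. \<Sum>i\<in>UNIV. \<Sum>k\<in>UNIV. (A (axis i 1) $ j * A (axis i 1) $ k) * (V $ k \<bullet> W $ j))"
    by (rule sum.swap)
  also have "\<dots> = (\<Sum>j\<in>UNIV. \<Sum>k\<in>UNIV. \<Sum>i\<in>UNIV. (A (axis i 1) $ j * A (axis i 1) $ k) * (V $ k \<bullet> W $ j))"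
    by (intro sum.cong sum.swap refl)
  also have "\<dots> = (\<Sum>j\<in>UNIV. \<Sum>k\<in>UNIV. (if j = k then 1 else 0) * (V $ k \<bullet> W $ j))"
    by (simp only: sum_distrib_right[symmetric] m)
  also have "\<dots> = (\<Sum>j\<in>UNIV. V $ j \<bullet> W $ j)"
    by (simp add: if_distrib[of "\<lambda>t. t * _"] sum.delta cong: if_cong)
  finally show ?thesis by (simp add: inner_vec_def)
qed

lemma pull_id: "pull (\<lambda>z. z) (\<lambda>x. x) W = W"
  by (simp add: pull_def vec_eq_iff axis_def if_distrib[of "\<lambda>t. t *\<^sub>R _"] cong: if_cong)

lemma pull_linear_id: "pull L (\<lambda>x. x) W = (\<chi> i. L (W $ i))"
  by (simp add: pull_def vec_eq_iff axis_def if_distrib[of "\<lambda>t. t *\<^sub>R _"] cong: if_cong)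

lemma grad_similarity:
  assumes "test_function \<phi>" "linear L" "orthogonal_transformation A"
  shows "grad (\<lambda>x. L (\<phi> (\<sigma> *\<^sub>R A x + a))) x = \<sigma> *\<^sub>R pull L A (grad \<phi> (\<sigma> *\<^sub>R A x + a))"
proof -
  have d: "\<phi> differentiable (at x)" for x using assms(1) by (rule test_function_differentiable)
  have lin: "linear (\<lambda>x. \<sigma> *\<^sub>R A x)"
    using assms(3) by (intro linear_compose_scale_right orthogonal_transformation_linear)
  note D = frechet_derivative_affine_compose[OF d \<open>linear L\<close> lin, of a]
  have "L (frechet_derivative \<phi> (at y) (\<sigma> *\<^sub>R A (axis i 1))) =
      \<sigma> *\<^sub>R (\<Sum>j\<in>UNIV. (A (axis i 1) $ j) *\<^sub>R L (frechet_derivative \<phi> (at y) (axis j 1)))" for y i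
    using assms(2) by (subst frechet_derivative_axis_sum[OF d]) (simp add: linear_sum linear_cmul scaleR_sum_right)
  then show ?thesis
    by (simp add: grad_def pull_def vec_eq_iff frechet_derivative_at[OF D, symmetric])
qed

lemma grad_add:
  assumes "test_function \<phi>" "test_function \<psi>"
  shows "grad (\<lambda>x. \<phi> x + \<psi> x) x = grad \<phi> x + grad \<psi> x"
proof -
  have "frechet_derivative (\<lambda>x. \<phi> x + \<psi> x) (at x) = (\<lambda>h. frechet_derivative \<phi> (at x) h + frechet_derivative \<psi> (at x) h)"
    using assms by (intro frechet_derivative_at[symmetric] derivative_intros)
      (auto simp: frechet_derivative_works[symmetric] test_function_differentiable)
  then show ?thesis by (simp add: grad_def vec_eq_iff)
qed

lemma continuous_grad: "test_function \<phi> \<Longrightarrow> continuous_on UNIV (grad \<phi>)"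
  unfolding grad_def test_function_def
  by (intro continuous_on_vec_lambda) (auto dest!: spec[of _ "Suc 0"])

lemma grad_eq_zero:
  fixes \<phi> :: "real^3 \<Rightarrow> complex" and x :: "real^3"
  assumes "x \<notin> closure {x. \<phi> x \<noteq> 0}" shows "grad \<phi> x = 0"
proof -
  have "(\<phi> has_derivative (\<lambda>h. 0)) (at x)"
  proof (rule has_derivative_transform_within_open)
    show "((\<lambda>x::real^3. 0::complex) has_derivative (\<lambda>h. 0)) (at x)" by simp
    show "open (- closure {x. \<phi> x \<noteq> 0})" by (simp add: open_Compl)
    show "x \<in> - closure {x. \<phi> x \<noteq> 0}" using assms by simp
    show "0 = \<phi> y" if "y \<in> - closure {x. \<phi> x \<noteq> 0}" for y
      using that closure_subset[of "{x. \<phi> x \<noteq> 0}"] by auto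
  qed
  then have "frechet_derivative \<phi> (at x) = (\<lambda>h. 0)" by (simp add: frechet_derivative_at[symmetric])
  then show ?thesis by (simp add: grad_def vec_eq_iff)
qed

lemma test_function_bounded_support:
  assumes "test_function \<phi>"
  obtains R where "R > 0" "\<And>x. norm x \<ge> R \<Longrightarrow> \<phi> x = 0" "\<And>x. norm x \<ge> R \<Longrightarrow> grad \<phi> x = 0"
proof -
  have "bounded (closure {x. \<phi> x \<noteq> 0})" using assms by (auto simp: test_function_iff)
  then obtain R where R: "R > 0" "\<And>x. x \<in> closure {x. \<phi> x \<noteq> 0} \<Longrightarrow> norm x < R"
    unfolding bounded_pos_less by blast
  show ?thesis
  proof (rule that[OF R(1)])
    fix x :: "real^3" assume "norm x \<ge> R"
    then have "x \<notin> closure {x. \<phi> x \<noteq> 0}" using R(2) by force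
    then show "\<phi> x = 0" "grad \<phi> x = 0"
      using grad_eq_zero closure_subset[of "{x. \<phi> x \<noteq> 0}"] by auto
  qed
qed

lemma test_function_has_derivative:
  assumes "test_function \<phi>"
  shows "(\<phi> has_derivative (\<lambda>h. \<Sum>j\<in>UNIV. (h $ j) *\<^sub>R (grad \<phi> x $ j))) (at x)"
proof -
  have d: "\<phi> differentiable (at x)" using assms by (rule test_function_differentiable)
  have "frechet_derivative \<phi> (at x) = (\<lambda>h. \<Sum>j\<in>UNIV. (h $ j) *\<^sub>R (grad \<phi> x $ j))"
    unfolding grad_def vec_lambda_beta by (rule ext, rule frechet_derivative_axis_sum[OF d])
  with d show ?thesis unfolding frechet_derivative_works by simp
qed

lemma norm_derivative_le: "norm (\<Sum>j\<in>UNIV. (h $ j) *\<^sub>R (W $ j)) \<le> norm h * norm (W :: complex^'n)"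
proof -
  have "norm (\<Sum>j\<in>UNIV. (h $ j) *\<^sub>R (W $ j)) \<le> (\<Sum>j\<in>UNIV. \<bar>h $ j\<bar> * norm (W $ j))"
    by (rule order_trans[OF norm_sum]) simp
  also have "\<dots> \<le> L2_set (\<lambda>j. \<bar>h $ j\<bar>) UNIV * L2_set (\<lambda>j. norm (W $ j)) UNIV"
    using L2_set_mult_ineq[of "\<lambda>j. \<bar>h $ j\<bar>" "\<lambda>j. norm (W $ j)" UNIV] by simp
  also have "\<dots> = norm h * norm W" by (simp add: norm_vec_def)
  finally show ?thesis .
qed

lemma integrable_test_function_like:
  fixes g :: "real^3 \<Rightarrow> 'b::euclidean_space"
  assumes "continuous_on UNIV g" "\<And>x. norm x \<ge> R \<Longrightarrow> g x = 0"
  shows "integrable lborel g"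
proof -
  have "integrable lborel (\<lambda>x. indicator (cball 0 R) x *\<^sub>R g x)"
    using assms(1) by (intro borel_integrable_compact) (auto intro: continuous_on_subset)
  moreover have "(\<lambda>x. indicator (cball 0 R) x *\<^sub>R g x) = g"
    using assms(2) by (auto simp: indicator_def fun_eq_iff not_le less_imp_le)
  ultimately show ?thesis by simp
qed

lemma norm_diff_le_nn_integral:
  fixes g :: "real \<Rightarrow> 'b::euclidean_space"
  assumes "a \<le> b" "\<And>t. a \<le> t \<Longrightarrow> t \<le> b \<Longrightarrow> (g has_vector_derivative g' t) (at t within {a..b})"
    "continuous_on {a..b} g'"
  shows "ennreal (norm (g b - g a)) \<le> (\<integral>\<^sup>+t. ennreal (norm (g' t)) * indicator {a..b} t \<partial>lborel)"
proof -
  have "(\<integral>t. indicator {a..b} t *\<^sub>R g' t \<partial>lborel) = g b - g a"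
    using assms by (rule integral_FTC_atLeastAtMost)
  moreover have "integrable lborel (\<lambda>t. indicator {a..b} t *\<^sub>R g' t)"
    using assms(3) by (intro borel_integrable_compact) auto
  ultimately have "ennreal (norm (g b - g a)) \<le> (\<integral>\<^sup>+t. ennreal (norm (indicator {a..b} t *\<^sub>R g' t)) \<partial>lborel)"
    using integral_norm_bound_ennreal by metis
  also have "\<dots> = (\<integral>\<^sup>+t. ennreal (norm (g' t)) * indicator {a..b} t \<partial>lborel)"
    by (intro nn_integral_cong) (auto simp: indicator_def)
  finally show ?thesis .
qed

lemma test_function_measurable:
  assumes "test_function \<phi>"
  shows "\<phi> \<in> borel_measurable borel" "grad \<phi> \<in> borel_measurable borel"
  using test_function_continuous[OF assms] continuous_grad[OF assms]
  by (auto intro: borel_measurable_continuous_onI)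

lemma test_function_line:
  assumes "test_function \<phi>"
  shows "((\<lambda>t. \<phi> (x + t *\<^sub>R h)) has_vector_derivative (\<Sum>j\<in>UNIV. (h $ j) *\<^sub>R (grad \<phi> (x + t *\<^sub>R h) $ j))) (at t within S)"
proof -
  have "((\<lambda>t. x + t *\<^sub>R h) has_vector_derivative 0 + 1 *\<^sub>R h) (at t within S)"
    by (auto intro!: derivative_eq_intros simp: has_vector_derivative_def)
  then have "((\<lambda>t. x + t *\<^sub>R h) has_vector_derivative h) (at t within S)" by simp
  from vector_derivative_diff_chain_within[OF this has_derivative_at_withinI[OF test_function_has_derivative[OF assms]]]
  show ?thesis by (simp add: o_def)
qed

lemma continuous_on_grad_line:
  assumes "test_function \<phi>"
  shows "continuous_on S (\<lambda>t. \<Sum>j\<in>UNIV. (h $ j) *\<^sub>R (grad \<phi> (x + t *\<^sub>R h) $ j))"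
proof -
  have "continuous_on S (\<lambda>t. grad \<phi> (x + t *\<^sub>R h))"
    by (rule continuous_on_compose2[OF continuous_grad[OF assms]]) (auto intro!: continuous_intros)
  then show ?thesis by (intro continuous_intros)
qed

text \<open>Integrate the derivative along the segment from x to x + h, apply Cauchy-Schwarz in the
  parameter, and use Tonelli with translation invariance to remove the parameter again.\<close>

lemma translation_estimate_test:
  assumes "test_function \<phi>"
  shows "(\<integral>\<^sup>+x. ennreal ((norm (\<phi> (x + h) - \<phi> x))\<^sup>2) \<partial>lborel)
    \<le> ennreal ((norm h)\<^sup>2) * (\<integral>\<^sup>+x. ennreal ((norm (grad \<phi> x))\<^sup>2) \<partial>lborel)"
proof -
  note [measurable] = test_function_measurable[OF assms]
  let ?G = "\<lambda>x. ennreal (norm (grad \<phi> x))"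
  let ?I = "\<lambda>t::real. indicator {0..1} t :: ennreal"
  have "ennreal ((norm (\<phi> (x + h) - \<phi> x))\<^sup>2) \<le> ennreal ((norm h)\<^sup>2) * (\<integral>\<^sup>+t. (?G (x + t *\<^sub>R h))\<^sup>2 * ?I t \<partial>lborel)" for x
  proof -
    have "ennreal (norm (\<phi> (x + 1 *\<^sub>R h) - \<phi> (x + 0 *\<^sub>R h))) \<le>
      (\<integral>\<^sup>+t. ennreal (norm (\<Sum>j\<in>UNIV. (h $ j) *\<^sub>R (grad \<phi> (x + t *\<^sub>R h) $ j))) * ?I t \<partial>lborel)"
      by (rule norm_diff_le_nn_integral[where g="\<lambda>t. \<phi> (x + t *\<^sub>R h)"])
         (auto intro: test_function_line[OF assms] continuous_on_grad_line[OF assms])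
    also have "\<dots> \<le> (\<integral>\<^sup>+t. ennreal (norm h) * (?G (x + t *\<^sub>R h) * ?I t) \<partial>lborel)"
      by (intro nn_integral_mono)
        (auto simp: indicator_def ennreal_mult[symmetric] intro!: ennreal_leI norm_derivative_le)
    also have "\<dots> = ennreal (norm h) * (\<integral>\<^sup>+t. ?G (x + t *\<^sub>R h) * ?I t \<partial>lborel)"
      by (rule nn_integral_cmult) measurable
    finally have "(ennreal (norm (\<phi> (x + h) - \<phi> x)))\<^sup>2 \<le> (ennreal (norm h) * (\<integral>\<^sup>+t. ?G (x + t *\<^sub>R h) * ?I t \<partial>lborel))\<^sup>2"
      by (intro power_mono) auto
    \<comment> \<open>The indicator is doubled on purpose: one copy stays with the gradient, the
      other is the second factor in Cauchy-Schwarz and integrates to 1 over the unit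
      interval.\<close>
    also have "\<dots> = ennreal ((norm h)\<^sup>2) * (\<integral>\<^sup>+t. (?G (x + t *\<^sub>R h) * ?I t) * ?I t \<partial>lborel)\<^sup>2"
      by (simp add: power_mult_distrib ennreal_power mult.assoc flip: indicator_inter_arith)
    also have "\<dots> \<le> ennreal ((norm h)\<^sup>2) * ((\<integral>\<^sup>+t. (?G (x + t *\<^sub>R h) * ?I t)\<^sup>2 \<partial>lborel) * (\<integral>\<^sup>+t. (?I t)\<^sup>2 \<partial>lborel))"
      by (intro mult_left_mono Cauchy_Schwarz_nn_integral) auto
    also have "(\<integral>\<^sup>+t. (?I t)\<^sup>2 \<partial>lborel) = (\<integral>\<^sup>+t. ?I t \<partial>lborel)"
      by (intro nn_integral_cong) (auto simp: indicator_def)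
    also have "\<dots> = 1" by simp
    also have "(\<integral>\<^sup>+t. (?G (x + t *\<^sub>R h) * ?I t)\<^sup>2 \<partial>lborel) = (\<integral>\<^sup>+t. (?G (x + t *\<^sub>R h))\<^sup>2 * ?I t \<partial>lborel)"
      by (intro nn_integral_cong) (auto simp: indicator_def)
    finally show ?thesis by (simp add: ennreal_power)
  qed
  then have "(\<integral>\<^sup>+x. ennreal ((norm (\<phi> (x + h) - \<phi> x))\<^sup>2) \<partial>lborel) \<le>
      (\<integral>\<^sup>+x. ennreal ((norm h)\<^sup>2) * (\<integral>\<^sup>+t. (?G (x + t *\<^sub>R h))\<^sup>2 * ?I t \<partial>lborel) \<partial>lborel)"
    by (rule nn_integral_mono)
  also have "\<dots> = ennreal ((norm h)\<^sup>2) * (\<integral>\<^sup>+x. (\<integral>\<^sup>+t. (?G (x + t *\<^sub>R h))\<^sup>2 * ?I t \<partial>lborel) \<partial>lborel)"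
    by (rule nn_integral_cmult) measurable
  also have "(\<integral>\<^sup>+x. (\<integral>\<^sup>+t. (?G (x + t *\<^sub>R h))\<^sup>2 * ?I t \<partial>lborel) \<partial>lborel) =
     (\<integral>\<^sup>+t. (\<integral>\<^sup>+x. (?G (x + t *\<^sub>R h))\<^sup>2 * ?I t \<partial>lborel) \<partial>lborel)"
    by (rule lborel_pair.Fubini') measurable
  also have "\<dots> = (\<integral>\<^sup>+t. (\<integral>\<^sup>+x. (?G x)\<^sup>2 \<partial>lborel) * ?I t \<partial>lborel)"
  proof (rule nn_integral_cong)
    fix t :: real
    have "(\<integral>\<^sup>+x. (?G (x + t *\<^sub>R h))\<^sup>2 * ?I t \<partial>lborel) = (\<integral>\<^sup>+x. (?G (x + t *\<^sub>R h))\<^sup>2 \<partial>lborel) * ?I t"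
      by (rule nn_integral_multc) measurable
    moreover have "(\<integral>\<^sup>+x. (?G x)\<^sup>2 \<partial>lborel) = (\<integral>\<^sup>+x. (?G (x + t *\<^sub>R h))\<^sup>2 \<partial>lborel)"
      using nn_integral_similarity[of "\<lambda>x::real^3. x" 1 "\<lambda>x. (?G x)\<^sup>2" "t *\<^sub>R h"] by (simp add: orthogonal_transformation_id)
    ultimately show "(\<integral>\<^sup>+x. (?G (x + t *\<^sub>R h))\<^sup>2 * ?I t \<partial>lborel) = (\<integral>\<^sup>+x. (?G x)\<^sup>2 \<partial>lborel) * ?I t" by simp
  qed
  also have "\<dots> = (\<integral>\<^sup>+x. (?G x)\<^sup>2 \<partial>lborel)" by (simp add: nn_integral_cmult)
  finally show ?thesis by (simp add: ennreal_power)
qed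

section \<open>The Sobolev inequality, after Gagliardo and Nirenberg\<close>

definition ennsqrt :: "ennreal \<Rightarrow> ennreal" where
  "ennsqrt F = (if F = top then top else ennreal (sqrt (enn2real F)))"

lemma ennsqrt_measurable[measurable]: "ennsqrt \<in> borel_measurable borel"
  unfolding ennsqrt_def by measurable

lemma ennsqrt_square: "(ennsqrt F)\<^sup>2 = F"
  by (cases F) (auto simp: ennsqrt_def power2_eq_square ennreal_mult[symmetric] ennreal_mult_eq_top_iff)

lemma ennreal_power2_le_imp_le:
  assumes "a\<^sup>2 \<le> b\<^sup>2" shows "a \<le> (b::ennreal)"
proof (cases "b = top")
  case False
  then obtain s where s: "0 \<le> s" "b = ennreal s" by (cases b) auto
  have fin: "a\<^sup>2 < top"
    using assms s by (auto simp: ennreal_power intro: le_less_trans)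
  then have "a \<noteq> top" by (auto simp: power2_eq_square)
  then obtain r where r: "0 \<le> r" "a = ennreal r" by (cases a) auto
  have "r\<^sup>2 \<le> s\<^sup>2" using assms r s by (simp add: ennreal_power)
  then have "r \<le> s" using s(1) by (rule power2_le_imp_le)
  then show ?thesis using r s by (simp add: ennreal_leI)
qed simp

text \<open>Cauchy-Schwarz in a form that can be iterated under further integral signs; since the
  square root is total, no finiteness of inner integrals has to be tracked.\<close>

lemma nn_integral_ennsqrt_mult:
  assumes [measurable]: "f \<in> borel_measurable M" "g \<in> borel_measurable M"
  shows "(\<integral>\<^sup>+x. ennsqrt (f x) * ennsqrt (g x) \<partial>M) \<le> ennsqrt (\<integral>\<^sup>+x. f x \<partial>M) * ennsqrt (\<integral>\<^sup>+x. g x \<partial>M)"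
  by (rule ennreal_power2_le_imp_le)
     (use Cauchy_Schwarz_nn_integral[of "\<lambda>x. ennsqrt (f x)" M "\<lambda>x. ennsqrt (g x)"] in
       \<open>simp add: power_mult_distrib ennsqrt_square\<close>)

text \<open>Three Cauchy-Schwarz inequalities, in c, b and a in turn: each time exactly two of the
  three remaining factors depend on the variable that is integrated.\<close>

lemma Loomis_Whitney:
  fixes F1 F2 F3 :: "real \<Rightarrow> real \<Rightarrow> ennreal"
  assumes [measurable]: "case_prod F1 \<in> borel_measurable (lborel \<Otimes>\<^sub>M lborel)"
    "case_prod F2 \<in> borel_measurable (lborel \<Otimes>\<^sub>M lborel)" "case_prod F3 \<in> borel_measurable (lborel \<Otimes>\<^sub>M lborel)"
  shows "(\<integral>\<^sup>+a. \<integral>\<^sup>+b. \<integral>\<^sup>+c. ennsqrt (F3 a b) * (ennsqrt (F1 b c) * ennsqrt (F2 a c)) \<partial>lborel \<partial>lborel \<partial>lborel)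
    \<le> ennsqrt (\<integral>\<^sup>+b. \<integral>\<^sup>+c. F1 b c \<partial>lborel \<partial>lborel) *
       (ennsqrt (\<integral>\<^sup>+a. \<integral>\<^sup>+b. F3 a b \<partial>lborel \<partial>lborel) * ennsqrt (\<integral>\<^sup>+a. \<integral>\<^sup>+c. F2 a c \<partial>lborel \<partial>lborel))" (is "?L \<le> ?R")
proof -
  have "?L \<le> (\<integral>\<^sup>+a. \<integral>\<^sup>+b. ennsqrt (F3 a b) * (ennsqrt (\<integral>\<^sup>+c. F1 b c \<partial>lborel) * ennsqrt (\<integral>\<^sup>+c. F2 a c \<partial>lborel)) \<partial>lborel \<partial>lborel)"
    by (intro nn_integral_mono, subst nn_integral_cmult) (auto intro!: mult_left_mono nn_integral_ennsqrt_mult)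
  also have "\<dots> = (\<integral>\<^sup>+a. ennsqrt (\<integral>\<^sup>+c. F2 a c \<partial>lborel) * (\<integral>\<^sup>+b. ennsqrt (F3 a b) * ennsqrt (\<integral>\<^sup>+c. F1 b c \<partial>lborel) \<partial>lborel) \<partial>lborel)"
    by (intro nn_integral_cong, subst nn_integral_cmult[symmetric]) (auto simp: mult_ac)
  also have "\<dots> \<le> (\<integral>\<^sup>+a. ennsqrt (\<integral>\<^sup>+c. F2 a c \<partial>lborel) * (ennsqrt (\<integral>\<^sup>+b. F3 a b \<partial>lborel) * ennsqrt (\<integral>\<^sup>+b. \<integral>\<^sup>+c. F1 b c \<partial>lborel \<partial>lborel)) \<partial>lborel)"
    by (intro nn_integral_mono mult_left_mono nn_integral_ennsqrt_mult) auto
  also have "\<dots> = ennsqrt (\<integral>\<^sup>+b. \<integral>\<^sup>+c. F1 b c \<partial>lborel \<partial>lborel) *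
     (\<integral>\<^sup>+a. ennsqrt (\<integral>\<^sup>+b. F3 a b \<partial>lborel) * ennsqrt (\<integral>\<^sup>+c. F2 a c \<partial>lborel) \<partial>lborel)"
    by (subst nn_integral_cmult[symmetric]) (auto simp: mult_ac)
  also have "\<dots> \<le> ?R"
    by (intro mult_left_mono nn_integral_ennsqrt_mult) auto
  finally show ?thesis .
qed

lemma measurable_vector3_compose[measurable (raw)]:
  assumes [measurable]: "f \<in> borel_measurable M" "g \<in> borel_measurable M" "h \<in> borel_measurable M"
  shows "(\<lambda>x. vector [f x, g x, h x] :: real^3) \<in> borel_measurable M"
proof -
  have "(\<lambda>x. (f x, g x, h x)) \<in> borel_measurable M" by measurable
  from measurable_compose[OF this measurable_vector3] show ?thesis by simp
qed

lemma vector3_line: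
  "(vector [t, b, c] :: real^3) = vector [0, b, c] + t *\<^sub>R axis 1 1"
  "(vector [a, t, c] :: real^3) = vector [a, 0, c] + t *\<^sub>R axis 2 1"
  "(vector [a, b, t] :: real^3) = vector [a, b, 0] + t *\<^sub>R axis 3 1"
  by (auto simp: vec_eq_iff forall_3 axis_def)

text \<open>Fundamental theorem of calculus, starting at a point outside the support. The power 4 is
  the one whose 3/2-th power, the exponent that Loomis-Whitney brings, is 6; as the square of
  \<open>\<phi> \<bullet> \<phi>\<close> it is differentiable even where \<phi> vanishes.\<close>

lemma norm4_le_line_integral:
  assumes \<phi>: "test_function \<phi>"
  shows "ennreal (norm (\<phi> (x + s *\<^sub>R axis i 1)) ^ 4) \<le>
    (\<integral>\<^sup>+t. ennreal (4 * norm (\<phi> (x + t *\<^sub>R axis i 1)) ^ 3 * norm (grad \<phi> (x + t *\<^sub>R axis i 1))) \<partial>lborel)"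
proof -
  let ?l = "\<lambda>t. x + t *\<^sub>R axis i 1"
  obtain R where R: "R > 0" "\<And>x. norm x \<ge> R \<Longrightarrow> \<phi> x = 0" by (rule test_function_bounded_support[OF \<phi>]) blast
  \<comment> \<open>Far enough out on the line to leave the support, and not to the right of
    \<open>s\<close>.\<close>
  define r where "r = - R - norm x - \<bar>s\<bar>"
  have "norm (?l r) \<ge> R"
  proof -
    have "\<bar>r\<bar> = norm (r *\<^sub>R axis i 1 :: real^3)" by simp
    also have "\<dots> \<le> norm (?l r) + norm x"
      by (metis add_diff_cancel_left' norm_triangle_ineq4 add.commute)
    finally show ?thesis using R(1) by (simp add: r_def)
  qed
  then have z: "\<phi> (?l r) = 0" by (rule R)
  have "r \<le> s" using R(1) norm_ge_zero[of x] unfolding r_def by linarith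
  let ?g = "\<lambda>t. (\<phi> (?l t) \<bullet> \<phi> (?l t))\<^sup>2"
  let ?d = "\<lambda>t. \<Sum>j\<in>UNIV. (axis i 1 $ j) *\<^sub>R (grad \<phi> (?l t) $ j)"
  let ?g' = "\<lambda>t. 4 * ((\<phi> (?l t) \<bullet> \<phi> (?l t)) * (\<phi> (?l t) \<bullet> ?d t))"
  have d: "(?g has_vector_derivative ?g' t) (at t within S)" for t S
  proof -
    have "((\<lambda>t. \<phi> (?l t)) has_derivative (\<lambda>h. h *\<^sub>R ?d t)) (at t within S)"
      using test_function_line[OF \<phi>, of x "axis i 1" t S] unfolding has_vector_derivative_def .
    from has_derivative_power[OF has_derivative_inner[OF this this], of 2] show ?thesis
      unfolding has_vector_derivative_def
      by (rule has_derivative_eq_rhs) (auto simp: fun_eq_iff inner_commute algebra_simps)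
  qed
  have c\<phi>: "continuous_on S (\<lambda>t. \<phi> (?l t))" for S
    by (rule continuous_on_compose2[OF test_function_continuous[OF \<phi>]]) (auto intro!: continuous_intros)
  have "norm (\<phi> (?l s)) ^ 4 = norm (?g s - ?g r)"
    using z by (simp add: power2_norm_eq_inner[symmetric])
  also have "ennreal \<dots> \<le> (\<integral>\<^sup>+t. ennreal (norm (?g' t)) * indicator {r..s} t \<partial>lborel)"
    using \<open>r \<le> s\<close> d
    by (rule norm_diff_le_nn_integral) (intro continuous_intros c\<phi> continuous_on_grad_line[OF \<phi>])
  also have "\<dots> \<le> (\<integral>\<^sup>+t. ennreal (4 * norm (\<phi> (?l t)) ^ 3 * norm (grad \<phi> (?l t))) \<partial>lborel)"
  proof (rule nn_integral_mono)
    fix t :: real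
    have "\<bar>\<phi> (?l t) \<bullet> ?d t\<bar> \<le> norm (\<phi> (?l t)) * norm (?d t)" by (rule Cauchy_Schwarz_ineq2)
    also have "\<dots> \<le> norm (\<phi> (?l t)) * norm (grad \<phi> (?l t))"
      using norm_derivative_le[of "axis i 1" "grad \<phi> (?l t)"] by (intro mult_left_mono) simp_all
    finally have "(norm (\<phi> (?l t)))\<^sup>2 * \<bar>\<phi> (?l t) \<bullet> ?d t\<bar> \<le> (norm (\<phi> (?l t)))\<^sup>2 * (norm (\<phi> (?l t)) * norm (grad \<phi> (?l t)))"
      by (rule mult_left_mono) simp
    then have "norm (?g' t) \<le> 4 * norm (\<phi> (?l t)) ^ 3 * norm (grad \<phi> (?l t))"
      by (simp add: abs_mult power2_norm_eq_inner[symmetric] power3_eq_cube power2_eq_square mult_ac)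
    then show "ennreal (norm (?g' t)) * indicator {r..s} t \<le> ennreal (4 * norm (\<phi> (?l t)) ^ 3 * norm (grad \<phi> (?l t)))"
      by (auto simp: indicator_def intro!: ennreal_leI)
  qed
  finally show ?thesis .
qed

lemma nn_integral_continuous_support_finite:
  fixes g :: "real^3 \<Rightarrow> real"
  assumes "continuous_on UNIV g" "\<And>x. norm x \<ge> R \<Longrightarrow> g x = 0"
  shows "(\<integral>\<^sup>+x. ennreal (g x) \<partial>lborel) < \<infinity>"
proof -
  have "(\<integral>\<^sup>+x. ennreal (norm (g x)) \<partial>lborel) < \<infinity>"
    using integrable_test_function_like[OF assms] unfolding integrable_iff_bounded by (rule conjunct2)
  then show ?thesis
    by (rule le_less_trans[rotated]) (auto intro!: nn_integral_mono ennreal_leI)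
qed

text \<open>Let N and D be the two integrals and J that of 4 |\<phi>|^3 |grad \<phi>|. Line
  integrals in the three directions and Loomis-Whitney give N^2 <= J^3, while Cauchy-Schwarz gives
  J^2 <= 16 N D. Hence N^4 <= (16 N D)^3, and 4096 is 16^3.\<close>

theorem Sobolev_test:
  assumes \<phi>: "test_function \<phi>"
  shows "(\<integral>\<^sup>+x. ennreal (norm (\<phi> x) ^ 6) \<partial>lborel) \<le> 4096 * (\<integral>\<^sup>+x. ennreal ((norm (grad \<phi> x))\<^sup>2) \<partial>lborel) ^ 3"
    (is "?N \<le> 4096 * ?D ^ 3")
proof -
  note [measurable] = test_function_measurable[OF \<phi>]
  define \<psi> where "\<psi> x = ennreal (4 * norm (\<phi> x) ^ 3 * norm (grad \<phi> x))" for x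
  have [measurable]: "\<psi> \<in> borel_measurable borel" unfolding \<psi>_def by measurable
  define F1 where "F1 b c = (\<integral>\<^sup>+a. \<psi> (vector [a, b, c]) \<partial>lborel)" for b c
  define F2 where "F2 a c = (\<integral>\<^sup>+b. \<psi> (vector [a, b, c]) \<partial>lborel)" for a c
  define F3 where "F3 a b = (\<integral>\<^sup>+c. \<psi> (vector [a, b, c]) \<partial>lborel)" for a b
  have [measurable]: "case_prod F1 \<in> borel_measurable (lborel \<Otimes>\<^sub>M lborel)"
    "case_prod F2 \<in> borel_measurable (lborel \<Otimes>\<^sub>M lborel)" "case_prod F3 \<in> borel_measurable (lborel \<Otimes>\<^sub>M lborel)"
    unfolding F1_def F2_def F3_def by measurable
  let ?J = "\<integral>\<^sup>+x. \<psi> x \<partial>lborel"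
  have J: "?J = (\<integral>\<^sup>+a. \<integral>\<^sup>+b. \<integral>\<^sup>+c. \<psi> (vector [a, b, c]) \<partial>lborel \<partial>lborel \<partial>lborel)"
    by (rule nn_integral_vector3) measurable
  have J3: "(\<integral>\<^sup>+a. \<integral>\<^sup>+b. F3 a b \<partial>lborel \<partial>lborel) = ?J" unfolding J F3_def ..
  have J2: "(\<integral>\<^sup>+a. \<integral>\<^sup>+c. F2 a c \<partial>lborel \<partial>lborel) = ?J"
    unfolding J F2_def by (intro nn_integral_cong lborel_pair.Fubini') measurable
  have J1: "(\<integral>\<^sup>+b. \<integral>\<^sup>+c. F1 b c \<partial>lborel \<partial>lborel) = ?J"
  proof -
    have "(\<integral>\<^sup>+b. \<integral>\<^sup>+c. F1 b c \<partial>lborel \<partial>lborel) = (\<integral>\<^sup>+b. \<integral>\<^sup>+a. \<integral>\<^sup>+c. \<psi> (vector [a, b, c]) \<partial>lborel \<partial>lborel \<partial>lborel)"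
      unfolding F1_def by (intro nn_integral_cong lborel_pair.Fubini') measurable
    also have "\<dots> = ?J" unfolding J by (rule lborel_pair.Fubini') measurable
    finally show ?thesis .
  qed
  have pt: "ennreal (norm (\<phi> (vector [a, b, c])) ^ 6) \<le> ennsqrt (F3 a b) * (ennsqrt (F1 b c) * ennsqrt (F2 a c))" for a b c
  proof (rule ennreal_power2_le_imp_le)
    let ?n = "ennreal (norm (\<phi> (vector [a, b, c])) ^ 4)"
    have "?n \<le> F1 b c" unfolding F1_def \<psi>_def
      using norm4_le_line_integral[OF \<phi>, of "vector [0, b, c]" a 1] by (simp only: vector3_line(1)[symmetric])
    moreover have "?n \<le> F2 a c" unfolding F2_def \<psi>_def
      using norm4_le_line_integral[OF \<phi>, of "vector [a, 0, c]" b 2] by (simp only: vector3_line(2)[symmetric])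
    moreover have "?n \<le> F3 a b" unfolding F3_def \<psi>_def
      using norm4_le_line_integral[OF \<phi>, of "vector [a, b, 0]" c 3] by (simp only: vector3_line(3)[symmetric])
    ultimately have "?n * (?n * ?n) \<le> F3 a b * (F1 b c * F2 a c)" by (intro mult_mono) auto
    then show "(ennreal (norm (\<phi> (vector [a, b, c])) ^ 6))\<^sup>2 \<le> (ennsqrt (F3 a b) * (ennsqrt (F1 b c) * ennsqrt (F2 a c)))\<^sup>2"
      by (simp add: power_mult_distrib ennsqrt_square ennreal_power ennreal_mult[symmetric] flip: power_add power_mult)
  qed
  have "?N = (\<integral>\<^sup>+a. \<integral>\<^sup>+b. \<integral>\<^sup>+c. ennreal (norm (\<phi> (vector [a, b, c])) ^ 6) \<partial>lborel \<partial>lborel \<partial>lborel)"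
    by (rule nn_integral_vector3) measurable
  also have "\<dots> \<le> (\<integral>\<^sup>+a. \<integral>\<^sup>+b. \<integral>\<^sup>+c. ennsqrt (F3 a b) * (ennsqrt (F1 b c) * ennsqrt (F2 a c)) \<partial>lborel \<partial>lborel \<partial>lborel)"
    by (intro nn_integral_mono pt)
  also have "\<dots> \<le> ennsqrt ?J * (ennsqrt ?J * ennsqrt ?J)"
    using Loomis_Whitney[of F1 F2 F3] unfolding J1 J2 J3 by simp
  finally have "?N\<^sup>2 \<le> (ennsqrt ?J * (ennsqrt ?J * ennsqrt ?J))\<^sup>2" by (rule power_mono) simp
  then have 1: "?N\<^sup>2 \<le> ?J ^ 3" by (simp add: power_mult_distrib ennsqrt_square power3_eq_cube mult.assoc)
  have "?J = (\<integral>\<^sup>+x. ennreal (4 * norm (\<phi> x) ^ 3) * ennreal (norm (grad \<phi> x)) \<partial>lborel)"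
    by (simp add: \<psi>_def ennreal_mult)
  then have "?J\<^sup>2 \<le> (\<integral>\<^sup>+x. (ennreal (4 * norm (\<phi> x) ^ 3))\<^sup>2 \<partial>lborel) * (\<integral>\<^sup>+x. (ennreal (norm (grad \<phi> x)))\<^sup>2 \<partial>lborel)"
    using Cauchy_Schwarz_nn_integral[of "\<lambda>x. ennreal (4 * norm (\<phi> x) ^ 3)" lborel "\<lambda>x. ennreal (norm (grad \<phi> x))"] by simp
  also have "(\<integral>\<^sup>+x. (ennreal (4 * norm (\<phi> x) ^ 3))\<^sup>2 \<partial>lborel) = (\<integral>\<^sup>+x. 16 * ennreal (norm (\<phi> x) ^ 6) \<partial>lborel)"
    by (intro nn_integral_cong)
      (simp add: ennreal_power power_mult_distrib ennreal_mult flip: power_mult)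
  also have "\<dots> = 16 * ?N" by (rule nn_integral_cmult) measurable
  also have "(\<integral>\<^sup>+x. (ennreal (norm (grad \<phi> x)))\<^sup>2 \<partial>lborel) = ?D" by (simp add: ennreal_power)
  finally have 2: "?J\<^sup>2 \<le> 16 * ?N * ?D" .
  \<comment> \<open>Compact support makes both integrals finite, which permits cancelling the cube
    of the first one at the end.\<close>
  obtain R where R: "\<And>x. norm x \<ge> R \<Longrightarrow> \<phi> x = 0" "\<And>x. norm x \<ge> R \<Longrightarrow> grad \<phi> x = 0"
    by (rule test_function_bounded_support[OF \<phi>]) blast
  have "?N < \<infinity>"
    by (rule nn_integral_continuous_support_finite[of _ R])
      (auto simp: R intro!: continuous_intros test_function_continuous[OF \<phi>])
  then obtain N where N: "N \<ge> 0" "?N = ennreal N" by (cases ?N) auto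
  have "?D < \<infinity>"
    by (rule nn_integral_continuous_support_finite[of _ R])
      (auto simp: R intro!: continuous_intros continuous_grad[OF \<phi>])
  then obtain D where D: "D \<ge> 0" "?D = ennreal D" by (cases ?D) auto
  have "?N ^ 4 = (?N\<^sup>2)\<^sup>2" by (simp flip: power_mult)
  also have "\<dots> \<le> (?J ^ 3)\<^sup>2" by (rule power_mono[OF 1]) simp
  also have "\<dots> = (?J\<^sup>2) ^ 3" by (simp flip: power_mult)
  also have "\<dots> \<le> (16 * ?N * ?D) ^ 3" by (rule power_mono[OF 2]) simp
  also have "\<dots> = ennreal ((16 * N * D) ^ 3)" using N D
    by (simp add: ennreal_mult ennreal_power[symmetric])
  finally have "N ^ 4 \<le> (16 * N * D) ^ 3" using N D by (simp add: ennreal_power)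
  then have "N * N ^ 3 \<le> (4096 * D ^ 3) * N ^ 3" by (simp add: power_mult_distrib power_Suc[symmetric] mult_ac)
  then have "N \<le> 4096 * D ^ 3" using N D by (cases "N = 0") auto
  then have "ennreal N \<le> ennreal (4096 * D ^ 3)" by (rule ennreal_leI)
  then show ?thesis using N D by (simp add: ennreal_mult ennreal_power)
qed

section \<open>The space of functions with square-integrable gradient\<close>

abbreviation Np :: "nat \<Rightarrow> (real^3 \<Rightarrow> 'b::real_normed_vector) \<Rightarrow> ennreal" where
  "Np p u \<equiv> (\<integral>\<^sup>+x. ennreal (norm (u x) ^ p) \<partial>lborel)"

lemma power_add_le: "0 \<le> a \<Longrightarrow> 0 \<le> b \<Longrightarrow> (a + b) ^ p \<le> 2 ^ p * (a ^ p + b ^ p :: real)"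
proof -
  assume "0 \<le> a" "0 \<le> b"
  then have "(a + b) ^ p \<le> (2 * max a b) ^ p" by (intro power_mono) auto
  also have "\<dots> = 2 ^ p * (max a b) ^ p" by (simp add: power_mult_distrib)
  also have "(max a b) ^ p \<le> a ^ p + b ^ p" using \<open>0 \<le> a\<close> \<open>0 \<le> b\<close> by (simp add: max_def)
  finally show ?thesis by simp
qed

text \<open>This quasi-triangle inequality takes the place of Minkowski's: it is applied to
  integrals that tend to 0 or need only be bounded, where a factor \<open>2 ^ p\<close> does no
  harm.\<close>

lemma nn_integral_norm_power_add:
  fixes u w :: "'a \<Rightarrow> 'b::{real_normed_vector, second_countable_topology}"
  assumes [measurable]: "u \<in> borel_measurable M" "w \<in> borel_measurable M"
  shows "(\<integral>\<^sup>+x. ennreal (norm (u x + w x) ^ p) \<partial>M) \<le>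
    ennreal (2 ^ p) * ((\<integral>\<^sup>+x. ennreal (norm (u x) ^ p) \<partial>M) + (\<integral>\<^sup>+x. ennreal (norm (w x) ^ p) \<partial>M))"
proof -
  have "(\<integral>\<^sup>+x. ennreal (norm (u x + w x) ^ p) \<partial>M) \<le> (\<integral>\<^sup>+x. ennreal (2 ^ p) * (ennreal (norm (u x) ^ p) + ennreal (norm (w x) ^ p)) \<partial>M)"
  proof (rule nn_integral_mono)
    fix x
    have "norm (u x + w x) ^ p \<le> (norm (u x) + norm (w x)) ^ p" by (intro power_mono norm_triangle_ineq) simp
    also have "\<dots> \<le> 2 ^ p * (norm (u x) ^ p + norm (w x) ^ p)" by (rule power_add_le) auto
    finally show "ennreal (norm (u x + w x) ^ p) \<le> ennreal (2 ^ p) * (ennreal (norm (u x) ^ p) + ennreal (norm (w x) ^ p))"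
      by (simp add: ennreal_mult[symmetric] ennreal_plus[symmetric] ennreal_leI del: ennreal_plus)
  qed
  also have "\<dots> = ennreal (2 ^ p) * ((\<integral>\<^sup>+x. ennreal (norm (u x) ^ p) \<partial>M) + (\<integral>\<^sup>+x. ennreal (norm (w x) ^ p) \<partial>M))"
    by (subst nn_integral_cmult) (auto simp: nn_integral_add)
  finally show ?thesis .
qed

lemma nn_integral_norm_power_diff:
  fixes u v w :: "'a \<Rightarrow> 'b::{real_normed_vector, second_countable_topology}"
  assumes [measurable]: "u \<in> borel_measurable M" "v \<in> borel_measurable M" "w \<in> borel_measurable M"
  shows "(\<integral>\<^sup>+x. ennreal (norm (u x - w x) ^ p) \<partial>M) \<le>
    ennreal (2 ^ p) * ((\<integral>\<^sup>+x. ennreal (norm (u x - v x) ^ p) \<partial>M) + (\<integral>\<^sup>+x. ennreal (norm (v x - w x) ^ p) \<partial>M))"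
  using nn_integral_norm_power_add[of "\<lambda>x. u x - v x" M "\<lambda>x. v x - w x" p] by simp

lemma nn_integral_norm_power_le:
  fixes u v w :: "'a \<Rightarrow> 'b::{real_normed_vector, second_countable_topology}"
  assumes [measurable]: "u \<in> borel_measurable M" "v \<in> borel_measurable M"
  shows "(\<integral>\<^sup>+x. ennreal (norm (u x) ^ p) \<partial>M) \<le>
    ennreal (2 ^ p) * ((\<integral>\<^sup>+x. ennreal (norm (u x - v x) ^ p) \<partial>M) + (\<integral>\<^sup>+x. ennreal (norm (v x) ^ p) \<partial>M))"
  using nn_integral_norm_power_diff[of u M v "\<lambda>x. 0" p] by simp

lemma nn_integral_norm_power_swap:
  "(\<integral>\<^sup>+x. ennreal (norm (u x - v x) ^ p) \<partial>M) = (\<integral>\<^sup>+x. ennreal (norm (v x - u x) ^ p) \<partial>M)"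
  by (simp add: norm_minus_commute)

lemma ennreal_tendsto_zero_bound:
  fixes X Y Z :: "'i \<Rightarrow> ennreal"
  assumes "\<And>k. Z k \<le> ennreal c * (X k + Y k)" "(X \<longlongrightarrow> 0) F" "(Y \<longlongrightarrow> 0) F"
  shows "(Z \<longlongrightarrow> 0) F"
proof (rule tendsto_sandwich[OF _ _ tendsto_const])
  have "((\<lambda>k. ennreal c * (X k + Y k)) \<longlongrightarrow> ennreal c * (0 + 0)) F"
    by (intro ennreal_tendsto_cmult tendsto_add assms) simp
  then show "((\<lambda>k. ennreal c * (X k + Y k)) \<longlongrightarrow> 0) F" by simp
qed (use assms(1) in auto)

lemma ennreal_tendsto_zeroD:
  "(X \<longlonglongrightarrow> (0::ennreal)) \<Longrightarrow> e > 0 \<Longrightarrow> \<exists>N. \<forall>k\<ge>N. X k \<le> ennreal e"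
  using order_tendstoD(2)[of X 0 sequentially "ennreal e"]
  by (auto simp: eventually_sequentially intro: less_imp_le)

lemma Lp_tendsto_imp_Cauchy:
  fixes u :: "nat \<Rightarrow> 'a \<Rightarrow> 'b::{real_normed_vector, second_countable_topology}"
  assumes [measurable]: "\<And>k. u k \<in> borel_measurable M" "v \<in> borel_measurable M"
    and lim: "(\<lambda>k. \<integral>\<^sup>+x. ennreal (norm (u k x - v x) ^ p) \<partial>M) \<longlonglongrightarrow> 0" and "e > 0"
  shows "\<exists>N. \<forall>k\<ge>N. \<forall>l\<ge>N. (\<integral>\<^sup>+x. ennreal (norm (u k x - u l x) ^ p) \<partial>M) \<le> ennreal e"
proof -
  have "e / (2 * 2 ^ p) > 0" using \<open>e > 0\<close> by simp
  from ennreal_tendsto_zeroD[OF lim this] obtain N where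
    N: "\<And>k. k \<ge> N \<Longrightarrow> (\<integral>\<^sup>+x. ennreal (norm (u k x - v x) ^ p) \<partial>M) \<le> ennreal (e / (2 * 2 ^ p))" by blast
  have "(\<integral>\<^sup>+x. ennreal (norm (u k x - u l x) ^ p) \<partial>M) \<le> ennreal e" if "k \<ge> N" "l \<ge> N" for k l
  proof -
    have "(\<integral>\<^sup>+x. ennreal (norm (u k x - u l x) ^ p) \<partial>M) \<le> ennreal (2 ^ p) *
        ((\<integral>\<^sup>+x. ennreal (norm (u k x - v x) ^ p) \<partial>M) + (\<integral>\<^sup>+x. ennreal (norm (v x - u l x) ^ p) \<partial>M))"
      by (rule nn_integral_norm_power_diff) measurable
    also have "\<dots> \<le> ennreal (2 ^ p) * (ennreal (e / (2 * 2 ^ p)) + ennreal (e / (2 * 2 ^ p)))"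
      using N[OF that(1)] N[OF that(2)]
      by (intro mult_left_mono add_mono) (simp_all add: nn_integral_norm_power_swap[where u=v])
    also have "\<dots> = ennreal e" using \<open>e > 0\<close>
      by (simp add: ennreal_plus[symmetric] ennreal_mult[symmetric] del: ennreal_plus)
    finally show ?thesis .
  qed
  then show ?thesis by blast
qed

lemma Lp_limit_unique:
  fixes u :: "nat \<Rightarrow> 'a \<Rightarrow> 'b::{real_normed_vector, second_countable_topology}"
  assumes [measurable]: "\<And>k. u k \<in> borel_measurable M" "v \<in> borel_measurable M" "w \<in> borel_measurable M"
    and "(\<lambda>k. \<integral>\<^sup>+x. ennreal (norm (u k x - v x) ^ p) \<partial>M) \<longlonglongrightarrow> 0"
    and "(\<lambda>k. \<integral>\<^sup>+x. ennreal (norm (u k x - w x) ^ p) \<partial>M) \<longlonglongrightarrow> 0" and "p > 0"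
  shows "AE x in M. v x = w x"
proof -
  have "(\<lambda>k::nat. \<integral>\<^sup>+x. ennreal (norm (v x - w x) ^ p) \<partial>M) \<longlonglongrightarrow> 0"
  proof (rule ennreal_tendsto_zero_bound[OF _ assms(4,5)])
    show "(\<integral>\<^sup>+x. ennreal (norm (v x - w x) ^ p) \<partial>M) \<le> ennreal (2 ^ p) *
        ((\<integral>\<^sup>+x. ennreal (norm (u k x - v x) ^ p) \<partial>M) + (\<integral>\<^sup>+x. ennreal (norm (u k x - w x) ^ p) \<partial>M))" for k
      using nn_integral_norm_power_diff[of v M "u k" w p] by (simp add: nn_integral_norm_power_swap[where u=v])
  qed
  then have "(\<integral>\<^sup>+x. ennreal (norm (v x - w x) ^ p) \<partial>M) = 0"
    by (simp add: tendsto_const_iff)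
  then have "AE x in M. ennreal (norm (v x - w x) ^ p) = 0"
    by (subst (asm) nn_integral_0_iff_AE) auto
  then show ?thesis using \<open>p > 0\<close> by (auto elim!: AE_mp)
qed

text \<open>Completeness yields a subsequence that converges almost everywhere to some limit, and
  limits agree up to a null set.\<close>

lemma Lp_tendsto_AE_subseq:
  fixes u :: "nat \<Rightarrow> 'a \<Rightarrow> 'b::{banach, second_countable_topology}"
  assumes u[measurable]: "\<And>k. u k \<in> borel_measurable M" and v[measurable]: "v \<in> borel_measurable M"
    and lim: "(\<lambda>k. \<integral>\<^sup>+x. ennreal (norm (u k x - v x) ^ p) \<partial>M) \<longlonglongrightarrow> 0" and "p > 0"
  obtains r where "strict_mono r" "AE x in M. (\<lambda>k. u (r k) x) \<longlonglongrightarrow> v x"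
proof -
  obtain r w where r: "strict_mono r" "w \<in> borel_measurable M" "AE x in M. (\<lambda>k. u (r k) x) \<longlonglongrightarrow> w x"
    "(\<lambda>k. \<integral>\<^sup>+x. ennreal (norm (u k x - w x) ^ p) \<partial>M) \<longlonglongrightarrow> 0"
    using Lp_complete[OF u \<open>p > 0\<close> Lp_tendsto_imp_Cauchy[OF u v lim]] by blast
  from Lp_limit_unique[OF u v r(2) lim r(4) \<open>p > 0\<close>] r(3)
  have "AE x in M. (\<lambda>k. u (r k) x) \<longlonglongrightarrow> v x" by eventually_elim simp
  with r(1) show ?thesis by (rule that)
qed

lemma Np_similarity:
  fixes u :: "real^3 \<Rightarrow> 'b::{real_normed_vector, second_countable_topology}"
  assumes "orthogonal_transformation A" "\<sigma> > 0" and [measurable]: "u \<in> borel_measurable borel"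
  shows "Np p u = ennreal (\<sigma> ^ 3) * Np p (\<lambda>x. u (\<sigma> *\<^sub>R A x + a))"
  using nn_integral_similarity[OF assms(1,2), of "\<lambda>x. ennreal (norm (u x) ^ p)" a] by simp

lemma Np_similarity':
  fixes u :: "real^3 \<Rightarrow> 'b::{real_normed_vector, second_countable_topology}"
  assumes "orthogonal_transformation A" "\<sigma> > 0" and [measurable]: "u \<in> borel_measurable borel"
  shows "Np p (\<lambda>x. u (\<sigma> *\<^sub>R A x + a)) = ennreal (1 / \<sigma> ^ 3) * Np p u"
proof -
  have "ennreal (1 / \<sigma> ^ 3) * Np p u = (ennreal (1 / \<sigma> ^ 3) * ennreal (\<sigma> ^ 3)) * Np p (\<lambda>x. u (\<sigma> *\<^sub>R A x + a))"
    by (subst Np_similarity[OF assms, where p=p and a=a]) (simp add: mult.assoc)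
  also have "ennreal (1 / \<sigma> ^ 3) * ennreal (\<sigma> ^ 3) = 1" using \<open>\<sigma> > 0\<close> by (simp add: ennreal_mult[symmetric])
  finally show ?thesis by simp
qed

lemma linear_borel_measurable:
  fixes L :: "'b::euclidean_space \<Rightarrow> 'c::euclidean_space"
  shows "linear L \<Longrightarrow> L \<in> borel_measurable borel"
  by (intro borel_measurable_continuous_onI linear_continuous_on linear_conv_bounded_linear[THEN iffD1])

lemma D12_measurable:
  assumes "has_D12_gradient v G"
  shows "v \<in> borel_measurable borel" "G \<in> borel_measurable borel"
  using assms by (auto simp: has_D12_gradient_def)

lemma D12_I:
  assumes "v \<in> borel_measurable borel" "G \<in> borel_measurable borel" "\<And>k. test_function (\<phi> k)"
    "(\<lambda>k. Np 6 (\<lambda>x. \<phi> k x - v x)) \<longlonglongrightarrow> 0" "(\<lambda>k. Np 2 (\<lambda>x. grad (\<phi> k) x - G x)) \<longlonglongrightarrow> 0"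
  shows "has_D12_gradient v G"
  using assms by (auto simp: has_D12_gradient_def intro!: exI[of _ \<phi>])

lemma D12_E:
  assumes "has_D12_gradient v G"
  obtains \<phi> where "\<And>k. test_function (\<phi> k)"
    "(\<lambda>k. Np 6 (\<lambda>x. \<phi> k x - v x)) \<longlonglongrightarrow> 0" "(\<lambda>k. Np 2 (\<lambda>x. grad (\<phi> k) x - G x)) \<longlonglongrightarrow> 0"
  using assms by (auto simp: has_D12_gradient_def)

lemma D12_test_function: "test_function \<phi> \<Longrightarrow> has_D12_gradient \<phi> (grad \<phi>)"
  by (rule D12_I[where \<phi>="\<lambda>_. \<phi>"]) (auto simp: test_function_measurable)

lemma D12_add:
  assumes v: "has_D12_gradient v G" and w: "has_D12_gradient w H"
  shows "has_D12_gradient (\<lambda>x. v x + w x) (\<lambda>x. G x + H x)"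
proof -
  obtain \<phi> where \<phi>: "\<And>k. test_function (\<phi> k)"
    "(\<lambda>k. Np 6 (\<lambda>x. \<phi> k x - v x)) \<longlonglongrightarrow> 0" "(\<lambda>k. Np 2 (\<lambda>x. grad (\<phi> k) x - G x)) \<longlonglongrightarrow> 0"
    using v by (rule D12_E) blast
  obtain \<psi> where \<psi>: "\<And>k. test_function (\<psi> k)"
    "(\<lambda>k. Np 6 (\<lambda>x. \<psi> k x - w x)) \<longlonglongrightarrow> 0" "(\<lambda>k. Np 2 (\<lambda>x. grad (\<psi> k) x - H x)) \<longlonglongrightarrow> 0"
    using w by (rule D12_E) blast
  note [measurable] = D12_measurable[OF v] D12_measurable[OF w] test_function_measurable[OF \<phi>(1)] test_function_measurable[OF \<psi>(1)]
  show ?thesis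
  proof (rule D12_I)
    show "test_function (\<lambda>x. \<phi> k x + \<psi> k x)" for k by (intro test_function_add \<phi> \<psi>)
    show "(\<lambda>k. Np 6 (\<lambda>x. \<phi> k x + \<psi> k x - (v x + w x))) \<longlonglongrightarrow> 0"
      by (rule ennreal_tendsto_zero_bound[OF _ \<phi>(2) \<psi>(2)], unfold add_diff_add, rule nn_integral_norm_power_add) measurable
    show "(\<lambda>k. Np 2 (\<lambda>x. grad (\<lambda>x. \<phi> k x + \<psi> k x) x - (G x + H x))) \<longlonglongrightarrow> 0"
      unfolding grad_add[OF \<phi>(1) \<psi>(1)]
      by (rule ennreal_tendsto_zero_bound[OF _ \<phi>(3) \<psi>(3)], unfold add_diff_add, rule nn_integral_norm_power_add) measurable
  qed measurable
qed

text \<open>Dilations, translations, isometries of space and of the values, and scalar multiples are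
  all instances.\<close>

lemma D12_similarity:
  assumes v: "has_D12_gradient v G" and L: "linear L" and A: "orthogonal_transformation A" and "\<sigma> > 0"
  shows "has_D12_gradient (\<lambda>x. L (v (\<sigma> *\<^sub>R A x + a))) (\<lambda>x. \<sigma> *\<^sub>R pull L A (G (\<sigma> *\<^sub>R A x + a)))"
proof -
  obtain \<phi> where \<phi>: "\<And>k. test_function (\<phi> k)"
    "(\<lambda>k. Np 6 (\<lambda>x. \<phi> k x - v x)) \<longlonglongrightarrow> 0" "(\<lambda>k. Np 2 (\<lambda>x. grad (\<phi> k) x - G x)) \<longlonglongrightarrow> 0"
    using v by (rule D12_E) blast
  have lP: "linear (\<lambda>W. \<sigma> *\<^sub>R pull L A W)" by (intro linear_compose_scale_right linear_pull L)
  note [measurable] = D12_measurable[OF v] test_function_measurable[OF \<phi>(1)] orthogonal_transformation_measurable[OF A]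
    linear_borel_measurable[OF L] linear_borel_measurable[OF linear_pull[OF L, of A]]
  \<comment> \<open>One estimate for both convergences: \<open>M\<close> will be \<open>L\<close>
    with exponent 6 for the values, and the scaled \<open>pull\<close> with exponent 2 for the
    gradients.\<close>
  have *: "(\<lambda>k. Np p (\<lambda>x. M (u k (\<sigma> *\<^sub>R A x + a)) - M (w (\<sigma> *\<^sub>R A x + a)))) \<longlonglongrightarrow> 0"
    if M: "linear M" and lim: "(\<lambda>k. Np p (\<lambda>x. u k x - w x)) \<longlonglongrightarrow> 0"
      and [measurable]: "\<And>k. u k \<in> borel_measurable borel" "w \<in> borel_measurable borel"
    for M :: "'b::euclidean_space \<Rightarrow> 'b" and u :: "nat \<Rightarrow> real^3 \<Rightarrow> 'b" and w and p
  proof -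
    obtain K where K: "K > 0" "\<And>z. norm (M z) \<le> norm z * K"
      using bounded_linear.pos_bounded[OF linear_conv_bounded_linear[THEN iffD1, OF M]] by auto
    note [measurable] = linear_borel_measurable[OF M]
    have "Np p (\<lambda>x. M (u k (\<sigma> *\<^sub>R A x + a)) - M (w (\<sigma> *\<^sub>R A x + a))) \<le> ennreal (K ^ p * (1 / \<sigma> ^ 3)) * (Np p (\<lambda>x. u k x - w x) + 0)" for k
    proof -
      have "Np p (\<lambda>x. M (u k (\<sigma> *\<^sub>R A x + a)) - M (w (\<sigma> *\<^sub>R A x + a))) \<le>
         (\<integral>\<^sup>+x. ennreal (K ^ p) * ennreal (norm (u k (\<sigma> *\<^sub>R A x + a) - w (\<sigma> *\<^sub>R A x + a)) ^ p) \<partial>lborel)"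
      proof (rule nn_integral_mono)
        fix x
        let ?z = "u k (\<sigma> *\<^sub>R A x + a) - w (\<sigma> *\<^sub>R A x + a)"
        show "ennreal (norm (M (u k (\<sigma> *\<^sub>R A x + a)) - M (w (\<sigma> *\<^sub>R A x + a))) ^ p) \<le> ennreal (K ^ p) * ennreal (norm ?z ^ p)"
          using K(1) power_mono[OF K(2)[of ?z] norm_ge_zero, of p]
          by (simp add: ennreal_mult[symmetric] power_mult_distrib mult.commute ennreal_leI linear_diff[OF M])
      qed
      also have "\<dots> = ennreal (K ^ p) * Np p (\<lambda>x. u k (\<sigma> *\<^sub>R A x + a) - w (\<sigma> *\<^sub>R A x + a))"
        by (rule nn_integral_cmult) measurable
      also have "\<dots> = ennreal (K ^ p) * (ennreal (1 / \<sigma> ^ 3) * Np p (\<lambda>x. u k x - w x))"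
        using Np_similarity'[OF A \<open>\<sigma> > 0\<close>, where u="\<lambda>x. u k x - w x" and p=p and a=a] by simp
      moreover have "ennreal (K ^ p * (1 / \<sigma> ^ 3)) = ennreal (K ^ p) * ennreal (1 / \<sigma> ^ 3)"
        using K(1) \<open>\<sigma> > 0\<close> by (intro ennreal_mult) auto
      ultimately show ?thesis by (simp only: add_0_right mult.assoc)
    qed
    then show ?thesis by (rule ennreal_tendsto_zero_bound[OF _ lim tendsto_const])
  qed
  show ?thesis
  proof (rule D12_I)
    show "test_function (\<lambda>x. L (\<phi> k (\<sigma> *\<^sub>R A x + a)))" for k
      by (intro test_function_similarity \<phi> L A \<open>\<sigma> > 0\<close>)
    show "(\<lambda>k. Np 6 (\<lambda>x. L (\<phi> k (\<sigma> *\<^sub>R A x + a)) - L (v (\<sigma> *\<^sub>R A x + a)))) \<longlonglongrightarrow> 0"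
      by (rule *[OF L \<phi>(2)]) measurable
    show "(\<lambda>k. Np 2 (\<lambda>x. grad (\<lambda>x. L (\<phi> k (\<sigma> *\<^sub>R A x + a))) x - \<sigma> *\<^sub>R pull L A (G (\<sigma> *\<^sub>R A x + a)))) \<longlonglongrightarrow> 0"
      unfolding grad_similarity[OF \<phi>(1) L A] by (rule *[OF lP \<phi>(3)]) measurable
  qed measurable
qed

lemma D12_scaleR:
  assumes v: "has_D12_gradient v G"
  shows "has_D12_gradient (\<lambda>x. c *\<^sub>R v x) (\<lambda>x. c *\<^sub>R G x)"
proof -
  have "has_D12_gradient (\<lambda>x. c *\<^sub>R v (1 *\<^sub>R x + 0)) (\<lambda>x. 1 *\<^sub>R pull ((*\<^sub>R) c) (\<lambda>x. x) (G (1 *\<^sub>R x + 0)))"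
    by (rule D12_similarity[OF v]) (auto intro: linear_scaleR orthogonal_transformation_id)
  moreover have "(\<chi> i. c *\<^sub>R (W $ i)) = c *\<^sub>R W" for W :: "complex^3" by (simp add: vec_eq_iff)
  ultimately show ?thesis by (simp add: pull_linear_id)
qed

lemma D12_diff:
  assumes "has_D12_gradient v G" "has_D12_gradient w H"
  shows "has_D12_gradient (\<lambda>x. v x - w x) (\<lambda>x. G x - H x)"
  using D12_add[OF assms(1) D12_scaleR[OF assms(2), of "-1"]] by simp

lemma D12_AE_cong:
  assumes v: "has_D12_gradient v G" and "AE x in lborel. v x = w x" "AE x in lborel. G x = H x"
    and [measurable]: "w \<in> borel_measurable borel" "H \<in> borel_measurable borel"
  shows "has_D12_gradient w H"
proof -
  obtain \<phi> where \<phi>: "\<And>k. test_function (\<phi> k)"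
    "(\<lambda>k. Np 6 (\<lambda>x. \<phi> k x - v x)) \<longlonglongrightarrow> 0" "(\<lambda>k. Np 2 (\<lambda>x. grad (\<phi> k) x - G x)) \<longlonglongrightarrow> 0"
    using v by (rule D12_E) blast
  have "Np 6 (\<lambda>x. \<phi> k x - v x) = Np 6 (\<lambda>x. \<phi> k x - w x)" for k
    using assms(2) by (intro nn_integral_cong_AE) (auto elim!: AE_mp)
  moreover have "Np 2 (\<lambda>x. grad (\<phi> k) x - G x) = Np 2 (\<lambda>x. grad (\<phi> k) x - H x)" for k
    using assms(3) by (intro nn_integral_cong_AE) (auto elim!: AE_mp)
  ultimately show ?thesis using \<phi> assms(4,5) by (intro D12_I) simp_all
qed

lemma D12_approx:
  assumes v: "has_D12_gradient v G" and "e > 0"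
  obtains \<phi> where "test_function \<phi>" "Np 6 (\<lambda>x. \<phi> x - v x) \<le> ennreal e" "Np 2 (\<lambda>x. grad \<phi> x - G x) \<le> ennreal e"
proof -
  obtain \<phi> where \<phi>: "\<And>k. test_function (\<phi> k)"
    "(\<lambda>k. Np 6 (\<lambda>x. \<phi> k x - v x)) \<longlonglongrightarrow> 0" "(\<lambda>k. Np 2 (\<lambda>x. grad (\<phi> k) x - G x)) \<longlonglongrightarrow> 0"
    using v by (rule D12_E) blast
  obtain N1 N2 where N: "\<And>k. k \<ge> N1 \<Longrightarrow> Np 6 (\<lambda>x. \<phi> k x - v x) \<le> ennreal e" "\<And>k. k \<ge> N2 \<Longrightarrow> Np 2 (\<lambda>x. grad (\<phi> k) x - G x) \<le> ennreal e"
    using ennreal_tendsto_zeroD[OF \<phi>(2) \<open>e > 0\<close>] ennreal_tendsto_zeroD[OF \<phi>(3) \<open>e > 0\<close>] by blast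
  show ?thesis by (rule that[OF \<phi>(1) N(1) N(2)]) (rule max.cobounded1, rule max.cobounded2)
qed

text \<open>Diagonal choice: replace the k-th function by a test function within 1/(k+1) of it in
  both distances.\<close>

lemma D12_closed:
  assumes [measurable]: "v \<in> borel_measurable borel" "G \<in> borel_measurable borel"
    and V: "\<And>k. has_D12_gradient (V k) (W k)"
    and lim: "(\<lambda>k. Np 6 (\<lambda>x. V k x - v x)) \<longlonglongrightarrow> 0" "(\<lambda>k. Np 2 (\<lambda>x. W k x - G x)) \<longlonglongrightarrow> 0"
  shows "has_D12_gradient v G"
proof -
  have "\<forall>k. \<exists>\<phi>. test_function \<phi> \<and> Np 6 (\<lambda>x. \<phi> x - V k x) \<le> ennreal (1 / Suc k) \<and> Np 2 (\<lambda>x. grad \<phi> x - W k x) \<le> ennreal (1 / Suc k)"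
  proof
    fix k
    have "1 / real (Suc k) > 0" by simp
    from D12_approx[OF V this, of k]
    show "\<exists>\<phi>. test_function \<phi> \<and> Np 6 (\<lambda>x. \<phi> x - V k x) \<le> ennreal (1 / Suc k) \<and> Np 2 (\<lambda>x. grad \<phi> x - W k x) \<le> ennreal (1 / Suc k)"
      by blast
  qed
  from choice[OF this] obtain \<phi> where \<phi>: "\<And>k. test_function (\<phi> k)" "\<And>k. Np 6 (\<lambda>x. \<phi> k x - V k x) \<le> ennreal (1 / Suc k)"
      "\<And>k. Np 2 (\<lambda>x. grad (\<phi> k) x - W k x) \<le> ennreal (1 / Suc k)"
    by blast
  note [measurable] = D12_measurable[OF V] test_function_measurable[OF \<phi>(1)]
  have "(\<lambda>k. ennreal (1 / Suc k)) \<longlonglongrightarrow> ennreal 0"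
    by (intro tendsto_ennrealI) (rule LIMSEQ_Suc[OF lim_1_over_n])
  then have e: "(\<lambda>k. ennreal (1 / Suc k)) \<longlonglongrightarrow> 0" by simp
  have 1: "(\<lambda>k. Np 6 (\<lambda>x. \<phi> k x - V k x)) \<longlonglongrightarrow> 0"
    by (rule tendsto_sandwich[OF always_eventually always_eventually tendsto_const e]; intro allI zero_le \<phi>)
  have 2: "(\<lambda>k. Np 2 (\<lambda>x. grad (\<phi> k) x - W k x)) \<longlonglongrightarrow> 0"
    by (rule tendsto_sandwich[OF always_eventually always_eventually tendsto_const e]; intro allI zero_le \<phi>)
  show ?thesis
  proof (rule D12_I)
    show "(\<lambda>k. Np 6 (\<lambda>x. \<phi> k x - v x)) \<longlonglongrightarrow> 0"
      by (rule ennreal_tendsto_zero_bound[OF _ 1 lim(1)], rule nn_integral_norm_power_diff) measurable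
    show "(\<lambda>k. Np 2 (\<lambda>x. grad (\<phi> k) x - G x)) \<longlonglongrightarrow> 0"
      by (rule ennreal_tendsto_zero_bound[OF _ 2 lim(2)], rule nn_integral_norm_power_diff) measurable
  qed (use \<phi> in measurable)
qed

lemma ennreal_mult_add: "0 \<le> c \<Longrightarrow> 0 \<le> a \<Longrightarrow> 0 \<le> b \<Longrightarrow> ennreal c * (ennreal a + ennreal b) = ennreal (c * (a + b))"
  by (simp add: ennreal_mult)

lemma test_function_Np2_finite: "test_function \<phi> \<Longrightarrow> Np 2 (grad \<phi>) < \<infinity>"
proof -
  assume \<phi>: "test_function \<phi>"
  obtain R where R: "\<And>x. norm x \<ge> R \<Longrightarrow> grad \<phi> x = 0"
    by (rule test_function_bounded_support[OF \<phi>]) blast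
  show ?thesis
    by (rule nn_integral_continuous_support_finite[of _ R])
      (auto simp: R intro!: continuous_intros continuous_grad[OF \<phi>])
qed

lemma D12_Np2_finite:
  assumes v: "has_D12_gradient v G"
  shows "Np 2 G < \<infinity>"
proof -
  obtain \<phi> where \<phi>: "test_function \<phi>" "Np 2 (\<lambda>x. grad \<phi> x - G x) \<le> ennreal 1"
    by (rule D12_approx[OF v, of 1]) auto
  note [measurable] = D12_measurable[OF v] test_function_measurable[OF \<phi>(1)]
  have "Np 2 G \<le> ennreal (2 ^ 2) * (Np 2 (\<lambda>x. G x - grad \<phi> x) + Np 2 (grad \<phi>))"
    by (rule nn_integral_norm_power_le) measurable
  also have "\<dots> < \<infinity>"
    using \<phi>(2) test_function_Np2_finite[OF \<phi>(1)]
    by (auto simp: nn_integral_norm_power_swap[where u=G] ennreal_mult_less_top intro: le_less_trans)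
  finally show ?thesis .
qed

lemma D12_approx_bound:
  assumes v: "has_D12_gradient v G" and "e > 0"
  obtains \<phi> where "test_function \<phi>" "Np 6 (\<lambda>x. \<phi> x - v x) \<le> ennreal e" "Np 2 (grad \<phi>) \<le> 4 * (Np 2 G + ennreal e)"
proof -
  obtain \<phi> where \<phi>: "test_function \<phi>" "Np 6 (\<lambda>x. \<phi> x - v x) \<le> ennreal e" "Np 2 (\<lambda>x. grad \<phi> x - G x) \<le> ennreal e"
    by (rule D12_approx[OF assms])
  note [measurable] = D12_measurable[OF v] test_function_measurable[OF \<phi>(1)]
  have "Np 2 (grad \<phi>) \<le> ennreal (2 ^ 2) * (Np 2 (\<lambda>x. grad \<phi> x - G x) + Np 2 G)"
    by (rule nn_integral_norm_power_le) measurable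
  also have "\<dots> \<le> ennreal (2 ^ 2) * (ennreal e + Np 2 G)"
    using \<phi>(3) by (intro mult_left_mono add_mono) auto
  finally show ?thesis using that[OF \<phi>(1,2)] by (simp add: add.commute)
qed

text \<open>The constant is 2^6 * 4096 * 4^3: passing to test functions costs 2^6 for the sixth
  powers and 4 for the squared gradients, the latter inside the cube. The approximation error e is
  then sent to 0.\<close>

theorem D12_Sobolev:
  assumes v: "has_D12_gradient v G"
  shows "Np 6 v \<le> 2 ^ 24 * (Np 2 G) ^ 3"
proof -
  note [measurable] = D12_measurable[OF v]
  obtain g where g: "g \<ge> 0" "Np 2 G = ennreal g" using D12_Np2_finite[OF v] by (cases "Np 2 G") auto
  have b: "Np 6 v \<le> ennreal (64 * (e + 4096 * (4 * (g + e)) ^ 3))" if e0: "e > 0" for e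
  proof -
    obtain \<phi> where \<phi>: "test_function \<phi>" "Np 6 (\<lambda>x. \<phi> x - v x) \<le> ennreal e" "Np 2 (grad \<phi>) \<le> 4 * (Np 2 G + ennreal e)"
      by (rule D12_approx_bound[OF v e0])
    note [measurable] = test_function_measurable[OF \<phi>(1)]
    have "Np 6 v \<le> ennreal (2 ^ 6) * (Np 6 (\<lambda>x. v x - \<phi> x) + Np 6 \<phi>)"
      by (rule nn_integral_norm_power_le) measurable
    also have "\<dots> \<le> ennreal (2 ^ 6) * (ennreal e + 4096 * (4 * (Np 2 G + ennreal e)) ^ 3)"
    proof (intro mult_left_mono add_mono)
      show "Np 6 (\<lambda>x. v x - \<phi> x) \<le> ennreal e" using \<phi>(2) by (simp add: nn_integral_norm_power_swap[where u=v])
      show "Np 6 \<phi> \<le> 4096 * (4 * (Np 2 G + ennreal e)) ^ 3"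
        by (rule order_trans[OF Sobolev_test[OF \<phi>(1)]], intro mult_left_mono power_mono \<phi>(3)) auto
    qed simp
    also have "4 * (Np 2 G + ennreal e) = ennreal (4 * (g + e))"
      using g e0 by (simp add: ennreal_mult)
    also have "ennreal (2 ^ 6) * (ennreal e + 4096 * ennreal (4 * (g + e)) ^ 3) = ennreal (64 * (e + 4096 * (4 * (g + e)) ^ 3))"
    proof -
      have "4096 * ennreal (4 * (g + e)) ^ 3 = ennreal (4096 * (4 * (g + e)) ^ 3)"
      proof -
        have "4096 * ennreal x ^ 3 = ennreal (4096 * x ^ 3)" if "x \<ge> 0" for x
          using that by (simp add: ennreal_power ennreal_mult)
        moreover have "4 * (g + e) \<ge> 0" using g(1) e0 by simp
        ultimately show ?thesis by blast
      qed
      moreover have "ennreal (2 ^ 6) * (ennreal e + ennreal (4096 * (4 * (g + e)) ^ 3)) = ennreal (2 ^ 6 * (e + 4096 * (4 * (g + e)) ^ 3))"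
        using g e0 by (intro ennreal_mult_add) auto
      ultimately show ?thesis by simp
    qed
    finally show ?thesis .
  qed
  have "Np 6 v < \<infinity>" using le_less_trans[OF b[of 1]] by simp
  then obtain n where n: "n \<ge> 0" "Np 6 v = ennreal n" by (cases "Np 6 v") auto
  have "n \<le> 64 * (0 + 4096 * (4 * (g + 0)) ^ 3)"
  proof (rule LIMSEQ_le_const)
    show "(\<lambda>k. 64 * (1 / Suc k + 4096 * (4 * (g + 1 / Suc k)) ^ 3)) \<longlonglongrightarrow> 64 * (0 + 4096 * (4 * (g + 0)) ^ 3)"
      by (intro tendsto_intros LIMSEQ_Suc[OF lim_1_over_n])
    have "n \<le> 64 * (1 / Suc k + 4096 * (4 * (g + 1 / Suc k)) ^ 3)" for k
    proof -
      have "1 / real (Suc k) > 0" by simp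
      from b[OF this] show ?thesis unfolding n(2) using g(1) by (subst (asm) ennreal_le_iff) auto
    qed
    then show "\<exists>N. \<forall>k\<ge>N. n \<le> 64 * (1 / Suc k + 4096 * (4 * (g + 1 / Suc k)) ^ 3)" by blast
  qed
  also have "\<dots> = 2 ^ 24 * g ^ 3" by (simp add: power_mult_distrib)
  finally have "ennreal n \<le> ennreal (2 ^ 24 * g ^ 3)" by (rule ennreal_leI)
  also have "\<dots> = 2 ^ 24 * (ennreal g) ^ 3" using g(1) by (simp add: ennreal_mult ennreal_power)
  finally show ?thesis using n g by simp
qed

lemma D12_Np6_finite: "has_D12_gradient v G \<Longrightarrow> Np 6 v < \<infinity>"
  using D12_Np2_finite[of v G] by (intro le_less_trans[OF D12_Sobolev]) (auto simp: ennreal_mult_less_top power_less_top_ennreal)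

lemma nn_integral_Fatou_le:
  fixes u :: "nat \<Rightarrow> 'a \<Rightarrow> 'b::{real_normed_vector, second_countable_topology}"
  assumes [measurable]: "\<And>k. u k \<in> borel_measurable M" and "AE x in M. (\<lambda>k. u k x) \<longlonglongrightarrow> v x"
    and "\<forall>\<^sub>F k in sequentially. (\<integral>\<^sup>+x. ennreal (norm (u k x) ^ p) \<partial>M) \<le> B"
  shows "(\<integral>\<^sup>+x. ennreal (norm (v x) ^ p) \<partial>M) \<le> B"
proof -
  have "(\<integral>\<^sup>+x. ennreal (norm (v x) ^ p) \<partial>M) = (\<integral>\<^sup>+x. liminf (\<lambda>k. ennreal (norm (u k x) ^ p)) \<partial>M)"
  proof (rule nn_integral_cong_AE, rule AE_mp[OF assms(2)], intro AE_I2 impI)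
    fix x assume "(\<lambda>k. u k x) \<longlonglongrightarrow> v x"
    then have "(\<lambda>k. ennreal (norm (u k x) ^ p)) \<longlonglongrightarrow> ennreal (norm (v x) ^ p)"
      by (intro tendsto_ennrealI tendsto_intros)
    then show "ennreal (norm (v x) ^ p) = liminf (\<lambda>k. ennreal (norm (u k x) ^ p))"
      by (rule lim_imp_Liminf[symmetric, rotated]) simp
  qed
  also have "\<dots> \<le> liminf (\<lambda>k. \<integral>\<^sup>+x. ennreal (norm (u k x) ^ p) \<partial>M)"
    by (rule nn_integral_liminf) measurable
  also have "\<dots> \<le> B" by (rule Liminf_le[OF _ assms(3)]) simp
  finally show ?thesis .
qed

text \<open>\<open>v\<close> itself need not be square integrable, so the estimate for test
  functions is passed on by Fatou along an almost everywhere convergent subsequence. The factor 4 is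
  the quasi-triangle price for bounding the gradients of the approximations.\<close>

theorem D12_translation_estimate:
  assumes v: "has_D12_gradient v G"
  shows "Np 2 (\<lambda>x. v (x + h) - v x) \<le> ennreal (4 * (norm h)\<^sup>2) * Np 2 G"
proof -
  note [measurable] = D12_measurable[OF v]
  obtain \<phi> where \<phi>: "\<And>k. test_function (\<phi> k)"
    "(\<lambda>k. Np 6 (\<lambda>x. \<phi> k x - v x)) \<longlonglongrightarrow> 0" "(\<lambda>k. Np 2 (\<lambda>x. grad (\<phi> k) x - G x)) \<longlonglongrightarrow> 0"
    using v by (rule D12_E) blast
  note [measurable] = test_function_measurable[OF \<phi>(1)]
  obtain r where r: "strict_mono r" "AE x in lborel. (\<lambda>k. \<phi> (r k) x) \<longlonglongrightarrow> v x"
    using Lp_tendsto_AE_subseq[of \<phi> lborel v 6] \<phi>(2) by auto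
  have "AE x in lborel. (\<lambda>k. \<phi> (r k) (x + h)) \<longlonglongrightarrow> v (x + h)"
    using AE_similarity[OF orthogonal_transformation_id _ r(2), of 1 h] by simp
  with r(2) have lim: "AE x in lborel. (\<lambda>k. \<phi> (r k) (x + h) - \<phi> (r k) x) \<longlonglongrightarrow> v (x + h) - v x"
    by eventually_elim (intro tendsto_intros)
  obtain g where g: "g \<ge> 0" "Np 2 G = ennreal g" using D12_Np2_finite[OF v] by (cases "Np 2 G") auto
  have b: "Np 2 (\<lambda>x. v (x + h) - v x) \<le> ennreal ((norm h)\<^sup>2 * (4 * (g + e)))" if e: "e > 0" for e
  proof (rule nn_integral_Fatou_le[OF _ lim])
    obtain N where N: "\<And>k. k \<ge> N \<Longrightarrow> Np 2 (\<lambda>x. grad (\<phi> k) x - G x) \<le> ennreal e"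
      using ennreal_tendsto_zeroD[OF \<phi>(3) e] by blast
    have "Np 2 (\<lambda>x. \<phi> (r k) (x + h) - \<phi> (r k) x) \<le> ennreal ((norm h)\<^sup>2 * (4 * (g + e)))" if "k \<ge> N" for k
    proof -
      have "Np 2 (grad (\<phi> (r k))) \<le> ennreal (2 ^ 2) * (Np 2 (\<lambda>x. grad (\<phi> (r k)) x - G x) + Np 2 G)"
        by (rule nn_integral_norm_power_le) measurable
      also have "\<dots> \<le> ennreal (2 ^ 2) * (ennreal e + ennreal g)"
        using strict_mono_imp_increasing[OF r(1), of k] that g(2)
        by (intro mult_left_mono add_mono N) auto
      also have "\<dots> = ennreal (4 * (g + e))" using e g(1)
        by (subst ennreal_mult_add) (simp_all add: add.commute)
      finally have "ennreal ((norm h)\<^sup>2) * Np 2 (grad (\<phi> (r k))) \<le> ennreal ((norm h)\<^sup>2) * ennreal (4 * (g + e))"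
        by (rule mult_left_mono) simp
      also have "\<dots> = ennreal ((norm h)\<^sup>2 * (4 * (g + e)))" using e g(1) by (simp add: ennreal_mult)
      finally show ?thesis using order_trans[OF translation_estimate_test[OF \<phi>(1)]] by blast
    qed
    then show "\<forall>\<^sub>F k in sequentially. Np 2 (\<lambda>x. \<phi> (r k) (x + h) - \<phi> (r k) x) \<le> ennreal ((norm h)\<^sup>2 * (4 * (g + e)))"
      by (auto simp: eventually_sequentially)
  qed measurable
  have "Np 2 (\<lambda>x. v (x + h) - v x) < \<infinity>" using le_less_trans[OF b[of 1]] by simp
  then obtain n where n: "n \<ge> 0" "Np 2 (\<lambda>x. v (x + h) - v x) = ennreal n"
    by (cases "Np 2 (\<lambda>x. v (x + h) - v x)") auto
  have "n \<le> (norm h)\<^sup>2 * (4 * (g + 0))"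
  proof (rule LIMSEQ_le_const)
    show "(\<lambda>k. (norm h)\<^sup>2 * (4 * (g + 1 / Suc k))) \<longlonglongrightarrow> (norm h)\<^sup>2 * (4 * (g + 0))"
      by (intro tendsto_intros LIMSEQ_Suc[OF lim_1_over_n])
    have "n \<le> (norm h)\<^sup>2 * (4 * (g + 1 / Suc k))" for k
    proof -
      have "1 / real (Suc k) > 0" by simp
      from b[OF this] show ?thesis unfolding n(2) using g(1) by (subst (asm) ennreal_le_iff) auto
    qed
    then show "\<exists>N. \<forall>k\<ge>N. n \<le> (norm h)\<^sup>2 * (4 * (g + 1 / Suc k))" by blast
  qed
  then have "ennreal n \<le> ennreal (4 * (norm h)\<^sup>2 * g)" by (intro ennreal_leI) (simp add: mult_ac)
  then show ?thesis using n g by (simp add: ennreal_mult)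
qed

text \<open>The Sobolev inequality applied to differences turns convergence of the gradients into
  convergence in L^6, so control of the gradients alone suffices.\<close>

theorem D12_complete:
  assumes V: "\<And>k. has_D12_gradient (V k) (W k)"
    and C: "\<And>e. e > 0 \<Longrightarrow> \<exists>N. \<forall>k\<ge>N. \<forall>l\<ge>N. Np 2 (\<lambda>x. W k x - W l x) \<le> ennreal e"
  obtains v G where "has_D12_gradient v G"
    "(\<lambda>k. Np 6 (\<lambda>x. V k x - v x)) \<longlonglongrightarrow> 0" "(\<lambda>k. Np 2 (\<lambda>x. W k x - G x)) \<longlonglongrightarrow> 0"
proof -
  note [measurable] = D12_measurable[OF V]
  obtain G where G[measurable]: "G \<in> borel_measurable borel" and GL: "(\<lambda>k. Np 2 (\<lambda>x. W k x - G x)) \<longlonglongrightarrow> 0"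
    by (rule Lp_complete[of W lborel 2, OF _ _ C]) (auto simp: D12_measurable[OF V])
  have "\<exists>N. \<forall>k\<ge>N. \<forall>l\<ge>N. Np 6 (\<lambda>x. V k x - V l x) \<le> ennreal e" if "e > 0" for e
  proof -
    \<comment> \<open>With \<open>d\<close> at most 1 one has \<open>d ^ 3 \<le> d\<close>, which
      keeps the cubed Sobolev bound below \<open>e\<close>.\<close>
    define d where "d = min 1 (e / 2 ^ 24)"
    have d: "d > 0" "d \<le> 1" "2 ^ 24 * d \<le> e" using that by (auto simp: d_def min_def field_simps)
    obtain N where N: "\<And>k l. k \<ge> N \<Longrightarrow> l \<ge> N \<Longrightarrow> Np 2 (\<lambda>x. W k x - W l x) \<le> ennreal d"
      using C[OF d(1)] by blast
    have "Np 6 (\<lambda>x. V k x - V l x) \<le> ennreal e" if "k \<ge> N" "l \<ge> N" for k l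
    proof -
      have "Np 6 (\<lambda>x. V k x - V l x) \<le> 2 ^ 24 * (Np 2 (\<lambda>x. W k x - W l x)) ^ 3"
        by (rule D12_Sobolev[OF D12_diff[OF V V]])
      also have "\<dots> \<le> 2 ^ 24 * (ennreal d) ^ 3"
        by (intro mult_left_mono power_mono N that) auto
      also have "\<dots> = ennreal (2 ^ 24 * d ^ 3)" using d(1) by (simp add: ennreal_power ennreal_mult)
      also have "\<dots> \<le> ennreal e"
      proof (rule ennreal_leI)
        have "d ^ 3 \<le> d ^ 1" using d by (intro power_decreasing) auto
        then show "2 ^ 24 * d ^ 3 \<le> e" using d(3) by simp
      qed
      finally show ?thesis .
    qed
    then show ?thesis by blast
  qed
  note C6 = this
  obtain v where v[measurable]: "v \<in> borel_measurable borel" and vL: "(\<lambda>k. Np 6 (\<lambda>x. V k x - v x)) \<longlonglongrightarrow> 0"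
    by (rule Lp_complete[of V lborel 6, OF _ _ C6]) (auto simp: D12_measurable[OF V])
  show ?thesis by (rule that[OF D12_closed[OF v G V vL GL] vL GL])
qed

lemma integrable_inner_L2:
  fixes G H :: "real^3 \<Rightarrow> 'b::euclidean_space"
  assumes [measurable]: "G \<in> borel_measurable borel" "H \<in> borel_measurable borel"
    and "Np 2 G < \<infinity>" "Np 2 H < \<infinity>"
  shows "integrable lborel (\<lambda>x. G x \<bullet> H x)"
proof (rule integrableI_bounded)
  have "(\<integral>\<^sup>+x. ennreal (norm (G x \<bullet> H x)) \<partial>lborel) \<le> (\<integral>\<^sup>+x. ennreal ((norm (G x))\<^sup>2) + ennreal ((norm (H x))\<^sup>2) \<partial>lborel)"
  proof (rule nn_integral_mono)
    fix x
    have "\<bar>G x \<bullet> H x\<bar> \<le> norm (G x) * norm (H x)" by (rule Cauchy_Schwarz_ineq2)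
    also have "\<dots> \<le> (norm (G x))\<^sup>2 + (norm (H x))\<^sup>2"
      using sum_squares_bound[of "norm (G x)" "norm (H x)"] mult_nonneg_nonneg[of "norm (G x)" "norm (H x)"]
      norm_ge_zero[of "G x"] norm_ge_zero[of "H x"] by linarith
    finally show "ennreal (norm (G x \<bullet> H x)) \<le> ennreal ((norm (G x))\<^sup>2) + ennreal ((norm (H x))\<^sup>2)"
      by (simp add: ennreal_plus[symmetric] ennreal_leI del: ennreal_plus)
  qed
  also have "\<dots> = Np 2 G + Np 2 H" by (rule nn_integral_add) measurable
  also have "\<dots> < \<infinity>" using assms by simp
  finally show "(\<integral>\<^sup>+x. ennreal (norm (G x \<bullet> H x)) \<partial>lborel) < \<infinity>" .
qed measurable

lemma D12_integrable_inner:
  assumes "has_D12_gradient v G" "has_D12_gradient w H"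
  shows "integrable lborel (\<lambda>x. G x \<bullet> H x)"
  by (intro integrable_inner_L2 D12_measurable[OF assms(1)] D12_measurable[OF assms(2)] D12_Np2_finite[OF assms(1)] D12_Np2_finite[OF assms(2)])

section \<open>Compactness\<close>

abbreviation ip :: "(real^3 \<Rightarrow> 'b::euclidean_space) \<Rightarrow> (real^3 \<Rightarrow> 'b) \<Rightarrow> real" where
  "ip G H \<equiv> (\<integral>x. G x \<bullet> H x \<partial>lborel)"

definition L2 :: "(real^3 \<Rightarrow> 'b::euclidean_space) \<Rightarrow> bool" where
  "L2 G \<longleftrightarrow> G \<in> borel_measurable borel \<and> Np 2 G < \<infinity>"

lemma L2_measurable: "L2 G \<Longrightarrow> G \<in> borel_measurable borel"
  by (simp add: L2_def)

lemma D12_L2: "has_D12_gradient v G \<Longrightarrow> L2 G"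
  by (simp add: L2_def D12_measurable D12_Np2_finite[unfolded infinity_ennreal_def])

lemma L2_integrable: "L2 G \<Longrightarrow> L2 H \<Longrightarrow> integrable lborel (\<lambda>x. G x \<bullet> H x)"
  unfolding L2_def by (intro integrable_inner_L2) auto

lemma Np2_eq_ip: "L2 G \<Longrightarrow> Np 2 G = ennreal (ip G G)"
proof -
  assume G: "L2 G"
  have "Np 2 G = (\<integral>\<^sup>+x. ennreal (G x \<bullet> G x) \<partial>lborel)" by (simp add: power2_norm_eq_inner)
  also have "\<dots> = ennreal (ip G G)" by (rule nn_integral_eq_integral[OF L2_integrable[OF G G]]) simp
  finally show ?thesis .
qed

lemma ip_nonneg: "ip G G \<ge> 0"
  by simp

lemma L2_add: "L2 G \<Longrightarrow> L2 H \<Longrightarrow> L2 (\<lambda>x. G x + H x)"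
proof -
  assume "L2 G" "L2 H"
  then have [measurable]: "G \<in> borel_measurable borel" "H \<in> borel_measurable borel" and f: "Np 2 G < \<infinity>" "Np 2 H < \<infinity>"
    by (auto simp: L2_def)
  have "Np 2 (\<lambda>x. G x + H x) \<le> ennreal (2 ^ 2) * (Np 2 G + Np 2 H)" by (rule nn_integral_norm_power_add) measurable
  also have "\<dots> < \<infinity>" using f by (simp add: ennreal_mult_less_top)
  finally show ?thesis by (simp add: L2_def)
qed

lemma L2_scaleR: "L2 G \<Longrightarrow> L2 (\<lambda>x. c *\<^sub>R G x)"
proof -
  assume "L2 G"
  then have [measurable]: "G \<in> borel_measurable borel" and f: "Np 2 G < \<infinity>"
    by (auto simp: L2_def)
  have "Np 2 (\<lambda>x. c *\<^sub>R G x) = (\<integral>\<^sup>+x. ennreal (\<bar>c\<bar>\<^sup>2) * ennreal ((norm (G x))\<^sup>2) \<partial>lborel)"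
    by (simp add: power_mult_distrib ennreal_mult)
  also have "\<dots> = ennreal (\<bar>c\<bar>\<^sup>2) * Np 2 G" by (rule nn_integral_cmult) measurable
  also have "\<dots> < \<infinity>" using f by (simp add: ennreal_mult_less_top)
  finally show ?thesis by (simp add: L2_def)
qed

lemma L2_diff: "L2 G \<Longrightarrow> L2 H \<Longrightarrow> L2 (\<lambda>x. G x - H x)"
  using L2_add[of G "\<lambda>x. (-1) *\<^sub>R H x"] L2_scaleR[of H "-1"] by simp

lemma ip_lincomb:
  assumes "L2 G" "L2 H" "L2 K"
  shows "ip (\<lambda>x. a *\<^sub>R G x + b *\<^sub>R H x) K = a * ip G K + b * ip H K"
proof -
  have "ip (\<lambda>x. a *\<^sub>R G x + b *\<^sub>R H x) K = (\<integral>x. a * (G x \<bullet> K x) + b * (H x \<bullet> K x) \<partial>lborel)"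
    by (simp add: inner_add_left)
  also have "\<dots> = a * ip G K + b * ip H K"
    using L2_integrable[OF assms(1,3)] L2_integrable[OF assms(2,3)] by simp
  finally show ?thesis .
qed

lemma ip_commute: "ip G H = ip H G"
  by (simp add: inner_commute)

lemma ip_quadratic:
  assumes G: "L2 G" and H: "L2 H"
  shows "ip (\<lambda>x. a *\<^sub>R G x + b *\<^sub>R H x) (\<lambda>x. a *\<^sub>R G x + b *\<^sub>R H x) = a\<^sup>2 * ip G G + 2 * a * b * ip G H + b\<^sup>2 * ip H H"
proof -
  let ?K = "\<lambda>x. a *\<^sub>R G x + b *\<^sub>R H x"
  have K: "L2 ?K" by (intro L2_add L2_scaleR G H)
  have "ip ?K ?K = a * ip G ?K + b * ip H ?K" by (rule ip_lincomb[OF G H K])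
  moreover have "ip G ?K = a * ip G G + b * ip H G" unfolding ip_commute[of G ?K] by (rule ip_lincomb[OF G H G])
  moreover have "ip H ?K = a * ip G H + b * ip H H" unfolding ip_commute[of H ?K] by (rule ip_lincomb[OF G H H])
  ultimately show ?thesis by (simp add: ip_commute[of H G] power2_eq_square algebra_simps)
qed

lemma ip_parallelogram:
  assumes G: "L2 G" and H: "L2 H"
  shows "ip (\<lambda>x. G x - H x) (\<lambda>x. G x - H x) = 2 * ip G G + 2 * ip H H -
    4 * ip (\<lambda>x. (1/2) *\<^sub>R G x + (1/2) *\<^sub>R H x) (\<lambda>x. (1/2) *\<^sub>R G x + (1/2) *\<^sub>R H x)"
  using ip_quadratic[OF G H, of 1 "-1"] ip_quadratic[OF G H, of "1/2" "1/2"]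
  by (simp add: power2_eq_square)

text \<open>Near-minimisers of the energy over a decreasing sequence of midpoint-convex sets form a
  Cauchy sequence by the parallelogram law; this replaces weak compactness and Mazur's lemma.\<close>

lemma D12_near_minimisers:
  fixes C :: "nat \<Rightarrow> ((real^3 \<Rightarrow> complex) \<times> (real^3 \<Rightarrow> complex^3)) set"
  assumes D: "\<And>k w W. (w, W) \<in> C k \<Longrightarrow> has_D12_gradient w W"
    and mid: "\<And>k w W w' W'. (w, W) \<in> C k \<Longrightarrow> (w', W') \<in> C k \<Longrightarrow>
      (\<lambda>x. (1/2) *\<^sub>R w x + (1/2) *\<^sub>R w' x, \<lambda>x. (1/2) *\<^sub>R W x + (1/2) *\<^sub>R W' x) \<in> C k"
    and dec: "\<And>k l. k \<le> l \<Longrightarrow> C l \<subseteq> C k"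
    and bd: "\<And>k. \<exists>w W. (w, W) \<in> C k \<and> ip W W \<le> B"
  obtains v G w W d \<delta> where "has_D12_gradient v G" "\<And>k. (w k, W k) \<in> C k"
    "(\<lambda>k. Np 6 (\<lambda>x. w k x - v x)) \<longlonglongrightarrow> 0" "(\<lambda>k. Np 2 (\<lambda>x. W k x - G x)) \<longlonglongrightarrow> 0"
    "\<And>k w W. (w, W) \<in> C k \<Longrightarrow> d k \<le> ip W W" "d \<longlonglongrightarrow> \<delta>" "\<And>k. d k \<le> \<delta>" "ip G G \<le> \<delta>"
proof -
  define E where "E k = (\<lambda>(w, W). ip W W) ` C k" for k
  define d where "d k = Inf (E k)" for k
  have bb: "bdd_below (E k)" for k unfolding E_def by (intro bdd_belowI[of _ 0]) auto
  have ne: "E k \<noteq> {}" for k using bd[of k] by (auto simp: E_def)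
  have dle: "d k \<le> ip W W" if "(w, W) \<in> C k" for k w W
    unfolding d_def using that bb by (intro cInf_lower) (auto simp: E_def intro!: rev_image_eqI)
  have dB: "d k \<le> B" for k using bd[of k] dle by (meson order_trans)
  have dm: "incseq d"
    unfolding d_def by (intro incseq_SucI cInf_superset_mono ne bb) (unfold E_def, intro image_mono dec, simp)
  then obtain \<delta> where \<delta>: "d \<longlonglongrightarrow> \<delta>" "\<And>k. d k \<le> \<delta>"
    using incseq_convergent[of d B] dB by blast
  \<comment> \<open>The infima \<open>d k\<close> increase to \<delta>, so a slack that tends to 0
    forces the distances in the parallelogram law to tend to 0 as well.\<close>
  have "\<forall>k. \<exists>p. p \<in> C k \<and> ip (snd p) (snd p) < d k + 1 / Suc k"
  proof
    fix k
    have "Inf (E k) < d k + 1 / Suc k" unfolding d_def by simp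
    from cInf_lessD[OF ne this] show "\<exists>p. p \<in> C k \<and> ip (snd p) (snd p) < d k + 1 / Suc k"
      unfolding E_def by force
  qed
  from choice[OF this] obtain p where p: "\<And>k. p k \<in> C k" "\<And>k. ip (snd (p k)) (snd (p k)) < d k + 1 / Suc k"
    by blast
  define w where "w k = fst (p k)" for k
  define W where "W k = snd (p k)" for k
  have wC: "(w k, W k) \<in> C k" for k using p(1) by (simp add: w_def W_def)
  have We: "ip (W k) (W k) < d k + 1 / Suc k" for k using p(2) by (simp add: W_def)
  note wD = D[OF wC]
  note WL = D12_L2[OF wD]
  have diff: "ip (\<lambda>x. W k x - W l x) (\<lambda>x. W k x - W l x) \<le> 2 * (\<delta> - d k) + 4 * (1 / Suc k)" if "k \<le> l" for k l
  proof -
    have "(w l, W l) \<in> C k" using wC dec[OF that] by blast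
    then have "d k \<le> ip (\<lambda>x. (1/2) *\<^sub>R W k x + (1/2) *\<^sub>R W l x) (\<lambda>x. (1/2) *\<^sub>R W k x + (1/2) *\<^sub>R W l x)"
      by (intro dle[OF mid[OF wC]])
    moreover have "1 / real (Suc l) \<le> 1 / real (Suc k)" using that by (intro divide_left_mono) auto
    moreover have "x \<le> 2 * (\<delta> - dk) + 4 * u"
      if "dk \<le> m" "u' \<le> u" "x = 2 * a + 2 * b - 4 * m" "a < dk + u" "b < dl + u'" "dl \<le> \<delta>" for x a b m dk dl u u' :: real
      using that by argo
    ultimately show ?thesis
      using ip_parallelogram[OF WL WL] We \<delta>(2) by blast
  qed
  have C: "\<exists>N. \<forall>k\<ge>N. \<forall>l\<ge>N. Np 2 (\<lambda>x. W k x - W l x) \<le> ennreal e" if "e > 0" for e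
  proof -
    have "(\<lambda>k. 2 * (\<delta> - d k) + 4 * (1 / Suc k)) \<longlonglongrightarrow> 2 * (\<delta> - \<delta>) + 4 * 0"
      by (intro tendsto_intros \<delta> LIMSEQ_Suc[OF lim_1_over_n])
    then have "\<forall>\<^sub>F k in sequentially. 2 * (\<delta> - d k) + 4 * (1 / Suc k) < e"
      using \<open>e > 0\<close> by (intro order_tendstoD) auto
    then obtain N where N: "\<And>k. k \<ge> N \<Longrightarrow> 2 * (\<delta> - d k) + 4 * (1 / Suc k) < e" by (auto simp: eventually_sequentially)
    have le: "Np 2 (\<lambda>x. W k x - W l x) \<le> ennreal e" if "k \<ge> N" "k \<le> l" for k l
      unfolding Np2_eq_ip[OF L2_diff[OF WL WL]] using diff[OF that(2)] N[OF that(1)] by (intro ennreal_leI) linarith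
    have "Np 2 (\<lambda>x. W k x - W l x) \<le> ennreal e" if "k \<ge> N" "l \<ge> N" for k l
      using le[of k l] le[of l k] that nn_integral_norm_power_swap[where u="W k" and v="W l"] by (cases "k \<le> l") auto
    then show ?thesis by blast
  qed
  obtain v G where vG: "has_D12_gradient v G"
    "(\<lambda>k. Np 6 (\<lambda>x. w k x - v x)) \<longlonglongrightarrow> 0" "(\<lambda>k. Np 2 (\<lambda>x. W k x - G x)) \<longlonglongrightarrow> 0"
    by (rule D12_complete[OF wD C])
  note [measurable] = L2_measurable[OF WL] D12_measurable[OF vG(1)]
  obtain r where r: "strict_mono r" "AE x in lborel. (\<lambda>k. W (r k) x) \<longlonglongrightarrow> G x"
    by (rule Lp_tendsto_AE_subseq[of W lborel G 2, OF _ _ vG(3)]) auto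
  have "ip G G \<le> \<delta>"
  proof (rule field_le_epsilon)
    fix e :: real assume "e > 0"
    have "(\<lambda>k. 1 / Suc k) \<longlonglongrightarrow> (0::real)" by (rule LIMSEQ_Suc[OF lim_1_over_n])
    then have "\<forall>\<^sub>F k in sequentially. 1 / Suc k < e" using \<open>e > 0\<close> by (rule order_tendstoD)
    then obtain N where N: "\<And>k. k \<ge> N \<Longrightarrow> 1 / Suc k < e" by (auto simp: eventually_sequentially)
    have "Np 2 (W (r k)) \<le> ennreal (\<delta> + e)" if "k \<ge> N" for k
      unfolding Np2_eq_ip[OF WL] using We[of "r k"] \<delta>(2)[of "r k"] N[of "r k"] strict_mono_imp_increasing[OF r(1), of k] that
      by (intro ennreal_leI) linarith
    then have "Np 2 G \<le> ennreal (\<delta> + e)"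
      by (intro nn_integral_Fatou_le[OF _ r(2)]) (auto simp: eventually_sequentially)
    moreover have "0 \<le> d N"
      unfolding d_def by (intro cInf_greatest[OF ne]) (auto simp: E_def)
    then have "0 \<le> \<delta> + e" using \<delta>(2)[of N] \<open>e > 0\<close> by simp
    ultimately show "ip G G \<le> \<delta> + e"
      unfolding Np2_eq_ip[OF D12_L2[OF vG(1)]] by (subst (asm) ennreal_le_iff) auto
  qed
  from that[OF vG(1) wC vG(2,3) dle \<delta>(1) \<delta>(2) this] show ?thesis .
qed

section \<open>Averages over balls and compactness of sequences of bounded energy\<close>

lemma D12_lincomb:
  "has_D12_gradient v G \<Longrightarrow> has_D12_gradient w H \<Longrightarrow>
   has_D12_gradient (\<lambda>x. a *\<^sub>R v x + b *\<^sub>R w x) (\<lambda>x. a *\<^sub>R G x + b *\<^sub>R H x)"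
  by (intro D12_add D12_scaleR)

lemma norm_convex_comb_square:
  fixes a b :: "'b::real_normed_vector"
  assumes "0 \<le> t" "t \<le> 1"
  shows "(norm ((1 - t) *\<^sub>R a + t *\<^sub>R b))\<^sup>2 \<le> (1 - t) * (norm a)\<^sup>2 + t * (norm b)\<^sup>2"
proof -
  have "norm ((1 - t) *\<^sub>R a + t *\<^sub>R b) \<le> (1 - t) * norm a + t * norm b"
    using assms norm_triangle_ineq[of "(1 - t) *\<^sub>R a" "t *\<^sub>R b"] by simp
  then have "(norm ((1 - t) *\<^sub>R a + t *\<^sub>R b))\<^sup>2 \<le> ((1 - t) * norm a + t * norm b)\<^sup>2"
    by (rule power_mono) simp
  also have "\<dots> = (1 - t) * (norm a)\<^sup>2 + t * (norm b)\<^sup>2 - t * (1 - t) * (norm a - norm b)\<^sup>2"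
    by (simp add: power2_eq_square algebra_simps)
  also have "\<dots> \<le> (1 - t) * (norm a)\<^sup>2 + t * (norm b)\<^sup>2" using assms by simp
  finally show ?thesis .
qed

text \<open>By convexity of the square, balls of L^2 are convex; this is what makes the constraint
  sets in the compactness proof convex.\<close>

lemma nn_integral_convex_comb_le:
  fixes u w v :: "'a \<Rightarrow> 'b::{real_normed_vector, second_countable_topology}"
  assumes [measurable]: "u \<in> borel_measurable M" "w \<in> borel_measurable M" "v \<in> borel_measurable M"
    and t: "0 \<le> t" "t \<le> 1"
    and "(\<integral>\<^sup>+x. ennreal ((norm (u x - v x))\<^sup>2) \<partial>M) \<le> ennreal d" "(\<integral>\<^sup>+x. ennreal ((norm (w x - v x))\<^sup>2) \<partial>M) \<le> ennreal d"
    and "d \<ge> 0"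
  shows "(\<integral>\<^sup>+x. ennreal ((norm (((1 - t) *\<^sub>R u x + t *\<^sub>R w x) - v x))\<^sup>2) \<partial>M) \<le> ennreal d"
proof -
  have "(\<integral>\<^sup>+x. ennreal ((norm (((1 - t) *\<^sub>R u x + t *\<^sub>R w x) - v x))\<^sup>2) \<partial>M) \<le>
    (\<integral>\<^sup>+x. ennreal (1 - t) * ennreal ((norm (u x - v x))\<^sup>2) + ennreal t * ennreal ((norm (w x - v x))\<^sup>2) \<partial>M)"
  proof (rule nn_integral_mono)
    fix x
    have "((1 - t) *\<^sub>R u x + t *\<^sub>R w x) - v x = (1 - t) *\<^sub>R (u x - v x) + t *\<^sub>R (w x - v x)"
      by (simp add: algebra_simps)
    then show "ennreal ((norm (((1 - t) *\<^sub>R u x + t *\<^sub>R w x) - v x))\<^sup>2) \<le>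
        ennreal (1 - t) * ennreal ((norm (u x - v x))\<^sup>2) + ennreal t * ennreal ((norm (w x - v x))\<^sup>2)"
      using norm_convex_comb_square[OF t, of "u x - v x" "w x - v x"] t
      by (simp add: ennreal_mult[symmetric] ennreal_plus[symmetric] ennreal_leI del: ennreal_plus)
  qed
  also have "\<dots> = ennreal (1 - t) * (\<integral>\<^sup>+x. ennreal ((norm (u x - v x))\<^sup>2) \<partial>M) + ennreal t * (\<integral>\<^sup>+x. ennreal ((norm (w x - v x))\<^sup>2) \<partial>M)"
    by (simp add: nn_integral_add nn_integral_cmult)
  also have "\<dots> \<le> ennreal (1 - t) * ennreal d + ennreal t * ennreal d"
    using assms by (intro add_mono mult_left_mono) auto
  also have "\<dots> = ennreal ((1 - t) * d + t * d)" using t \<open>d \<ge> 0\<close>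
    by (simp only: ennreal_mult ennreal_plus mult_nonneg_nonneg diff_ge_0_iff_ge)
  also have "(1 - t) * d + t * d = d" by (simp add: algebra_simps)
  finally show ?thesis .
qed

text \<open>The mean of \<open>u\<close> over the ball around \<open>x\<close>, left multiplied by
  \<open>ball_vol \<epsilon>\<close> so that the estimates need no division.\<close>

definition ball_sum :: "real \<Rightarrow> (real^3 \<Rightarrow> complex) \<Rightarrow> real^3 \<Rightarrow> complex" where
  "ball_sum \<epsilon> u x = (\<integral>y. indicator (ball 0 \<epsilon>) y *\<^sub>R u (x + y) \<partial>lborel)"

definition ball_vol :: "real \<Rightarrow> real" where
  "ball_vol \<epsilon> = measure lborel (ball (0::real^3) \<epsilon>)"

lemma ball_vol_pos: "\<epsilon> > 0 \<Longrightarrow> ball_vol \<epsilon> > 0"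
  unfolding ball_vol_def by (simp add: content_ball_pos)

lemma ball_vol_nonneg: "ball_vol \<epsilon> \<ge> 0"
  by (simp add: ball_vol_def)

lemma ball_sets[measurable]: "ball a r \<in> sets borel"
  by simp

lemma emeasure_ball_vol: "emeasure lborel (ball (a::real^3) \<epsilon>) = ennreal (ball_vol \<epsilon>)"
proof -
  have "emeasure lborel (ball a \<epsilon>) = (\<integral>\<^sup>+x. indicator (ball a \<epsilon>) x \<partial>lborel)" by simp
  also have "\<dots> = (\<integral>\<^sup>+x. indicator (ball a \<epsilon>) (x + a) \<partial>lborel)"
    using nn_integral_similarity[of "\<lambda>x::real^3. x" 1 "indicator (ball a \<epsilon>)" a] by (simp add: orthogonal_transformation_id)
  also have "(\<lambda>x. indicator (ball a \<epsilon>) (x + a) :: ennreal) = indicator (ball 0 \<epsilon>)"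
    by (auto simp: fun_eq_iff indicator_def dist_norm)
  also have "(\<integral>\<^sup>+x. indicator (ball (0::real^3) \<epsilon>) x \<partial>lborel) = emeasure lborel (ball (0::real^3) \<epsilon>)" by simp
  also have "\<dots> = ennreal (ball_vol \<epsilon>)"
    unfolding ball_vol_def using emeasure_lborel_ball_finite[of "0::real^3" \<epsilon>]
    by (intro emeasure_eq_ennreal_measure) auto
  finally show ?thesis .
qed

lemma ball_vol_mono:
  assumes "\<epsilon> \<le> \<epsilon>'" shows "ball_vol \<epsilon> \<le> ball_vol \<epsilon>'"
proof -
  have "emeasure lborel (ball (0::real^3) \<epsilon>) \<le> emeasure lborel (ball (0::real^3) \<epsilon>')"
    using assms by (intro emeasure_mono) auto
  then show ?thesis unfolding emeasure_ball_vol by (simp add: ball_vol_nonneg)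
qed

lemma integrable_ball_indicator: "integrable lborel (indicator (ball (a::real^3) \<epsilon>) :: _ \<Rightarrow> real)"
  by (rule integrable_real_indicator) (auto simp: emeasure_ball_vol)

text \<open>The pointwise bound t <= 1 + t^6 takes the place of Holder's inequality on the
  ball.\<close>

lemma nn_integral_ball_le:
  fixes u :: "real^3 \<Rightarrow> complex"
  assumes [measurable]: "u \<in> borel_measurable borel" and "Np 6 u \<le> ennreal S" "S \<ge> 0"
  shows "(\<integral>\<^sup>+y. ennreal (norm (indicator (ball 0 \<epsilon>) y *\<^sub>R u (x + y))) \<partial>lborel) \<le> ennreal (ball_vol \<epsilon> + S)"
proof -
  have "(\<integral>\<^sup>+y. ennreal (norm (indicator (ball 0 \<epsilon>) y *\<^sub>R u (x + y))) \<partial>lborel) \<le>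
     (\<integral>\<^sup>+y. indicator (ball 0 \<epsilon>) y + ennreal (norm (u (y + x)) ^ 6) \<partial>lborel)"
  proof (rule nn_integral_mono)
    fix y
    have "t \<le> 1 + t ^ 6" if "t \<ge> 0" for t :: real
    proof -
      have "0 \<le> t ^ 6" using that by simp
      moreover have "t \<le> 1 \<or> t \<le> t ^ 6" using self_le_power[of t 6] by linarith
      ultimately show ?thesis by linarith
    qed
    from this[of "norm (u (y + x))"]
    show "ennreal (norm (indicator (ball 0 \<epsilon>) y *\<^sub>R u (x + y))) \<le> indicator (ball 0 \<epsilon>) y + ennreal (norm (u (y + x)) ^ 6)"
      by (auto simp: indicator_def add.commute ennreal_plus[symmetric] simp del: ennreal_plus simp flip: ennreal_1 intro!: ennreal_leI)
  qed
  also have "\<dots> = ennreal (ball_vol \<epsilon>) + Np 6 (\<lambda>y. u (y + x))"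
    by (subst nn_integral_add) (auto simp: emeasure_ball_vol)
  also have "Np 6 (\<lambda>y. u (y + x)) = Np 6 u"
    using Np_similarity[of "\<lambda>x::real^3. x" 1 u 6 x] by (simp add: orthogonal_transformation_id)
  also have "ennreal (ball_vol \<epsilon>) + Np 6 u \<le> ennreal (ball_vol \<epsilon>) + ennreal S" using assms by (intro add_left_mono)
  finally show ?thesis using \<open>S \<ge> 0\<close> by (simp add: ball_vol_def)
qed

lemma integrable_ball:
  fixes u :: "real^3 \<Rightarrow> complex"
  assumes [measurable]: "u \<in> borel_measurable borel" and "Np 6 u \<le> ennreal S" "S \<ge> 0"
  shows "integrable lborel (\<lambda>y. indicator (ball 0 \<epsilon>) y *\<^sub>R u (x + y))"
  using nn_integral_ball_le[OF assms(1-3), of \<epsilon> x] by (intro integrableI_bounded) (measurable, auto intro: le_less_trans)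

lemma norm_ball_sum_le:
  assumes "u \<in> borel_measurable borel" and "Np 6 u \<le> ennreal S" "S \<ge> 0"
  shows "norm (ball_sum \<epsilon> u x) \<le> ball_vol \<epsilon> + S"
proof -
  have "ennreal (norm (ball_sum \<epsilon> u x)) \<le> ennreal (ball_vol \<epsilon> + S)"
    unfolding ball_sum_def
    using order_trans[OF integral_norm_bound_ennreal[OF integrable_ball[OF assms]] nn_integral_ball_le[OF assms]] .
  then show ?thesis using \<open>S \<ge> 0\<close> by (subst (asm) ennreal_le_iff) (auto simp: ball_vol_def)
qed

lemma ball_sum_measurable[measurable]:
  "u \<in> borel_measurable borel \<Longrightarrow> ball_sum \<epsilon> u \<in> borel_measurable borel"
proof -
  assume [measurable]: "u \<in> borel_measurable borel"
  have "(\<lambda>x. ball_sum \<epsilon> u x) \<in> borel_measurable borel" unfolding ball_sum_def by measurable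
  then show ?thesis by simp
qed

text \<open>With \<tau> the distance of the two points, each difference t of values satisfies t <=
  \<tau> + t^2 / \<tau>. The first term integrates over the ball to \<tau> times its volume, the
  second to at most 4 \<tau> B by the translation estimate. Bounded energy thus makes ball averages
  equicontinuous.\<close>

lemma ball_sum_diff_le:
  assumes v: "has_D12_gradient v G" and G: "Np 2 G \<le> ennreal B" "B \<ge> 0"
  shows "norm (ball_sum \<epsilon> v x - ball_sum \<epsilon> v x') \<le> norm (x - x') * (ball_vol \<epsilon> + 4 * B)"
proof (cases "x = x'")
  case False
  define \<tau> where "\<tau> = norm (x - x')"
  have \<tau>: "\<tau> > 0" using False by (simp add: \<tau>_def)
  note [measurable] = D12_measurable[OF v]
  obtain S where S: "S \<ge> 0" "Np 6 v \<le> ennreal S" using D12_Np6_finite[OF v] by (cases "Np 6 v") auto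
  note i = integrable_ball[OF D12_measurable(1)[OF v] S(2,1)]
  have "ennreal (norm (ball_sum \<epsilon> v x - ball_sum \<epsilon> v x')) \<le>
    (\<integral>\<^sup>+y. ennreal (norm (indicator (ball 0 \<epsilon>) y *\<^sub>R v (x + y) - indicator (ball 0 \<epsilon>) y *\<^sub>R v (x' + y))) \<partial>lborel)"
    unfolding ball_sum_def Bochner_Integration.integral_diff[OF i i, symmetric]
    by (rule integral_norm_bound_ennreal[OF Bochner_Integration.integrable_diff[OF i i]])
  also have "\<dots> \<le> (\<integral>\<^sup>+y. ennreal \<tau> * indicator (ball 0 \<epsilon>) y + ennreal (1 / \<tau>) * ennreal ((norm (v (x + y) - v (x' + y)))\<^sup>2) \<partial>lborel)"
  proof (rule nn_integral_mono)
    fix y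
    have "t \<le> \<tau> + 1 / \<tau> * t\<^sup>2" if "t \<ge> 0" for t
    proof (cases "t \<le> \<tau>")
      case False
      then have "t * \<tau> \<le> t * t" using that by (intro mult_left_mono) auto
      then have "t \<le> 1 / \<tau> * t\<^sup>2" using \<tau> by (simp add: field_simps power2_eq_square)
      then show ?thesis using \<tau> by simp
    qed (use \<tau> in \<open>auto intro: add_increasing2\<close>)
    from this[of "norm (v (x + y) - v (x' + y))"]
    show "ennreal (norm (indicator (ball 0 \<epsilon>) y *\<^sub>R v (x + y) - indicator (ball 0 \<epsilon>) y *\<^sub>R v (x' + y))) \<le>
      ennreal \<tau> * indicator (ball 0 \<epsilon>) y + ennreal (1 / \<tau>) * ennreal ((norm (v (x + y) - v (x' + y)))\<^sup>2)"
      using \<tau> by (auto simp: indicator_def ennreal_mult[symmetric] ennreal_plus[symmetric] simp del: ennreal_plus intro!: ennreal_leI)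
  qed
  also have "\<dots> = ennreal \<tau> * ennreal (ball_vol \<epsilon>) + ennreal (1 / \<tau>) * Np 2 (\<lambda>y. v (x + y) - v (x' + y))"
    by (subst nn_integral_add) (auto simp: nn_integral_cmult emeasure_ball_vol)
  also have "\<dots> \<le> ennreal \<tau> * ennreal (ball_vol \<epsilon>) + ennreal (1 / \<tau>) * (ennreal (4 * (norm (x - x'))\<^sup>2) * ennreal B)"
  proof (intro add_left_mono mult_left_mono)
    have "Np 2 (\<lambda>y. v (y + (x - x')) - v y) = Np 2 (\<lambda>y. v (y + x' + (x - x')) - v (y + x'))"
      using Np_similarity[of "\<lambda>x::real^3. x" 1 "\<lambda>y. v (y + (x - x')) - v y" 2 x'] by (simp add: orthogonal_transformation_id)
    then have "Np 2 (\<lambda>y. v (x + y) - v (x' + y)) = Np 2 (\<lambda>y. v (y + (x - x')) - v y)" by (simp add: add.commute)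
    also have "\<dots> \<le> ennreal (4 * (norm (x - x'))\<^sup>2) * ennreal B"
      by (rule order_trans[OF D12_translation_estimate[OF v]]) (rule mult_left_mono[OF G(1)], simp)
    finally show "Np 2 (\<lambda>y. v (x + y) - v (x' + y)) \<le> ennreal (4 * (norm (x - x'))\<^sup>2) * ennreal B" .
  qed simp
  also have "ennreal \<tau> * ennreal (ball_vol \<epsilon>) + ennreal (1 / \<tau>) * (ennreal (4 * (norm (x - x'))\<^sup>2) * ennreal B) =
    ennreal (\<tau> * (ball_vol \<epsilon> + 4 * B))"
  proof -
    have "1 / \<tau> * (4 * \<tau>\<^sup>2 * B) = 4 * \<tau> * B" using \<tau> by (simp add: power2_eq_square)
    then show ?thesis using \<tau> \<open>B \<ge> 0\<close> unfolding \<tau>_def[symmetric]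
      by (simp add: ball_vol_def ennreal_mult[symmetric] ennreal_plus[symmetric] algebra_simps del: ennreal_plus)
  qed
  finally show ?thesis using \<tau> \<open>B \<ge> 0\<close> unfolding \<tau>_def[symmetric]
    by (subst (asm) ennreal_le_iff) (auto simp: ball_vol_def add_left_mono mult_left_mono)
qed simp

text \<open>Cauchy-Schwarz over the ball and Tonelli reduce the error to translation estimates with
  shifts shorter than \<epsilon>. After division by the squared volume the bound is
  \<open>4 * \<epsilon>\<^sup>2 * B\<close>, uniform over all functions of bounded energy.\<close>

lemma ball_sum_L2_error:
  assumes v: "has_D12_gradient v G" and G: "Np 2 G \<le> ennreal B" "B \<ge> 0"
  shows "Np 2 (\<lambda>x. ball_vol \<epsilon> *\<^sub>R v x - ball_sum \<epsilon> v x) \<le> ennreal ((ball_vol \<epsilon>)\<^sup>2 * (4 * \<epsilon>\<^sup>2 * B))"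
proof -
  note [measurable] = D12_measurable[OF v]
  obtain S where S: "S \<ge> 0" "Np 6 v \<le> ennreal S" using D12_Np6_finite[OF v] by (cases "Np 6 v") auto
  note i = integrable_ball[OF D12_measurable(1)[OF v] S(2,1)]
  let ?I = "\<lambda>y. indicator (ball (0::real^3) \<epsilon>) y :: ennreal"
  have ic: "integrable lborel (\<lambda>y. indicator (ball (0::real^3) \<epsilon>) y *\<^sub>R v x)" for x
    by (intro integrable_scaleR_left integrable_ball_indicator)
  have "Np 2 (\<lambda>x. ball_vol \<epsilon> *\<^sub>R v x - ball_sum \<epsilon> v x) \<le>
    (\<integral>\<^sup>+x. (\<integral>\<^sup>+y. ennreal ((norm (v (x + y) - v x))\<^sup>2) * ?I y \<partial>lborel) * ennreal (ball_vol \<epsilon>) \<partial>lborel)"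
  proof (rule nn_integral_mono)
    fix x
    have "ball_vol \<epsilon> *\<^sub>R v x = (\<integral>y. indicator (ball (0::real^3) \<epsilon>) y *\<^sub>R v x \<partial>lborel)"
      unfolding ball_vol_def using integrable_ball_indicator by (subst integral_scaleR_left) auto
    then have "ball_vol \<epsilon> *\<^sub>R v x - ball_sum \<epsilon> v x = (\<integral>y. indicator (ball 0 \<epsilon>) y *\<^sub>R v x - indicator (ball 0 \<epsilon>) y *\<^sub>R v (x + y) \<partial>lborel)"
      unfolding ball_sum_def Bochner_Integration.integral_diff[OF ic i] by simp
    then have "ennreal (norm (ball_vol \<epsilon> *\<^sub>R v x - ball_sum \<epsilon> v x)) \<le>
       (\<integral>\<^sup>+y. ennreal (norm (indicator (ball 0 \<epsilon>) y *\<^sub>R v x - indicator (ball 0 \<epsilon>) y *\<^sub>R v (x + y))) \<partial>lborel)"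
      using integral_norm_bound_ennreal[OF Bochner_Integration.integrable_diff[OF ic i]] by (simp only:)
    also have "\<dots> = (\<integral>\<^sup>+y. (ennreal (norm (v (x + y) - v x)) * ?I y) * ?I y \<partial>lborel)"
      by (intro nn_integral_cong) (auto simp: indicator_def norm_minus_commute)
    finally have "(ennreal (norm (ball_vol \<epsilon> *\<^sub>R v x - ball_sum \<epsilon> v x)))\<^sup>2 \<le> (\<integral>\<^sup>+y. (ennreal (norm (v (x + y) - v x)) * ?I y) * ?I y \<partial>lborel)\<^sup>2"
      by (rule power_mono) simp
    also have "\<dots> \<le> (\<integral>\<^sup>+y. (ennreal (norm (v (x + y) - v x)) * ?I y)\<^sup>2 \<partial>lborel) * (\<integral>\<^sup>+y. (?I y)\<^sup>2 \<partial>lborel)"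
      by (rule Cauchy_Schwarz_nn_integral) measurable
    also have "(\<integral>\<^sup>+y. (ennreal (norm (v (x + y) - v x)) * ?I y)\<^sup>2 \<partial>lborel) = (\<integral>\<^sup>+y. ennreal ((norm (v (x + y) - v x))\<^sup>2) * ?I y \<partial>lborel)"
      by (intro nn_integral_cong) (auto simp: indicator_def ennreal_power)
    also have "(\<integral>\<^sup>+y. (?I y)\<^sup>2 \<partial>lborel) = (\<integral>\<^sup>+y. ?I y \<partial>lborel)"
      by (intro nn_integral_cong) (auto simp: indicator_def)
    also have "\<dots> = ennreal (ball_vol \<epsilon>)" by (simp add: emeasure_ball_vol)
    finally show "ennreal ((norm (ball_vol \<epsilon> *\<^sub>R v x - ball_sum \<epsilon> v x))\<^sup>2) \<le>
      (\<integral>\<^sup>+y. ennreal ((norm (v (x + y) - v x))\<^sup>2) * ?I y \<partial>lborel) * ennreal (ball_vol \<epsilon>)"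
      by (simp add: ennreal_power)
  qed
  also have "\<dots> = (\<integral>\<^sup>+x. (\<integral>\<^sup>+y. ennreal ((norm (v (x + y) - v x))\<^sup>2) * ?I y \<partial>lborel) \<partial>lborel) * ennreal (ball_vol \<epsilon>)"
    by (rule nn_integral_multc) measurable
  also have "(\<integral>\<^sup>+x. (\<integral>\<^sup>+y. ennreal ((norm (v (x + y) - v x))\<^sup>2) * ?I y \<partial>lborel) \<partial>lborel) =
     (\<integral>\<^sup>+y. (\<integral>\<^sup>+x. ennreal ((norm (v (x + y) - v x))\<^sup>2) * ?I y \<partial>lborel) \<partial>lborel)"
    by (rule lborel_pair.Fubini') measurable
  also have "\<dots> \<le> (\<integral>\<^sup>+y. ennreal (4 * \<epsilon>\<^sup>2 * B) * ?I y \<partial>lborel)"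
  proof (rule nn_integral_mono)
    fix y :: "real^3"
    have "(\<integral>\<^sup>+x. ennreal ((norm (v (x + y) - v x))\<^sup>2) * ?I y \<partial>lborel) = Np 2 (\<lambda>x. v (x + y) - v x) * ?I y"
      by (rule nn_integral_multc) measurable
    also have "\<dots> \<le> ennreal (4 * \<epsilon>\<^sup>2 * B) * ?I y"
    proof (cases "y \<in> ball 0 \<epsilon>")
      case True
      then have y: "norm y \<le> \<epsilon>" by simp
      have "Np 2 (\<lambda>x. v (x + y) - v x) \<le> ennreal (4 * (norm y)\<^sup>2) * ennreal B"
        by (rule order_trans[OF D12_translation_estimate[OF v]]) (rule mult_left_mono[OF G(1)], simp)
      also have "\<dots> = ennreal (4 * (norm y)\<^sup>2 * B)" using \<open>B \<ge> 0\<close> by (simp add: ennreal_mult)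
      also have "\<dots> \<le> ennreal (4 * \<epsilon>\<^sup>2 * B)"
        using y \<open>B \<ge> 0\<close> by (intro ennreal_leI mult_right_mono mult_left_mono power_mono) auto
      finally show ?thesis by (rule mult_right_mono) simp
    qed simp
    finally show "(\<integral>\<^sup>+x. ennreal ((norm (v (x + y) - v x))\<^sup>2) * ?I y \<partial>lborel) \<le> ennreal (4 * \<epsilon>\<^sup>2 * B) * ?I y" .
  qed
  also have "\<dots> = ennreal (4 * \<epsilon>\<^sup>2 * B) * ennreal (ball_vol \<epsilon>)"
    by (subst nn_integral_cmult) (auto simp: emeasure_ball_vol)
  finally have "Np 2 (\<lambda>x. ball_vol \<epsilon> *\<^sub>R v x - ball_sum \<epsilon> v x) \<le> ennreal (4 * \<epsilon>\<^sup>2 * B) * ennreal (ball_vol \<epsilon>) * ennreal (ball_vol \<epsilon>)"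
    by (simp add: mult_right_mono)
  also have "\<dots> = ennreal ((ball_vol \<epsilon>)\<^sup>2 * (4 * \<epsilon>\<^sup>2 * B))"
  proof -
    have "4 * \<epsilon>\<^sup>2 * B \<ge> 0" using \<open>B \<ge> 0\<close> by simp
    then have "ennreal (4 * \<epsilon>\<^sup>2 * B) * ennreal (ball_vol \<epsilon>) * ennreal (ball_vol \<epsilon>) = ennreal (4 * \<epsilon>\<^sup>2 * B * ball_vol \<epsilon> * ball_vol \<epsilon>)"
      by (simp only: ennreal_mult mult_nonneg_nonneg ball_vol_nonneg)
    then show ?thesis by (simp add: power2_eq_square mult_ac)
  qed
  finally show ?thesis .
qed

text \<open>Bounded convergence of the ball averages requires a finite measure. One below Lebesgue
  measure inherits its integral bounds, and one with the same null sets loses nothing about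
  convergence almost everywhere.\<close>

lemma finite_measure_equivalent_lborel:
  obtains M :: "(real^3) measure" where "sets M = sets borel" "\<And>f. f \<in> borel_measurable borel \<Longrightarrow> (\<integral>\<^sup>+x. f x \<partial>M) \<le> (\<integral>\<^sup>+x. f x \<partial>lborel)"
    "emeasure M UNIV < \<infinity>" "\<And>P. (AE x in M. P x) \<longleftrightarrow> (AE x in lborel. P x)"
proof -
  obtain h :: "real^3 \<Rightarrow> ennreal" where h[measurable]: "h \<in> borel_measurable borel"
    and h2: "(\<integral>\<^sup>+x. h x \<partial>lborel) \<noteq> \<infinity>" "\<And>x. 0 < h x"
    using sigma_finite_measure.Ex_finite_integrable_function[OF sigma_finite_lborel] by auto
  define \<omega> where "\<omega> x = min (h x) 1" for x
  have [measurable]: "\<omega> \<in> borel_measurable borel" unfolding \<omega>_def by measurable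
  have pos: "\<omega> x > 0" "\<omega> x \<le> 1" "\<omega> x \<le> h x" for x using h2(2)[of x] by (auto simp: \<omega>_def)
  show ?thesis
  proof (rule that[of "density lborel \<omega>"])
    fix f :: "real^3 \<Rightarrow> ennreal" assume [measurable]: "f \<in> borel_measurable borel"
    have "(\<integral>\<^sup>+x. f x \<partial>density lborel \<omega>) = (\<integral>\<^sup>+x. \<omega> x * f x \<partial>lborel)" by (rule nn_integral_density) measurable
    also have "\<dots> \<le> (\<integral>\<^sup>+x. 1 * f x \<partial>lborel)" by (intro nn_integral_mono mult_right_mono pos) simp
    finally show "(\<integral>\<^sup>+x. f x \<partial>density lborel \<omega>) \<le> (\<integral>\<^sup>+x. f x \<partial>lborel)" by simp
  next
    have "emeasure (density lborel \<omega>) UNIV = (\<integral>\<^sup>+x. \<omega> x \<partial>lborel)" by (simp add: emeasure_density)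
    also have "\<dots> \<le> (\<integral>\<^sup>+x. h x \<partial>lborel)" by (intro nn_integral_mono pos)
    also have "\<dots> < \<infinity>" using h2(1) by (simp add: less_top)
    finally show "emeasure (density lborel \<omega>) UNIV < \<infinity>" .
  next
    fix P show "(AE x in density lborel \<omega>. P x) \<longleftrightarrow> (AE x in lborel. P x)"
      using pos(1) by (subst AE_density) auto
  qed simp
qed

text \<open>Arzela-Ascoli for all radii 1/(j+1) at once: a diagonal extraction on a countable dense
  set, extended to every point by the uniform Lipschitz bound.\<close>

lemma ball_sum_convergent_subseq:
  fixes V :: "nat \<Rightarrow> real^3 \<Rightarrow> complex"
  assumes V: "\<And>k. has_D12_gradient (V k) (W k)" and B: "\<And>k. Np 2 (W k) \<le> ennreal B" "B \<ge> 0"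
    and S: "\<And>k. Np 6 (V k) \<le> ennreal S" "S \<ge> 0"
  obtains r :: "nat \<Rightarrow> nat" where "strict_mono r" "\<And>j x. convergent (\<lambda>k. ball_sum (1 / Suc j) (V (r k)) x)"
proof -
  obtain Q :: "(real^3) set" where Q: "countable Q" "\<And>X. open X \<Longrightarrow> X \<noteq> {} \<Longrightarrow> \<exists>d\<in>Q. d \<in> X"
    by (rule countable_dense_setE) blast
  have bnd: "norm (ball_sum (1 / Suc j) (V k) x) \<le> ball_vol 1 + S" for j k x
    using norm_ball_sum_le[OF D12_measurable(1)[OF V] S, of "1 / Suc j" k x] ball_vol_mono[of "1 / Suc j" 1] by simp
  have "\<exists>r. strict_mono r \<and> (\<forall>p\<in>(UNIV::nat set) \<times> Q. \<exists>l. (\<lambda>k. ball_sum (1 / real (Suc (fst p))) (V (r k)) (snd p)) \<longlonglongrightarrow> l)"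
    by (rule function_convergent_subsequence[of "UNIV \<times> Q" "\<lambda>k p. ball_sum (1 / real (Suc (fst p))) (V k) (snd p)" "ball_vol 1 + S"])
      (use Q(1) bnd in auto)
  then obtain r where r: "strict_mono r" "\<And>j q. q \<in> Q \<Longrightarrow> \<exists>l. (\<lambda>k. ball_sum (1 / Suc j) (V (r k)) q) \<longlonglongrightarrow> l"
    by auto
  have "convergent (\<lambda>k. ball_sum (1 / Suc j) (V (r k)) x)" for j x
  proof (rule Cauchy_convergent, rule metric_CauchyI)
    fix e :: real assume e: "e > 0"
    define K where "K = ball_vol (1 / Suc j) + 4 * B + 1"
    have K: "K > 0" using B(2) ball_vol_nonneg[of "1 / Suc j"] by (simp add: K_def)
    have "e / (4 * K) > 0" using K e by (intro divide_pos_pos) auto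
    then have "ball x (e / (4 * K)) \<noteq> {}" by (simp only: ball_eq_empty not_le)
    then obtain q where q: "q \<in> Q" "q \<in> ball x (e / (4 * K))" using Q(2)[OF open_ball] by blast
    have close: "norm (ball_sum (1 / Suc j) (V k) x - ball_sum (1 / Suc j) (V k) q) \<le> e / 4" for k
    proof -
      have "norm (ball_sum (1 / Suc j) (V k) x - ball_sum (1 / Suc j) (V k) q) \<le> norm (x - q) * (ball_vol (1 / Suc j) + 4 * B)"
        by (rule ball_sum_diff_le[OF V B])
      also have "\<dots> \<le> (e / (4 * K)) * K"
      proof (intro mult_mono)
        show "norm (x - q) \<le> e / (4 * K)" using q(2) by (simp add: dist_norm)
        show "ball_vol (1 / Suc j) + 4 * B \<le> K" by (simp add: K_def)
        show "0 \<le> e / (4 * K)" using K e by (intro divide_nonneg_pos) auto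
        show "0 \<le> ball_vol (1 / Suc j) + 4 * B" using B(2) by (intro add_nonneg_nonneg ball_vol_nonneg) simp
      qed
      also have "\<dots> = e / 4" using K by simp
      finally show ?thesis .
    qed
    have "Cauchy (\<lambda>k. ball_sum (1 / Suc j) (V (r k)) q)" using r(2)[OF q(1)] by (auto intro: convergent_Cauchy simp: convergent_def)
    then obtain N where N: "\<And>m n. m \<ge> N \<Longrightarrow> n \<ge> N \<Longrightarrow> dist (ball_sum (1 / Suc j) (V (r m)) q) (ball_sum (1 / Suc j) (V (r n)) q) < e / 2"
      using e by (metis metric_CauchyD half_gt_zero)
    have "dist (ball_sum (1 / Suc j) (V (r m)) x) (ball_sum (1 / Suc j) (V (r n)) x) < e" if "m \<ge> N" "n \<ge> N" for m n
    proof -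
      have "norm (a - b) < e" if "norm (a - a') \<le> e / 4" "norm (b - b') \<le> e / 4" "norm (a' - b') < e / 2" for a b a' b' :: complex
      proof -
        have "norm (a - b) = norm ((a - a') + (a' - b') + (b' - b))" by simp
        also have "\<dots> \<le> norm (a - a') + norm (a' - b') + norm (b' - b)" by (intro norm_triangle_le add_mono norm_triangle_ineq) simp
        finally show ?thesis using that by (simp add: norm_minus_commute)
      qed
      from this[OF close close] N[OF that] show ?thesis by (simp add: dist_norm)
    qed
    then show "\<exists>M. \<forall>m\<ge>M. \<forall>n\<ge>M. dist (ball_sum (1 / Suc j) (V (r m)) x) (ball_sum (1 / Suc j) (V (r n)) x) < e" by blast
  qed
  with r(1) show ?thesis by (rule that)
qed

lemma bounded_convergence_L2:
  fixes a :: "nat \<Rightarrow> 'a \<Rightarrow> complex"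
  assumes [measurable]: "\<And>k. a k \<in> borel_measurable M" and fin: "emeasure M (space M) < \<infinity>"
    and bnd: "\<And>k x. norm (a k x) \<le> K" and cv: "\<And>x. convergent (\<lambda>k. a k x)" and "e > 0"
  shows "\<exists>N. \<forall>k\<ge>N. \<forall>l\<ge>N. (\<integral>\<^sup>+x. ennreal ((norm (a k x - a l x))\<^sup>2) \<partial>M) \<le> ennreal e"
proof -
  define b where "b x = lim (\<lambda>k. a k x)" for x
  have b: "(\<lambda>k. a k x) \<longlonglongrightarrow> b x" for x using cv[of x] by (simp add: b_def convergent_LIMSEQ_iff)
  have [measurable]: "b \<in> borel_measurable M" unfolding b_def by measurable
  have bb: "norm (b x) \<le> K" for x
    by (rule Lim_bounded[OF tendsto_norm[OF b]]) (use bnd in auto)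
  have "(\<lambda>k. \<integral>\<^sup>+x. ennreal ((norm (a k x - b x))\<^sup>2) \<partial>M) \<longlonglongrightarrow> (\<integral>\<^sup>+x. 0 \<partial>M)"
  proof (rule nn_integral_dominated_convergence[where w="\<lambda>_. ennreal ((2 * K)\<^sup>2)"])
    show "AE x in M. ennreal ((norm (a k x - b x))\<^sup>2) \<le> ennreal ((2 * K)\<^sup>2)" for k
    proof (intro AE_I2 ennreal_leI power_mono norm_triangle_le_diff)
      show "norm (a k x) + norm (b x) \<le> 2 * K" for x using bnd[of k x] bb[of x] by linarith
    qed simp
    show "AE x in M. (\<lambda>k. ennreal ((norm (a k x - b x))\<^sup>2)) \<longlonglongrightarrow> 0"
    proof (rule AE_I2)
      fix x
      have "(\<lambda>k. (norm (a k x - b x))\<^sup>2) \<longlonglongrightarrow> (norm (b x - b x))\<^sup>2" by (intro tendsto_intros b)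
      then have "(\<lambda>k. ennreal ((norm (a k x - b x))\<^sup>2)) \<longlonglongrightarrow> ennreal ((norm (b x - b x))\<^sup>2)" by (rule tendsto_ennrealI)
      then show "(\<lambda>k. ennreal ((norm (a k x - b x))\<^sup>2)) \<longlonglongrightarrow> 0" by simp
    qed
    show "(\<integral>\<^sup>+x. ennreal ((2 * K)\<^sup>2) \<partial>M) < \<infinity>" using fin by (simp add: ennreal_mult_less_top)
  qed measurable
  then have "(\<lambda>k. \<integral>\<^sup>+x. ennreal (norm (a k x - b x) ^ 2) \<partial>M) \<longlonglongrightarrow> 0" by simp
  from Lp_tendsto_imp_Cauchy[OF _ _ this \<open>e > 0\<close>] show ?thesis by simp
qed

text \<open>Two members are compared through their ball averages: replacing a function by its
  average costs little, uniformly in the index, and for a fixed radius the averages converge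
  boundedly.\<close>

lemma Rellich_Cauchy:
  fixes V :: "nat \<Rightarrow> real^3 \<Rightarrow> complex"
  assumes V: "\<And>k. has_D12_gradient (V k) (W k)" and B: "\<And>k. Np 2 (W k) \<le> ennreal B" "B \<ge> 0"
    and M: "sets M = sets borel" "\<And>f. f \<in> borel_measurable borel \<Longrightarrow> (\<integral>\<^sup>+x. f x \<partial>M) \<le> (\<integral>\<^sup>+x. f x \<partial>lborel)"
      "emeasure M UNIV < \<infinity>"
  obtains r :: "nat \<Rightarrow> nat" where "strict_mono r"
    "\<And>e. e > 0 \<Longrightarrow> \<exists>N. \<forall>k\<ge>N. \<forall>l\<ge>N. (\<integral>\<^sup>+x. ennreal ((norm (V (r k) x - V (r l) x))\<^sup>2) \<partial>M) \<le> ennreal e"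
proof -
  note VM[measurable] = D12_measurable(1)[OF V]
  have [measurable_cong]: "sets M = sets borel" by (rule M)
  define S where "S = 2 ^ 24 * B ^ 3"
  have S: "S \<ge> 0" using B(2) by (simp add: S_def)
  have SV: "Np 6 (V k) \<le> ennreal S" for k
  proof -
    have "Np 6 (V k) \<le> 2 ^ 24 * (Np 2 (W k)) ^ 3" by (rule D12_Sobolev[OF V])
    also have "\<dots> \<le> 2 ^ 24 * (ennreal B) ^ 3" by (intro mult_left_mono power_mono B) auto
    also have "\<dots> = ennreal S" using B(2) by (simp add: S_def ennreal_mult ennreal_power)
    finally show ?thesis .
  qed
  obtain r where r: "strict_mono r" "\<And>j x. convergent (\<lambda>k. ball_sum (1 / Suc j) (V (r k)) x)"
    by (rule ball_sum_convergent_subseq[where V=V and W=W, OF V B SV S]) blast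
  let ?I = "\<lambda>u. \<integral>\<^sup>+x. ennreal ((norm (u x :: complex))\<^sup>2) \<partial>M"
  show ?thesis
  proof (rule that[OF r(1)])
    fix e :: real assume e: "e > 0"
    \<comment> \<open>128 is 2^2 * 2^2 * (4 + 4), from two quasi-triangle inequalities and two
      replacement errors. The averages contribute 2^2 * e / 8, the other half of
      \<open>e\<close>.\<close>
    have "(\<lambda>j. 128 * B * (1 / Suc j)\<^sup>2) \<longlonglongrightarrow> 128 * B * 0\<^sup>2" by (intro tendsto_intros LIMSEQ_Suc[OF lim_1_over_n])
    then have "\<forall>\<^sub>F j in sequentially. 128 * B * (1 / Suc j)\<^sup>2 < e / 2" by (rule order_tendstoD) (use e in simp)
    then obtain j where j: "128 * B * (1 / Suc j)\<^sup>2 < e / 2" by (auto simp: eventually_sequentially)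
    define \<epsilon> where "\<epsilon> = 1 / real (Suc j)"
    define \<beta> where "\<beta> = ball_vol \<epsilon>"
    have \<beta>: "\<beta> > 0" unfolding \<beta>_def \<epsilon>_def by (rule ball_vol_pos) simp
    define A where "A k = ball_sum \<epsilon> (V (r k))" for k
    have [measurable]: "A k \<in> borel_measurable borel" for k unfolding A_def by measurable
    define D where "D k x = \<beta> *\<^sub>R V (r k) x - A k x" for k x
    have [measurable]: "D k \<in> borel_measurable borel" for k unfolding D_def by measurable
    have D: "?I (D k) \<le> ennreal (\<beta>\<^sup>2 * (4 * \<epsilon>\<^sup>2 * B))" for k
    proof -
      have "?I (D k) \<le> Np 2 (D k)" by (rule M(2)) measurable
      also have "\<dots> \<le> ennreal (\<beta>\<^sup>2 * (4 * \<epsilon>\<^sup>2 * B))"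
        unfolding D_def A_def \<beta>_def by (rule ball_sum_L2_error[OF V B])
      finally show ?thesis .
    qed
    have "space M = UNIV" using sets_eq_imp_space_eq[OF M(1)] by simp
    then have "\<exists>N. \<forall>k\<ge>N. \<forall>l\<ge>N. ?I (\<lambda>x. A k x - A l x) \<le> ennreal (\<beta>\<^sup>2 * (e / 8))"
      using M(3) r(2)[of j] e \<beta>
      by (intro bounded_convergence_L2[where K="ball_vol \<epsilon> + S"])
        (auto simp: A_def \<epsilon>_def intro!: norm_ball_sum_le VM SV S)
    then obtain N where N: "\<And>k l. k \<ge> N \<Longrightarrow> l \<ge> N \<Longrightarrow> ?I (\<lambda>x. A k x - A l x) \<le> ennreal (\<beta>\<^sup>2 * (e / 8))" by blast
    have "?I (\<lambda>x. V (r k) x - V (r l) x) \<le> ennreal e" if kl: "k \<ge> N" "l \<ge> N" for k l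
    proof -
      have eq: "\<beta> *\<^sub>R (V (r k) x - V (r l) x) = (D k x - D l x) + (A k x - A l x)" for x
        by (simp add: D_def scaleR_diff_right)
      have "ennreal (\<beta>\<^sup>2) * ?I (\<lambda>x. V (r k) x - V (r l) x) = (\<integral>\<^sup>+x. ennreal (\<beta>\<^sup>2) * ennreal ((norm (V (r k) x - V (r l) x))\<^sup>2) \<partial>M)"
        by (rule nn_integral_cmult[symmetric]) measurable
      also have "\<dots> = ?I (\<lambda>x. \<beta> *\<^sub>R (V (r k) x - V (r l) x))" using \<beta> by (simp add: ennreal_mult power_mult_distrib)
      also have "\<dots> = ?I (\<lambda>x. (D k x - D l x) + (A k x - A l x))" by (simp only: eq)
      also have "\<dots> \<le> ennreal (2 ^ 2) * (?I (\<lambda>x. D k x - D l x) + ?I (\<lambda>x. A k x - A l x))"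
        by (rule nn_integral_norm_power_add) measurable
      also have "\<dots> \<le> ennreal (2 ^ 2) * (ennreal (2 ^ 2) * (ennreal (\<beta>\<^sup>2 * (4 * \<epsilon>\<^sup>2 * B)) + ennreal (\<beta>\<^sup>2 * (4 * \<epsilon>\<^sup>2 * B))) + ennreal (\<beta>\<^sup>2 * (e / 8)))"
      proof (intro mult_left_mono add_mono N kl)
        have "?I (\<lambda>x. D k x - D l x) \<le> ennreal (2 ^ 2) * (?I (D k) + ?I (\<lambda>x. - D l x))"
          using nn_integral_norm_power_add[of "D k" M "\<lambda>x. - D l x" 2] by simp
        also have "\<dots> \<le> ennreal (2 ^ 2) * (ennreal (\<beta>\<^sup>2 * (4 * \<epsilon>\<^sup>2 * B)) + ennreal (\<beta>\<^sup>2 * (4 * \<epsilon>\<^sup>2 * B)))"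
          using D by (intro mult_left_mono add_mono) auto
        finally show "?I (\<lambda>x. D k x - D l x) \<le> ennreal (2 ^ 2) * (ennreal (\<beta>\<^sup>2 * (4 * \<epsilon>\<^sup>2 * B)) + ennreal (\<beta>\<^sup>2 * (4 * \<epsilon>\<^sup>2 * B)))" .
      qed simp
      also have "\<dots> = ennreal (2\<^sup>2 * (2\<^sup>2 * (\<beta>\<^sup>2 * (4 * \<epsilon>\<^sup>2 * B) + \<beta>\<^sup>2 * (4 * \<epsilon>\<^sup>2 * B)) + \<beta>\<^sup>2 * (e / 8)))"
      proof -
        have "0 \<le> \<beta>\<^sup>2 * (4 * \<epsilon>\<^sup>2 * B)" "0 \<le> \<beta>\<^sup>2 * (e / 8)" using \<open>B \<ge> 0\<close> e by simp_all
        then show ?thesis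
          by (simp only: ennreal_mult_add zero_le_power2 mult_nonneg_nonneg add_nonneg_nonneg)
      qed
      also have "\<dots> = ennreal (\<beta>\<^sup>2 * (128 * B * \<epsilon>\<^sup>2 + e / 2))"
        by (rule arg_cong[where f=ennreal]) (simp add: algebra_simps)
      also have "\<dots> \<le> ennreal (\<beta>\<^sup>2 * e)" using j by (intro ennreal_leI mult_left_mono) (auto simp: \<epsilon>_def)
      also have "\<dots> = ennreal (\<beta>\<^sup>2) * ennreal e" using e by (simp add: ennreal_mult)
      finally have le: "ennreal (\<beta>\<^sup>2) * ?I (\<lambda>x. V (r k) x - V (r l) x) \<le> ennreal (\<beta>\<^sup>2) * ennreal e" .
      have inv: "ennreal (1 / \<beta>\<^sup>2) * (ennreal (\<beta>\<^sup>2) * X) = X" for X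
        using \<beta> by (simp add: mult.assoc[symmetric] ennreal_mult[symmetric])
      from mult_left_mono[OF le, of "ennreal (1 / \<beta>\<^sup>2)"] show ?thesis unfolding inv by simp
    qed
    then show "\<exists>N. \<forall>k\<ge>N. \<forall>l\<ge>N. ?I (\<lambda>x. V (r k) x - V (r l) x) \<le> ennreal e" by blast
  qed
qed

text \<open>Stands in for weak compactness. \<open>v\<close> and \<open>V (r k)\<close> lie in
  convex sets on which the energy is at least \<open>d k\<close>, and \<open>d k\<close> tends to a
  value not below the energy of \<open>v\<close>. Moving from \<open>v\<close> towards
  \<open>V (r k)\<close> therefore lowers the energy by at most a vanishing amount, and the term of
  first order in t gives the one-sided bound.\<close>

theorem D12_compact:
  fixes V :: "nat \<Rightarrow> real^3 \<Rightarrow> complex"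
  assumes V: "\<And>k. has_D12_gradient (V k) (W k)" and B: "\<And>k. Np 2 (W k) \<le> ennreal B" "B \<ge> 0"
  obtains r :: "nat \<Rightarrow> nat" and v G where "strict_mono r" "has_D12_gradient v G"
    "AE x in lborel. (\<lambda>k. V (r k) x) \<longlonglongrightarrow> v x"
    "\<And>e. e > 0 \<Longrightarrow> \<forall>\<^sub>F k in sequentially. ip G G - e \<le> ip G (W (r k))"
proof -
  obtain M :: "(real^3) measure" where M: "sets M = sets borel"
    "\<And>f. f \<in> borel_measurable borel \<Longrightarrow> (\<integral>\<^sup>+x. f x \<partial>M) \<le> (\<integral>\<^sup>+x. f x \<partial>lborel)"
    "emeasure M UNIV < \<infinity>" "\<And>P. (AE x in M. P x) \<longleftrightarrow> (AE x in lborel. P x)"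
    by (rule finite_measure_equivalent_lborel) blast
  have [measurable_cong]: "sets M = sets borel" by (rule M)
  note [measurable] = D12_measurable[OF V]
  let ?I = "\<lambda>u. \<integral>\<^sup>+x. ennreal ((norm (u x :: complex))\<^sup>2) \<partial>M"
  obtain r1 :: "nat \<Rightarrow> nat" where r1: "strict_mono r1"
    "\<And>e. e > 0 \<Longrightarrow> \<exists>N. \<forall>k\<ge>N. \<forall>l\<ge>N. ?I (\<lambda>x. V (r1 k) x - V (r1 l) x) \<le> ennreal e"
  proof (rule Rellich_Cauchy[where V=V and W=W, OF V B M(1-3)])
    fix r :: "nat \<Rightarrow> nat" assume a: "strict_mono r" and b: "\<And>e. e > 0 \<Longrightarrow> \<exists>N. \<forall>k\<ge>N. \<forall>l\<ge>N. ?I (\<lambda>x. V (r k) x - V (r l) x) \<le> ennreal e"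
    show thesis by (rule that[OF a b])
  qed
  obtain r2 v0 where r2: "strict_mono r2" and v0: "v0 \<in> borel_measurable M"
    and AE0: "AE x in M. (\<lambda>k. V (r1 (r2 k)) x) \<longlonglongrightarrow> v0 x"
    and L0: "(\<lambda>k. ?I (\<lambda>x. V (r1 k) x - v0 x)) \<longlonglongrightarrow> 0"
    by (rule Lp_complete[of "\<lambda>k. V (r1 k)" M 2, OF _ _ r1(2)]) auto
  have [measurable]: "v0 \<in> borel_measurable borel" using v0 by simp
  have "\<forall>k. \<exists>N. \<forall>j\<ge>N. ?I (\<lambda>x. V (r1 j) x - v0 x) \<le> ennreal (1 / Suc k)"
    by (intro allI ennreal_tendsto_zeroD[OF L0]) simp
  from choice[OF this] obtain N where N: "\<And>k j. j \<ge> N k \<Longrightarrow> ?I (\<lambda>x. V (r1 j) x - v0 x) \<le> ennreal (1 / Suc k)"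
    by blast
  \<comment> \<open>\<open>r2\<close> secures convergence almost everywhere; the further subsequence
    \<open>n\<close> secures the rate 1/(k+1) in L^2 of \<open>M\<close>, which places the k-th
    function in the k-th constraint set below.\<close>
  define n where "n k = (\<Sum>i\<le>k. Suc (N i))" for k
  have n: "strict_mono n" by (simp add: strict_mono_Suc_iff n_def)
  have nN: "n k \<ge> N k" for k
    unfolding n_def using member_le_sum[of k "{..k}" "\<lambda>i. Suc (N i)"] by simp
  define r where "r k = r1 (r2 (n k))" for k
  have r: "strict_mono r" using r1(1) r2 n by (simp add: r_def strict_mono_def)
  have AEr: "AE x in lborel. (\<lambda>k. V (r k) x) \<longlonglongrightarrow> v0 x"
    using AE0 unfolding M(4)
  proof (rule AE_mp, intro AE_I2 impI)
    fix x assume "(\<lambda>k. V (r1 (r2 k)) x) \<longlonglongrightarrow> v0 x"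
    from LIMSEQ_subseq_LIMSEQ[OF this n] show "(\<lambda>k. V (r k) x) \<longlonglongrightarrow> v0 x" by (simp add: r_def o_def)
  qed
  have Vr: "?I (\<lambda>x. V (r k) x - v0 x) \<le> ennreal (1 / Suc k)" for k
    unfolding r_def by (rule N) (rule order_trans[OF nN strict_mono_imp_increasing[OF r2]])
  define C where "C k = {(w, U). has_D12_gradient w U \<and> ?I (\<lambda>x. w x - v0 x) \<le> ennreal (1 / Suc k)}" for k
  have VC: "(V (r k), W (r k)) \<in> C k" for k using V Vr by (simp add: C_def)
  have conv: "(\<lambda>x. (1 - t) *\<^sub>R w x + t *\<^sub>R w' x, \<lambda>x. (1 - t) *\<^sub>R U x + t *\<^sub>R U' x) \<in> C k"
    if "(w, U) \<in> C k" "(w', U') \<in> C k" "0 \<le> t" "t \<le> 1" for k w U w' U' and t :: real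
  proof -
    have D: "has_D12_gradient w U" "has_D12_gradient w' U'" using that by (auto simp: C_def)
    note [measurable] = D12_measurable[OF D(1)] D12_measurable[OF D(2)]
    have "?I (\<lambda>x. ((1 - t) *\<^sub>R w x + t *\<^sub>R w' x) - v0 x) \<le> ennreal (1 / Suc k)"
      using that by (intro nn_integral_convex_comb_le) (auto simp: C_def)
    then show ?thesis using D12_lincomb[OF D, of "1 - t" t] by (simp add: C_def)
  qed
  have ipB: "ip (W k) (W k) \<le> B" for k
    using B(1)[of k] B(2) unfolding Np2_eq_ip[OF D12_L2[OF V]] by (subst (asm) ennreal_le_iff) auto
  obtain v G w U d \<delta> where vG: "has_D12_gradient v G" and wU: "\<And>k. (w k, U k) \<in> C k"
    and w6: "(\<lambda>k. Np 6 (\<lambda>x. w k x - v x)) \<longlonglongrightarrow> 0"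
    and d: "\<And>k w U. (w, U) \<in> C k \<Longrightarrow> d k \<le> ip U U" "d \<longlonglongrightarrow> \<delta>" "\<And>k. d k \<le> \<delta>" and G\<delta>: "ip G G \<le> \<delta>"
  proof (rule D12_near_minimisers[of C B])
    show "has_D12_gradient w U" if "(w, U) \<in> C k" for k w U using that by (simp add: C_def)
    show "(\<lambda>x. (1/2) *\<^sub>R w x + (1/2) *\<^sub>R w' x, \<lambda>x. (1/2) *\<^sub>R U x + (1/2) *\<^sub>R U' x) \<in> C k"
      if "(w, U) \<in> C k" "(w', U') \<in> C k" for k w U w' U'
      using conv[OF that, of "1/2"] by simp
    show "C l \<subseteq> C k" if "k \<le> l" for k l
    proof -
      have "ennreal (1 / Suc l) \<le> ennreal (1 / Suc k)" using that by (intro ennreal_leI divide_left_mono) auto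
      then show ?thesis by (auto simp: C_def intro: order_trans)
    qed
    show "\<exists>w U. (w, U) \<in> C k \<and> ip U U \<le> B" for k using VC[of k] ipB by blast
  qed blast
  have wD: "has_D12_gradient (w k) (U k)" "?I (\<lambda>x. w k x - v0 x) \<le> ennreal (1 / Suc k)" for k
    using wU[of k] by (auto simp: C_def)
  note [measurable] = D12_measurable[OF vG] D12_measurable[OF wD(1)]
  \<comment> \<open>\<open>v\<close> is the L^6 limit of the near-minimisers and \<open>v0\<close>
    their limit in L^2 of \<open>M\<close>; along a common subsequence both are limits almost
    everywhere.\<close>
  have vv0: "AE x in lborel. v x = v0 x"
  proof -
    obtain r3 where r3: "strict_mono r3" "AE x in lborel. (\<lambda>k. w (r3 k) x) \<longlonglongrightarrow> v x"
      by (rule Lp_tendsto_AE_subseq[of w lborel v 6, OF _ _ w6]) auto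
    have e: "(\<lambda>k. ennreal (1 / Suc k)) \<longlonglongrightarrow> 0"
      using tendsto_ennrealI[OF LIMSEQ_Suc[OF lim_1_over_n]] by simp
    have "(\<lambda>k. ?I (\<lambda>x. w (r3 k) x - v0 x)) \<longlonglongrightarrow> 0"
    proof (rule tendsto_sandwich[OF always_eventually always_eventually tendsto_const e]; intro allI zero_le)
      fix k
      have "ennreal (1 / Suc (r3 k)) \<le> ennreal (1 / Suc k)"
        using strict_mono_imp_increasing[OF r3(1), of k] by (intro ennreal_leI divide_left_mono) auto
      with wD(2)[of "r3 k"] show "?I (\<lambda>x. w (r3 k) x - v0 x) \<le> ennreal (1 / Suc k)" by (rule order_trans)
    qed
    then obtain r4 where r4: "strict_mono r4" "AE x in M. (\<lambda>k. w (r3 (r4 k)) x) \<longlonglongrightarrow> v0 x"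
      by (rule Lp_tendsto_AE_subseq[of "\<lambda>k. w (r3 k)" M v0 2, rotated 2]) auto
    from r3(2) r4(2)[unfolded M(4)] show ?thesis
    proof eventually_elim
      case (elim x)
      from LIMSEQ_subseq_LIMSEQ[OF elim(1) r4(1)] elim(2) show ?case
        by (simp add: o_def LIMSEQ_unique)
    qed
  qed
  have AEv: "AE x in lborel. (\<lambda>k. V (r k) x) \<longlonglongrightarrow> v x"
    using AEr vv0 by eventually_elim simp
  have vC: "(v, G) \<in> C k" for k
  proof -
    have "?I (\<lambda>x. v x - v0 x) = (\<integral>\<^sup>+x. 0 \<partial>M)"
      using vv0 unfolding M(4)[symmetric] by (intro nn_integral_cong_AE) (auto elim!: AE_mp)
    then show ?thesis using vG by (simp add: C_def)
  qed
  have "\<forall>\<^sub>F k in sequentially. ip G G - e \<le> ip G (W (r k))" if e: "e > 0" for e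
  proof -
    \<comment> \<open>\<open>t * B \<le> e / 2\<close> absorbs the quadratic term, and
      \<open>t \<le> 1/2\<close> gives \<open>1 \<le> 2 * (1 - t)\<close>, so that the factor in
      front of the first-order term can be cancelled.\<close>
    define t where "t = min (1/2) (e / (2 * (B + 1)))"
    have t: "t > 0" "t \<le> 1/2" using e B(2) by (simp add: t_def, simp only: t_def min.cobounded1)
    have tB: "t * B \<le> e / 2"
    proof -
      have "t * B \<le> e / (2 * (B + 1)) * (B + 1)" using t B(2) by (intro mult_mono) (auto simp: t_def)
      also have "\<dots> = e / 2" using B(2) by (simp add: field_simps)
      finally show ?thesis .
    qed
    have "\<forall>\<^sub>F k in sequentially. \<delta> - t * e / 2 < d k"
      using d(2) t e by (intro order_tendstoD) auto
    then show ?thesis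
    proof eventually_elim
      case (elim k)
      let ?g = "ip G G" and ?x = "ip G (W (r k))" and ?y = "ip (W (r k)) (W (r k))"
      have "d k \<le> (1 - t)\<^sup>2 * ?g + 2 * (1 - t) * t * ?x + t\<^sup>2 * ?y"
        using d(1)[OF conv[OF vC VC, of t k]] t
        unfolding ip_quadratic[OF D12_L2[OF vG] D12_L2[OF V]] by simp
      moreover have "t\<^sup>2 * ?y \<le> t\<^sup>2 * B" using ipB by (intro mult_left_mono) auto
      moreover have "t\<^sup>2 * B \<le> t * (e / 2)" using mult_left_mono[OF tB, of t] t by (simp add: power2_eq_square mult.assoc)
      moreover have "0 \<le> t\<^sup>2 * ?g" by (intro mult_nonneg_nonneg ip_nonneg) simp
      moreover have "(1 - t)\<^sup>2 * ?g = ?g - 2 * t * ?g + t\<^sup>2 * ?g" by (simp add: power2_eq_square algebra_simps)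
      moreover have "(2 * (1 - t) * t) * (?g - ?x) = 2 * t * ?g - 2 * (t\<^sup>2 * ?g) - 2 * (1 - t) * t * ?x" by (simp add: power2_eq_square algebra_simps)
      ultimately have "(2 * (1 - t) * t) * (?g - ?x) \<le> t * e" using elim G\<delta> by argo
      also have "t * e \<le> (2 * (1 - t) * t) * e" using t e by (intro mult_right_mono) auto
      finally have "?g - ?x \<le> e" using t by (simp only: mult_le_cancel_left_pos mult_pos_pos)
      then show ?case by simp
    qed
  qed
  with r vG AEv show ?thesis by (rule that)
qed

section \<open>The nonlinearity\<close>

text \<open>Comparing b with \<tau> a gives Young's inequality for the exponents 6/5 and 6 with a
  free weight; it stands in for Holder's inequality in the estimates of the nonlinear terms.\<close>

lemma Young_power:
  fixes a b \<tau> :: real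
  assumes "a \<ge> 0" "b \<ge> 0" "\<tau> > 0"
  shows "a ^ 5 * b \<le> \<tau> * a ^ 6 + (1 / \<tau>) ^ 5 * b ^ 6"
proof (cases "b \<le> \<tau> * a")
  case True
  then have "a ^ 5 * b \<le> a ^ 5 * (\<tau> * a)" using assms by (intro mult_left_mono) auto
  also have "\<dots> = \<tau> * a ^ 6" by (simp add: eval_nat_numeral)
  finally show ?thesis using assms by (intro add_increasing2) auto
next
  case False
  then have "a \<le> 1 / \<tau> * b" using assms by (simp add: field_simps)
  then have "a ^ 5 \<le> (1 / \<tau> * b) ^ 5" using assms by (intro power_mono) auto
  then have "a ^ 5 * b \<le> (1 / \<tau> * b) ^ 5 * b" using assms by (intro mult_right_mono) auto
  also have "\<dots> = (1 / \<tau>) ^ 5 * b ^ 6" by (simp add: eval_nat_numeral)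
  finally show ?thesis using assms by (intro add_increasing) auto
qed

locale nonlinearity =
  fixes p q c :: real and f :: "complex \<Rightarrow> real" and f' :: "complex \<Rightarrow> complex"
  assumes p: "1 < p" "p < 6" and q: "6 < q" and c: "c > 0"
    and GD: "\<And>\<xi>. GDERIV f \<xi> :> f' \<xi>" and cont_f': "continuous_on UNIV f'"
    and f0: "f 0 = 0"
    and growth: "\<And>\<xi>. norm (f' \<xi>) \<le> c * min (norm \<xi> powr (p - 1)) (norm \<xi> powr (q - 1))"
    and rot: "\<And>(\<rho>::real) (\<alpha>::real). \<rho> \<ge> 0 \<Longrightarrow> f (exp (\<i> * of_real \<alpha>) * of_real \<rho>) = f (of_real \<rho>)"
begin

lemma has_derivative_f: "(f has_derivative (\<lambda>h. h \<bullet> f' \<xi>)) (at \<xi> within S)"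
  using GD[of \<xi>] unfolding gderiv_def by (rule has_derivative_at_withinI)

lemma cont_f: "continuous_on UNIV f"
  using has_derivative_f by (meson has_derivative_continuous_on)

lemma measurable_f[measurable]: "f \<in> borel_measurable borel" "f' \<in> borel_measurable borel"
  using cont_f cont_f' by (auto intro: borel_measurable_continuous_onI)

lemma f_mvt:
  obtains t where "0 < t" "t < 1" "f \<xi> - f \<eta> = (\<xi> - \<eta>) \<bullet> f' (\<eta> + t *\<^sub>R (\<xi> - \<eta>))"
proof -
  have d: "((\<lambda>t. f (\<eta> + t *\<^sub>R (\<xi> - \<eta>))) has_derivative (\<lambda>h. (h *\<^sub>R (\<xi> - \<eta>)) \<bullet> f' (\<eta> + t *\<^sub>R (\<xi> - \<eta>)))) (at t within S)" for t S
    by (rule has_derivative_compose[OF _ has_derivative_f]) (auto intro!: derivative_eq_intros)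
  have "\<exists>t\<in>{0<..<1}. f (\<eta> + 1 *\<^sub>R (\<xi> - \<eta>)) - f (\<eta> + 0 *\<^sub>R (\<xi> - \<eta>)) = ((1 - 0) *\<^sub>R (\<xi> - \<eta>)) \<bullet> f' (\<eta> + t *\<^sub>R (\<xi> - \<eta>))"
    by (rule mvt_simple[where f="\<lambda>t. f (\<eta> + t *\<^sub>R (\<xi> - \<eta>))"]) (use d in auto)
  then show ?thesis using that by auto
qed

text \<open>The exponent q - 1 > 5 governs moduli up to 1, and p - 1 < 5 the larger ones; this is
  what ties the nonlinearity to the Sobolev exponent 6.\<close>

lemma powr_min_le_power5: "a \<ge> 0 \<Longrightarrow> min (a powr (p - 1)) (a powr (q - 1)) \<le> a ^ 5"
proof -
  assume a: "a \<ge> 0"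
  consider "a = 0" | "0 < a" "a \<le> 1" | "a > 1" using a by linarith
  then show ?thesis
  proof cases
    case 2
    have "a powr (q - 1) \<le> a powr 5" using 2 q by (intro powr_mono') auto
    also have "a powr 5 = a ^ 5" using 2 by simp
    finally show ?thesis by simp
  next
    case 3
    have "a powr (p - 1) \<le> a powr 5" using 3 p by (intro powr_mono) auto
    also have "a powr 5 = a ^ 5" using 3 by simp
    finally show ?thesis by simp
  qed simp
qed

lemma f'_bound: "norm (f' \<xi>) \<le> c * norm \<xi> ^ 5"
  using growth[of \<xi>] powr_min_le_power5[of "norm \<xi>"] c by (meson mult_left_mono norm_ge_zero order_trans less_imp_le)

lemma f_Lipschitz: "\<bar>f \<xi> - f \<eta>\<bar> \<le> c * (norm \<xi> + norm \<eta>) ^ 5 * norm (\<xi> - \<eta>)"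
proof -
  obtain t where t: "0 < t" "t < 1" "f \<xi> - f \<eta> = (\<xi> - \<eta>) \<bullet> f' (\<eta> + t *\<^sub>R (\<xi> - \<eta>))" by (rule f_mvt)
  have "\<eta> + t *\<^sub>R (\<xi> - \<eta>) = (1 - t) *\<^sub>R \<eta> + t *\<^sub>R \<xi>" by (simp add: algebra_simps)
  then have "norm (\<eta> + t *\<^sub>R (\<xi> - \<eta>)) \<le> (1 - t) * norm \<eta> + t * norm \<xi>"
    using t(1,2) norm_triangle_ineq[of "(1 - t) *\<^sub>R \<eta>" "t *\<^sub>R \<xi>"] by simp
  also have "\<dots> \<le> 1 * norm \<eta> + 1 * norm \<xi>" using t by (intro add_mono mult_right_mono) auto
  finally have n: "norm (\<eta> + t *\<^sub>R (\<xi> - \<eta>)) \<le> norm \<xi> + norm \<eta>" by simp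
  have "\<bar>f \<xi> - f \<eta>\<bar> \<le> norm (\<xi> - \<eta>) * norm (f' (\<eta> + t *\<^sub>R (\<xi> - \<eta>)))" unfolding t(3) by (rule Cauchy_Schwarz_ineq2)
  also have "\<dots> \<le> norm (\<xi> - \<eta>) * (c * (norm \<xi> + norm \<eta>) ^ 5)"
    using c n by (intro mult_left_mono order_trans[OF f'_bound] power_mono) auto
  finally show ?thesis by (simp add: mult_ac)
qed

lemma f_bound: "\<bar>f \<xi>\<bar> \<le> c * norm \<xi> ^ 6"
  using f_Lipschitz[of \<xi> 0] f0 by (simp add: eval_nat_numeral mult_ac)

lemma f_bound_min: "\<bar>f \<xi>\<bar> \<le> c * norm \<xi> * min (norm \<xi> powr (p - 1)) (norm \<xi> powr (q - 1))"
proof -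
  obtain t where t: "0 < t" "t < 1" "f \<xi> - f 0 = (\<xi> - 0) \<bullet> f' (0 + t *\<^sub>R (\<xi> - 0))" by (rule f_mvt)
  have n: "norm (t *\<^sub>R \<xi>) \<le> norm \<xi>" using t mult_right_mono[of t 1 "norm \<xi>"] by simp
  have "\<bar>f \<xi>\<bar> \<le> norm \<xi> * norm (f' (t *\<^sub>R \<xi>))" using t(3) f0 Cauchy_Schwarz_ineq2[of \<xi> "f' (t *\<^sub>R \<xi>)"] by simp
  also have "\<dots> \<le> norm \<xi> * (c * min (norm (t *\<^sub>R \<xi>) powr (p - 1)) (norm (t *\<^sub>R \<xi>) powr (q - 1)))"
    by (intro mult_left_mono growth) auto
  also have "\<dots> \<le> norm \<xi> * (c * min (norm \<xi> powr (p - 1)) (norm \<xi> powr (q - 1)))"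
    using n p q c by (intro mult_left_mono min.mono powr_mono2) auto
  finally show ?thesis by (simp add: mult_ac)
qed

text \<open>The source of compactness: |f xi| is at most c |xi|^6 times the smaller of |xi|^(p - 6)
  and |xi|^(q - 6), of which the first tends to 0 at infinity and the second at 0.\<close>

lemma f_small_off_compact:
  assumes "\<eta> > 0"
  obtains \<epsilon> K where "\<epsilon> > 0" "K > 0" "\<And>\<xi>. norm \<xi> \<le> \<epsilon> \<or> norm \<xi> \<ge> K \<Longrightarrow> \<bar>f \<xi>\<bar> \<le> \<eta> * norm \<xi> ^ 6"
proof -
  \<comment> \<open>The two thresholds are the moduli at which c |xi|^(q - 6) and c |xi|^(p - 6)
    equal \<eta>.\<close>
  define \<epsilon> where "\<epsilon> = (\<eta> / c) powr (1 / (q - 6))"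
  define K where "K = (\<eta> / c) powr (1 / (p - 6))"
  have pos: "\<epsilon> > 0" "K > 0" "\<eta> / c > 0" using assms c by (auto simp: \<epsilon>_def K_def)
  have \<epsilon>q: "\<epsilon> powr (q - 6) = \<eta> / c" and Kp: "K powr (p - 6) = \<eta> / c"
    using pos q p assms c by (simp_all add: \<epsilon>_def K_def powr_powr abs_of_pos)
  have "\<bar>f \<xi>\<bar> \<le> \<eta> * norm \<xi> ^ 6" if "norm \<xi> \<le> \<epsilon> \<or> norm \<xi> \<ge> K" for \<xi>
  proof (cases "\<xi> = 0")
    case False
    let ?a = "norm \<xi>"
    have a: "?a > 0" using False by simp
    have e: "?a * ?a powr (s - 1) = ?a powr (s - 6) * ?a ^ 6" for s
    proof -
      have "?a powr 1 * ?a powr (s - 1) = ?a powr (s - 6) * ?a powr 6" unfolding powr_add[symmetric] by simp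
      moreover have "?a powr 6 = ?a ^ 6" "?a powr 1 = ?a" using a by simp_all
      ultimately show ?thesis by (simp only:)
    qed
    have "min (?a powr (p - 6)) (?a powr (q - 6)) \<le> \<eta> / c"
      using that
    proof
      assume "?a \<le> \<epsilon>"
      then have "?a powr (q - 6) \<le> \<epsilon> powr (q - 6)" using a q by (intro powr_mono2) auto
      then show ?thesis by (simp add: \<epsilon>q)
    next
      assume "?a \<ge> K"
      then have "?a powr (p - 6) \<le> K powr (p - 6)" using pos p by (intro powr_mono2') auto
      then show ?thesis by (simp add: Kp)
    qed
    then have "c * min (?a powr (p - 6)) (?a powr (q - 6)) * ?a ^ 6 \<le> c * (\<eta> / c) * ?a ^ 6"
      using c by (intro mult_right_mono mult_left_mono) auto
    moreover have "?a * min (?a powr (p - 1)) (?a powr (q - 1)) = min (?a powr (p - 6)) (?a powr (q - 6)) * ?a ^ 6"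
      using a by (simp add: min_mult_distrib_left min_mult_distrib_right e)
    ultimately show ?thesis using f_bound_min[of \<xi>] c by (simp add: mult.assoc)
  qed (simp add: f0)
  then show ?thesis using that pos by blast
qed

lemma f_norm: "f \<xi> = f (of_real (norm \<xi>))"
proof -
  have "\<xi> = exp (\<i> * of_real (Arg \<xi>)) * of_real (norm \<xi>)"
    using Arg_eq[of \<xi>] by (cases "\<xi> = 0") (auto simp: mult.commute)
  then show ?thesis using rot[of "norm \<xi>" "Arg \<xi>"] by simp
qed

lemma f_isometry: "orthogonal_transformation L \<Longrightarrow> f (L \<xi>) = f \<xi>"
  using f_norm[of "L \<xi>"] f_norm[of \<xi>] by (simp add: orthogonal_transformation_norm)

text \<open>Differentiate \<open>f (L \<xi>) = f \<xi>\<close>: the derivative pairs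
  \<open>L h\<close> with \<open>f' (L \<xi>)\<close>, and \<open>L\<close> is onto and preserves
  inner products, so that gradient must be \<open>L (f' \<xi>)\<close>.\<close>

lemma f'_isometry:
  assumes L: "orthogonal_transformation L"
  shows "f' (L \<xi>) = L (f' \<xi>)"
proof -
  have "(L has_derivative L) (at \<xi>)" using L by (intro linear_imp_has_derivative orthogonal_transformation_linear)
  from has_derivative_compose[OF this has_derivative_f]
  have "((\<lambda>x. f (L x)) has_derivative (\<lambda>h. L h \<bullet> f' (L \<xi>))) (at \<xi>)" .
  then have "(f has_derivative (\<lambda>h. L h \<bullet> f' (L \<xi>))) (at \<xi>)" by (simp add: f_isometry[OF L])
  then have eq: "(\<lambda>h. L h \<bullet> f' (L \<xi>)) = (\<lambda>h. h \<bullet> f' \<xi>)" using has_derivative_unique has_derivative_f by blast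
  have "L h \<bullet> (f' (L \<xi>) - L (f' \<xi>)) = 0" for h
    using fun_cong[OF eq, of h] L by (simp add: inner_diff_right orthogonal_transformation_def)
  moreover obtain h where "L h = f' (L \<xi>) - L (f' \<xi>)"
    using orthogonal_transformation_surj[OF L] by (metis surjD)
  ultimately have "(f' (L \<xi>) - L (f' \<xi>)) \<bullet> (f' (L \<xi>) - L (f' \<xi>)) = 0" by metis
  then show ?thesis by simp
qed

text \<open>The bound is lopsided because \<open>a\<close> will be the remainder, bounded but not
  small in L^6, and \<open>b\<close> the fixed limit, whose sixth power can serve as a dominating
  function.\<close>

lemma f_Brezis_Lieb:
  assumes "\<eta> > 0"
  obtains C where "C > 0" "\<And>a b. \<bar>f (a + b) - f a - f b\<bar> \<le> \<eta> * norm a ^ 6 + C * norm b ^ 6"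
proof -
  \<comment> \<open>1024 is 2^5 * 2^5, one factor from \<open>power_add_le\<close> and one from the
    doubled \<open>norm a\<close>. In \<open>C\<close>, the 33 adds the bound for \<open>f b\<close>
    to the 32 left over from \<open>power_add_le\<close>.\<close>
  define \<tau> where "\<tau> = \<eta> / (1024 * c)"
  have \<tau>: "\<tau> > 0" using assms c by (simp add: \<tau>_def)
  define C where "C = 1024 * c * (1 / \<tau>) ^ 5 + 33 * c"
  have "\<bar>f (a + b) - f a - f b\<bar> \<le> \<eta> * norm a ^ 6 + C * norm b ^ 6" for a b
  proof -
    let ?a = "norm a" and ?b = "norm b"
    have "\<bar>f (a + b) - f a\<bar> \<le> c * (norm (a + b) + ?a) ^ 5 * ?b" using f_Lipschitz[of "a + b" a] by simp
    also have "\<dots> \<le> c * (2 * ?a + ?b) ^ 5 * ?b"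
      using c norm_triangle_ineq[of a b] by (intro mult_right_mono mult_left_mono power_mono) auto
    also have "\<dots> \<le> c * (2 ^ 5 * ((2 * ?a) ^ 5 + ?b ^ 5)) * ?b"
      using c by (intro mult_right_mono mult_left_mono power_add_le) auto
    also have "\<dots> = 1024 * c * (?a ^ 5 * ?b) + 32 * c * ?b ^ 6" by (simp add: eval_nat_numeral algebra_simps)
    also have "\<dots> \<le> 1024 * c * (\<tau> * ?a ^ 6 + (1 / \<tau>) ^ 5 * ?b ^ 6) + 32 * c * ?b ^ 6"
      using c \<tau> by (intro add_right_mono mult_left_mono Young_power) auto
    also have "\<dots> = \<eta> * ?a ^ 6 + (C - c) * ?b ^ 6" using c by (simp add: \<tau>_def C_def algebra_simps)
    finally show ?thesis using f_bound[of b] by (simp add: algebra_simps)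
  qed
  moreover have "C > 0" using c \<tau> by (auto simp: C_def intro!: add_nonneg_pos)
  ultimately show ?thesis using that by blast
qed

section \<open>The functional \<open>F\<close>: integrability, splitting and directional
  derivatives\<close>

abbreviation F :: "(real^3 \<Rightarrow> complex) \<Rightarrow> real" where
  "F v \<equiv> (\<integral>x. f (v x) \<partial>lborel)"

lemma integrable_norm6:
  fixes v :: "real^3 \<Rightarrow> complex"
  assumes [measurable]: "v \<in> borel_measurable borel" and "Np 6 v < \<infinity>"
  shows "integrable lborel (\<lambda>x. norm (v x) ^ 6)"
  using assms(2) by (intro integrableI_bounded) auto

lemma integrable_f:
  assumes [measurable]: "v \<in> borel_measurable borel" and "Np 6 v < \<infinity>"
  shows "integrable lborel (\<lambda>x. f (v x))"
proof (rule Bochner_Integration.integrable_bound)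
  show "integrable lborel (\<lambda>x. c * norm (v x) ^ 6)" using integrable_norm6[OF assms] by simp
  show "AE x in lborel. norm (f (v x)) \<le> norm (c * norm (v x) ^ 6)" using f_bound c by (auto simp: abs_mult)
qed measurable

lemma integrable_f'_inner:
  assumes [measurable]: "v \<in> borel_measurable borel" "h \<in> borel_measurable borel"
    and "Np 6 v < \<infinity>" "Np 6 h < \<infinity>"
  shows "integrable lborel (\<lambda>x. f' (v x) \<bullet> h x)"
proof (rule Bochner_Integration.integrable_bound)
  show "integrable lborel (\<lambda>x. c * (norm (v x) ^ 6 + norm (h x) ^ 6))"
    using integrable_norm6[OF assms(1,3)] integrable_norm6[OF assms(2,4)] by simp
  have "norm (f' \<xi> \<bullet> \<zeta>) \<le> c * (norm \<xi> ^ 6 + norm \<zeta> ^ 6)" for \<xi> \<zeta>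
  proof -
    have "norm (f' \<xi> \<bullet> \<zeta>) \<le> norm (f' \<xi>) * norm \<zeta>" by (simp add: Cauchy_Schwarz_ineq2)
    also have "\<dots> \<le> c * norm \<xi> ^ 5 * norm \<zeta>" by (intro mult_right_mono f'_bound) simp
    also have "\<dots> \<le> c * (1 * norm \<xi> ^ 6 + (1 / 1) ^ 5 * norm \<zeta> ^ 6)"
      unfolding mult.assoc using c by (intro mult_left_mono Young_power) auto
    finally show ?thesis by simp
  qed
  then show "AE x in lborel. norm (f' (v x) \<bullet> h x) \<le> norm (c * (norm (v x) ^ 6 + norm (h x) ^ 6))"
    using c by (intro AE_I2) (simp add: abs_mult)
qed measurable

lemma F_le:
  assumes "v \<in> borel_measurable borel" and "Np 6 v \<le> ennreal S" "S \<ge> 0"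
  shows "F v \<le> c * S"
proof -
  have fin: "Np 6 v < \<infinity>" using assms(2) by (auto intro: le_less_trans)
  note i = integrable_norm6[OF assms(1) fin]
  have "F v \<le> (\<integral>x. c * norm (v x) ^ 6 \<partial>lborel)"
    using f_bound i by (intro integral_mono integrable_f assms fin) (auto intro: order_trans[OF abs_ge_self])
  also have "\<dots> = c * (\<integral>x. norm (v x) ^ 6 \<partial>lborel)" by simp
  also have "(\<integral>x. norm (v x) ^ 6 \<partial>lborel) \<le> S"
    using assms(2,3) nn_integral_eq_integral[OF i] by simp
  finally show ?thesis using c by simp
qed

text \<open>The splitting error \<open>R k\<close> exceeds \<eta> times the sixth power of the
  remainder only by something dominated by a multiple of |v|^6, which disappears by dominated
  convergence. The rest is at most \<eta> times 128 S, where 128 = 2^6 * 2 bounds the remainder by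
  the quasi-triangle inequality.\<close>

lemma F_Brezis_Lieb:
  fixes V :: "nat \<Rightarrow> real^3 \<Rightarrow> complex"
  assumes V[measurable]: "\<And>k. V k \<in> borel_measurable borel" "v \<in> borel_measurable borel"
    and S: "\<And>k. Np 6 (V k) \<le> ennreal S" "S \<ge> 0"
    and AE: "AE x in lborel. (\<lambda>k. V k x) \<longlonglongrightarrow> v x"
  shows "(\<lambda>k. F (V k) - F (\<lambda>x. V k x - v x)) \<longlonglongrightarrow> F v"
proof -
  have v6: "Np 6 v \<le> ennreal S" by (rule nn_integral_Fatou_le[OF _ AE]) (use S in auto)
  define w where "w k x = V k x - v x" for k x
  have w[measurable]: "w k \<in> borel_measurable borel" for k unfolding w_def by measurable
  have w6: "Np 6 (w k) \<le> ennreal (128 * S)" for k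
  proof -
    have "Np 6 (w k) \<le> ennreal (2 ^ 6) * (Np 6 (V k) + Np 6 (\<lambda>x. - v x))"
      unfolding w_def using nn_integral_norm_power_add[of "V k" lborel "\<lambda>x. - v x" 6] by simp
    also have "\<dots> \<le> ennreal (2 ^ 6) * (ennreal S + ennreal S)" using S v6 by (intro mult_left_mono add_mono) auto
    also have "\<dots> = ennreal (2 ^ 6 * (S + S))" using S(2) by (intro ennreal_mult_add) auto
    finally show ?thesis by simp
  qed
  have fin: "Np 6 (V k) < \<infinity>" "Np 6 v < \<infinity>" "Np 6 (w k) < \<infinity>" for k
    using S(1)[of k] v6 w6[of k] by (auto intro: le_less_trans)
  define R where "R k x = \<bar>f (V k x) - f (w k x) - f (v x)\<bar>" for k x
  have [measurable]: "R k \<in> borel_measurable borel" for k unfolding R_def by measurable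
  have iR: "integrable lborel (R k)" for k unfolding R_def
    by (intro integrable_abs Bochner_Integration.integrable_diff integrable_f fin w V)
  have i6: "integrable lborel (\<lambda>x. norm (w k x) ^ 6)" for k by (rule integrable_norm6[OF w fin(3)])
  have R0: "(\<lambda>k. \<integral>x. R k x \<partial>lborel) \<longlonglongrightarrow> 0"
  proof (rule LIMSEQ_I)
    fix e :: real assume e: "e > 0"
    define \<eta> where "\<eta> = e / (2 * (128 * S + 1))"
    have \<eta>: "\<eta> > 0" "\<eta> * (128 * S) \<le> e / 2"
    proof -
      show p: "\<eta> > 0" using e S(2) by (simp add: \<eta>_def)
      have "\<eta> * (128 * S) \<le> \<eta> * (128 * S + 1)" using p by (intro mult_left_mono) auto
      also have "\<dots> = e / 2" using S(2) by (simp add: \<eta>_def field_simps)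
      finally show "\<eta> * (128 * S) \<le> e / 2" .
    qed
    obtain C where C: "C > 0" "\<And>a b. \<bar>f (a + b) - f a - f b\<bar> \<le> \<eta> * norm a ^ 6 + C * norm b ^ 6"
      by (rule f_Brezis_Lieb[OF \<eta>(1)]) blast
    have RC: "R k x \<le> \<eta> * norm (w k x) ^ 6 + C * norm (v x) ^ 6" for k x
      using C(2)[of "w k x" "v x"] by (simp add: R_def w_def)
    \<comment> \<open>The excess of the splitting error over its uniformly small part; only this
      part needs convergence almost everywhere.\<close>
    define X where "X k x = max 0 (R k x - \<eta> * norm (w k x) ^ 6)" for k x
    have [measurable]: "X k \<in> borel_measurable borel" for k unfolding X_def by measurable
    have Xb: "norm (X k x) \<le> C * norm (v x) ^ 6" for k x using RC[of k x] C(1) by (simp add: X_def)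
    have iC: "integrable lborel (\<lambda>x. C * norm (v x) ^ 6)" using integrable_norm6[OF V(2) fin(2)] by simp
    have "(\<lambda>k. \<integral>x. X k x \<partial>lborel) \<longlonglongrightarrow> (\<integral>x. 0 \<partial>(lborel :: (real^3) measure))"
    proof (rule integral_dominated_convergence[OF _ _ iC])
      show "AE x in lborel. (\<lambda>k. X k x) \<longlonglongrightarrow> 0"
        using AE
      proof eventually_elim
        case (elim x)
        have wl: "(\<lambda>k. w k x) \<longlonglongrightarrow> v x - v x" unfolding w_def by (intro tendsto_intros elim)
        have fl: "(\<lambda>k. f (u k)) \<longlonglongrightarrow> f l" if "u \<longlonglongrightarrow> l" for u l
          using that cont_f by (intro isCont_tendsto_compose[of l f]) (auto simp: continuous_on_eq_continuous_at)
        have "(\<lambda>k. X k x) \<longlonglongrightarrow> max 0 (\<bar>f (v x) - f (v x - v x) - f (v x)\<bar> - \<eta> * norm (v x - v x) ^ 6)"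
          unfolding X_def R_def by (intro tendsto_intros fl elim wl)
        then show ?case by (simp add: f0)
      qed
      show "AE x in lborel. norm (X k x) \<le> C * norm (v x) ^ 6" for k using Xb by simp
    qed measurable
    then have "\<forall>\<^sub>F k in sequentially. (\<integral>x. X k x \<partial>lborel) < e / 2" using e by (intro order_tendstoD) auto
    then obtain N where N: "\<And>k. k \<ge> N \<Longrightarrow> (\<integral>x. X k x \<partial>lborel) < e / 2" by (auto simp: eventually_sequentially)
    have "norm ((\<integral>x. R k x \<partial>lborel) - 0) < e" if "k \<ge> N" for k
    proof -
      have iX: "integrable lborel (X k)"
        using Xb by (intro Bochner_Integration.integrable_bound[OF iC]) (auto intro: order_trans[OF _ abs_ge_self])
      have "(\<integral>x. R k x \<partial>lborel) \<le> (\<integral>x. X k x + \<eta> * norm (w k x) ^ 6 \<partial>lborel)"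
        using i6 iX iR by (intro integral_mono) (auto simp: X_def)
      also have "\<dots> = (\<integral>x. X k x \<partial>lborel) + \<eta> * (\<integral>x. norm (w k x) ^ 6 \<partial>lborel)"
        using i6 iX by simp
      also have "\<dots> \<le> (\<integral>x. X k x \<partial>lborel) + \<eta> * (128 * S)"
      proof -
        have "(\<integral>x. norm (w k x) ^ 6 \<partial>lborel) \<le> 128 * S"
          using w6[of k] S(2) nn_integral_eq_integral[OF i6, of k] by simp
        then show ?thesis using \<eta>(1) by (intro add_left_mono mult_left_mono) auto
      qed
      finally have "(\<integral>x. R k x \<partial>lborel) < e" using N[OF that] \<eta>(2) by simp
      moreover have "(\<integral>x. R k x \<partial>lborel) \<ge> 0" by (simp add: R_def)
      ultimately show ?thesis by simp
    qed
    then show "\<exists>N. \<forall>k\<ge>N. norm ((\<integral>x. R k x \<partial>lborel) - 0) < e" by blast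
  qed
  have Rb: "norm (F (V k) - F (w k) - F v) \<le> (\<integral>x. R k x \<partial>lborel)" for k
  proof -
    have "F (V k) - F (w k) - F v = (\<integral>x. f (V k x) - f (w k x) - f (v x) \<partial>lborel)"
      using integrable_f[OF V(1) fin(1)] integrable_f[OF w fin(3)] integrable_f[OF V(2) fin(2)] by simp
    then show ?thesis using integral_norm_bound[of lborel "\<lambda>x. f (V k x) - f (w k x) - f (v x)"] by (simp add: R_def)
  qed
  have "(\<lambda>k. F (V k) - F (w k) - F v) \<longlonglongrightarrow> 0"
    by (rule Lim_null_comparison[OF always_eventually[OF allI[OF Rb]] R0])
  then show ?thesis unfolding w_def by (rule LIM_zero_cancel)
qed

text \<open>Steps 1/(k+1) suffice, since the quotients will be compared with a bound along the same
  steps.\<close>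

lemma F_directional_derivative:
  fixes v h :: "real^3 \<Rightarrow> complex"
  assumes [measurable]: "v \<in> borel_measurable borel" "h \<in> borel_measurable borel"
    and fin: "Np 6 v < \<infinity>" "Np 6 h < \<infinity>"
  shows "(\<lambda>k. Suc k * (F (\<lambda>x. v x + (1 / Suc k) *\<^sub>R h x) - F v)) \<longlonglongrightarrow> (\<integral>x. f' (v x) \<bullet> h x \<partial>lborel)"
proof -
  \<comment> \<open>The Lipschitz estimate bounds every quotient by c (2 |v| + |h|)^6, independently
    of the step; \<open>power_add_le\<close> splits it into this sum.\<close>
  define B where "B x = c * (64 * (64 * norm (v x) ^ 6 + norm (h x) ^ 6))" for x
  have iB: "integrable lborel B"
    unfolding B_def using integrable_norm6[OF assms(1) fin(1)] integrable_norm6[OF assms(2) fin(2)] by simp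
  define Y where "Y k x = Suc k * (f (v x + (1 / Suc k) *\<^sub>R h x) - f (v x))" for k x
  have [measurable]: "Y k \<in> borel_measurable borel" for k unfolding Y_def by measurable
  have Yb: "norm (Y k x) \<le> B x" for k x
  proof -
    let ?t = "1 / real (Suc k)"
    have t: "0 < ?t" "?t \<le> 1" by auto
    have th: "norm (?t *\<^sub>R h x) \<le> norm (h x)" using mult_right_mono[OF t(2), of "norm (h x)"] by simp
    have "\<bar>f (v x + ?t *\<^sub>R h x) - f (v x)\<bar> \<le> c * (norm (v x + ?t *\<^sub>R h x) + norm (v x)) ^ 5 * norm (?t *\<^sub>R h x)"
      using f_Lipschitz[of "v x + ?t *\<^sub>R h x" "v x"] by simp
    also have "\<dots> \<le> c * (2 * norm (v x) + norm (h x)) ^ 5 * norm (?t *\<^sub>R h x)"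
      using c th norm_triangle_ineq[of "v x" "?t *\<^sub>R h x"] by (intro mult_right_mono mult_left_mono power_mono) auto
    finally have "Suc k * \<bar>f (v x + ?t *\<^sub>R h x) - f (v x)\<bar> \<le> Suc k * (c * (2 * norm (v x) + norm (h x)) ^ 5 * norm (?t *\<^sub>R h x))"
      by (rule mult_left_mono) simp
    also have "\<dots> = c * (2 * norm (v x) + norm (h x)) ^ 5 * norm (h x)" by simp
    also have "\<dots> \<le> c * (2 * norm (v x) + norm (h x)) ^ 5 * (2 * norm (v x) + norm (h x))"
      using c by (intro mult_left_mono) auto
    also have "\<dots> = c * (2 * norm (v x) + norm (h x)) ^ 6" by (simp add: eval_nat_numeral mult_ac)
    also have "\<dots> \<le> c * (2 ^ 6 * ((2 * norm (v x)) ^ 6 + norm (h x) ^ 6))"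
      using c by (intro mult_left_mono power_add_le) auto
    also have "\<dots> = B x" by (simp add: B_def power_mult_distrib)
    finally show ?thesis by (simp add: Y_def abs_mult)
  qed
  have "(\<lambda>k. \<integral>x. Y k x \<partial>lborel) \<longlonglongrightarrow> (\<integral>x. f' (v x) \<bullet> h x \<partial>lborel)"
  proof (rule integral_dominated_convergence[OF _ _ iB])
    show "AE x in lborel. (\<lambda>k. Y k x) \<longlonglongrightarrow> f' (v x) \<bullet> h x"
    proof (rule AE_I2)
      fix x
      have "((\<lambda>t. f (v x + t *\<^sub>R h x)) has_derivative (\<lambda>s. (s *\<^sub>R h x) \<bullet> f' (v x + 0 *\<^sub>R h x))) (at 0)"
        by (rule has_derivative_compose[OF _ has_derivative_f]) (auto intro!: derivative_eq_intros)
      then have "((\<lambda>t. f (v x + t *\<^sub>R h x)) has_real_derivative (f' (v x) \<bullet> h x)) (at 0)"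
        unfolding has_field_derivative_def by (rule has_derivative_eq_rhs) (auto simp: inner_commute)
      then have "((\<lambda>t. (f (v x + t *\<^sub>R h x) - f (v x)) / t) \<longlongrightarrow> f' (v x) \<bullet> h x) (at 0)"
        by (simp add: has_field_derivative_iff)
      moreover have "filterlim (\<lambda>k. 1 / real (Suc k)) (at 0) sequentially"
        by (rule filterlim_atI[OF LIMSEQ_Suc[OF lim_1_over_n]]) simp
      ultimately have "(\<lambda>k. (f (v x + (1 / Suc k) *\<^sub>R h x) - f (v x)) / (1 / Suc k)) \<longlonglongrightarrow> f' (v x) \<bullet> h x"
        by (rule filterlim_compose)
      then show "(\<lambda>k. Y k x) \<longlonglongrightarrow> f' (v x) \<bullet> h x" by (simp add: Y_def mult.commute)
    qed
    show "AE x in lborel. norm (Y k x) \<le> B x" for k using Yb by simp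
  qed measurable
  moreover have "(\<integral>x. Y k x \<partial>lborel) = Suc k * (F (\<lambda>x. v x + (1 / Suc k) *\<^sub>R h x) - F v)" for k
  proof -
    have "Np 6 (\<lambda>x. (1 / Suc k) *\<^sub>R h x) \<le> Np 6 h"
    proof (intro nn_integral_mono ennreal_leI power_mono)
      have "1 / real (Suc k) \<le> 1" by simp
      from mult_right_mono[OF this norm_ge_zero] show "norm ((1 / real (Suc k)) *\<^sub>R h x) \<le> norm (h x)" for x
        by simp
    qed simp
    then have "Np 6 (\<lambda>x. v x + (1 / Suc k) *\<^sub>R h x) \<le> ennreal (2 ^ 6) * (Np 6 v + Np 6 h)"
      by (intro order_trans[OF nn_integral_norm_power_add] mult_left_mono add_left_mono) auto
    also have "\<dots> < \<infinity>" using fin by (simp add: ennreal_mult_less_top)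
    finally have "integrable lborel (\<lambda>x. f (v x + (1 / Suc k) *\<^sub>R h x))" by (intro integrable_f) auto
    with integrable_f[OF assms(1) fin(1)] show ?thesis unfolding Y_def by simp
  qed
  ultimately show ?thesis by (simp only:)
qed

end

section \<open>Symmetries and critical points\<close>

type_synonym symmetries = "((complex \<Rightarrow> complex) \<times> (real^3 \<Rightarrow> real^3)) set"

definition isometries :: "symmetries \<Rightarrow> bool" where
  "isometries \<Gamma> \<longleftrightarrow> (\<forall>(L, A)\<in>\<Gamma>. orthogonal_transformation L \<and> orthogonal_transformation A)"

text \<open>Members of the space are classes modulo null sets, hence \<open>AE\<close>, with a null
  set that may depend on the pair. The set of pairs need not be a group: every argument treats one
  pair at a time.\<close>

definition invariant :: "symmetries \<Rightarrow> (real^3 \<Rightarrow> complex) \<Rightarrow> bool" where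
  "invariant \<Gamma> v \<longleftrightarrow> (\<forall>(L, A)\<in>\<Gamma>. AE x in lborel. L (v (A x)) = v x)"

lemma isometriesD:
  assumes "isometries \<Gamma>" "(L, A) \<in> \<Gamma>"
  shows "orthogonal_transformation L" "orthogonal_transformation A" "linear L" "linear A"
  using assms by (auto simp: isometries_def intro: orthogonal_transformation_linear)

lemma AE_orthogonal:
  fixes A :: "real^3 \<Rightarrow> real^3"
  shows "orthogonal_transformation A \<Longrightarrow> AE x in lborel. P x \<Longrightarrow> AE x in lborel. P (A x)"
  using AE_similarity[of A 1 P 0] by simp

lemma invariantD: "invariant \<Gamma> v \<Longrightarrow> (L, A) \<in> \<Gamma> \<Longrightarrow> AE x in lborel. L (v (A x)) = v x"
  by (auto simp: invariant_def)

lemma invariant_lincomb: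
  assumes \<Gamma>: "isometries \<Gamma>" and v: "invariant \<Gamma> v" and w: "invariant \<Gamma> w"
  shows "invariant \<Gamma> (\<lambda>x. a *\<^sub>R v x + b *\<^sub>R w x)"
  unfolding invariant_def
proof (clarify)
  fix L A assume g: "(L, A) \<in> \<Gamma>"
  note l = isometriesD(3)[OF \<Gamma> g]
  from invariantD[OF v g] invariantD[OF w g]
  show "AE x in lborel. L (a *\<^sub>R v (A x) + b *\<^sub>R w (A x)) = a *\<^sub>R v x + b *\<^sub>R w x"
    by eventually_elim (simp add: linear_add[OF l] linear_cmul[OF l])
qed

lemma invariant_similarity:
  assumes \<Gamma>: "isometries \<Gamma>" and v: "invariant \<Gamma> v" and "\<sigma> > 0" and a: "\<And>L A. (L, A) \<in> \<Gamma> \<Longrightarrow> A a = a"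
  shows "invariant \<Gamma> (\<lambda>x. v (\<sigma> *\<^sub>R x + a))"
  unfolding invariant_def
proof (clarify)
  fix L A assume g: "(L, A) \<in> \<Gamma>"
  note l = isometriesD(4)[OF \<Gamma> g]
  have "AE x in lborel. L (v (A (\<sigma> *\<^sub>R x + a))) = v (\<sigma> *\<^sub>R x + a)"
    using AE_similarity[OF orthogonal_transformation_id \<open>\<sigma> > 0\<close> invariantD[OF v g], of a] by simp
  then show "AE x in lborel. L (v (\<sigma> *\<^sub>R A x + a)) = v (\<sigma> *\<^sub>R x + a)"
    by (simp add: linear_add[OF l] linear_cmul[OF l] a[OF g])
qed

lemma invariant_limit:
  assumes \<Gamma>: "isometries \<Gamma>" and V: "\<And>k::nat. invariant \<Gamma> (V k)" and lim: "AE x in lborel. (\<lambda>k. V k x) \<longlonglongrightarrow> v x"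
  shows "invariant \<Gamma> v"
  unfolding invariant_def
proof (clarify)
  fix L A assume g: "(L, A) \<in> \<Gamma>"
  note l = isometriesD[OF \<Gamma> g]
  have "AE x in lborel. \<forall>k. L (V k (A x)) = V k x" using invariantD[OF V g] by (simp add: AE_all_countable)
  with lim AE_orthogonal[OF l(2) lim] show "AE x in lborel. L (v (A x)) = v x"
  proof eventually_elim
    case (elim x)
    have "(\<lambda>k. L (V k (A x))) \<longlonglongrightarrow> L (v (A x))"
      by (rule linear_conv_bounded_linear[THEN iffD1, OF l(3), THEN bounded_linear.tendsto, OF elim(2)])
    then have "(\<lambda>k. V k x) \<longlonglongrightarrow> L (v (A x))" using elim(3) by simp
    then show ?case using elim(1) LIMSEQ_unique by blast
  qed
qed

lemma D12_transform:
  assumes v: "has_D12_gradient v G" and L: "orthogonal_transformation L" and A: "orthogonal_transformation A"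
  shows "has_D12_gradient (\<lambda>x. L (v (A x))) (\<lambda>x. pull L A (G (A x)))"
  using D12_similarity[OF v orthogonal_transformation_linear[OF L] A, of 1 0] by simp

lemma integral_orthogonal:
  fixes g :: "real^3 \<Rightarrow> real" and A :: "real^3 \<Rightarrow> real^3"
  shows "orthogonal_transformation A \<Longrightarrow> g \<in> borel_measurable borel \<Longrightarrow> (\<integral>x. g (A x) \<partial>lborel) = (\<integral>x. g x \<partial>lborel)"
  using integral_similarity[of A 1 g 0] by simp

lemma ip_transform:
  assumes G: "L2 G" and H: "L2 H" and L: "orthogonal_transformation L" and A: "orthogonal_transformation A"
  shows "ip (\<lambda>x. pull L A (G (A x))) (\<lambda>x. pull L A (H (A x))) = ip G H"
proof -
  note [measurable] = L2_measurable[OF G] L2_measurable[OF H]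
  show ?thesis unfolding inner_pull[OF L A] by (rule integral_orthogonal[OF A]) measurable
qed

lemma ip_zero_imp_AE:
  assumes "L2 G" "ip G G = 0" shows "AE x in lborel. G x = 0"
proof -
  note [measurable] = L2_measurable[OF assms(1)]
  have "Np 2 G = 0" using Np2_eq_ip[OF assms(1)] assms(2) by simp
  then have "AE x in lborel. ennreal ((norm (G x))\<^sup>2) = 0" by (subst (asm) nn_integral_0_iff_AE) auto
  then show ?thesis by (auto elim!: AE_mp)
qed

lemma D12_zero_energy:
  assumes v: "has_D12_gradient v G" and "ip G G = 0" shows "AE x in lborel. v x = 0"
proof -
  note [measurable] = D12_measurable[OF v]
  have "Np 6 v \<le> 2 ^ 24 * (Np 2 G) ^ 3" by (rule D12_Sobolev[OF v])
  also have "\<dots> = 0" using Np2_eq_ip[OF D12_L2[OF v]] assms(2) by simp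
  finally have "AE x in lborel. ennreal (norm (v x) ^ 6) = 0" by (subst (asm) le_zero_eq, subst (asm) nn_integral_0_iff_AE) auto
  then show ?thesis by (auto elim!: AE_mp)
qed

text \<open>Uniqueness of the least-energy element: if the midpoint does not have less energy than
  the bound on both ends, the parallelogram law leaves no room for a difference.\<close>

lemma ip_minimal_eq:
  assumes G: "L2 G" and H: "L2 H" and "ip G G \<le> \<delta>" "ip H H \<le> \<delta>"
    and "\<delta> \<le> ip (\<lambda>x. (1/2) *\<^sub>R G x + (1/2) *\<^sub>R H x) (\<lambda>x. (1/2) *\<^sub>R G x + (1/2) *\<^sub>R H x)"
  shows "ip (\<lambda>x. G x - H x) (\<lambda>x. G x - H x) = 0"
proof (rule antisym)
  have "x = 2 * a + 2 * b - 4 * m \<Longrightarrow> a \<le> \<delta> \<Longrightarrow> b \<le> \<delta> \<Longrightarrow> \<delta> \<le> m \<Longrightarrow> x \<le> 0" for x a b m :: real by argo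
  from this[OF ip_parallelogram[OF G H] assms(3-5)] show "ip (\<lambda>x. G x - H x) (\<lambda>x. G x - H x) \<le> 0" .
qed simp

context nonlinearity
begin

lemma F_zero: "AE x in lborel. v x = 0 \<Longrightarrow> v \<in> borel_measurable borel \<Longrightarrow> F v = 0"
proof -
  assume v: "AE x in lborel. v x = 0" and [measurable]: "v \<in> borel_measurable borel"
  have "F v = (\<integral>x. 0 \<partial>(lborel :: (real^3) measure))"
    by (rule integral_cong_AE) (use v in \<open>auto elim!: AE_mp simp: f0\<close>)
  then show ?thesis by simp
qed

text \<open>The inequality for the quotient is multiplied out, so that functions of zero energy need
  no exception; at energy 1 the quotient is \<open>F v\<close> itself.\<close>

definition maximiser :: "symmetries \<Rightarrow> real \<Rightarrow> (real^3 \<Rightarrow> complex) \<Rightarrow> (real^3 \<Rightarrow> complex^3) \<Rightarrow> bool" where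
  "maximiser \<Gamma> S v G \<longleftrightarrow> has_D12_gradient v G \<and> invariant \<Gamma> v \<and> ip G G = 1 \<and> F v = S \<and> S > 0 \<and>
     (\<forall>w W. has_D12_gradient w W \<longrightarrow> invariant \<Gamma> w \<longrightarrow> F w \<le> S * (ip W W) ^ 3)"

text \<open>F - S T^3 is nonpositive on invariant functions and 0 at \<open>v\<close>, so its
  difference quotients are nonpositive. The factor 6 is 3 from the cube times 2 from the square of
  the gradient.\<close>

lemma Euler_Lagrange_le:
  assumes \<Gamma>: "isometries \<Gamma>" and m: "maximiser \<Gamma> S v G" and h: "has_D12_gradient h H" "invariant \<Gamma> h"
  shows "(\<integral>x. f' (v x) \<bullet> h x \<partial>lborel) \<le> 6 * S * ip G H"
proof (rule LIMSEQ_le)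
  have v: "has_D12_gradient v G" "invariant \<Gamma> v" "ip G G = 1" "F v = S" "S > 0"
    and max: "\<And>w W. has_D12_gradient w W \<Longrightarrow> invariant \<Gamma> w \<Longrightarrow> F w \<le> S * (ip W W) ^ 3"
    using m by (auto simp: maximiser_def)
  let ?t = "\<lambda>k. 1 / real (Suc k)"
  let ?x = "ip G H" and ?y = "ip H H"
  \<comment> \<open>Chosen so that the energy of v + t h is 1 + t b; then (1 + t b)^3 - 1 equals t b
    (3 + 3 t b + (t b)^2).\<close>
  let ?b = "\<lambda>k. 2 * ?x + ?t k * ?y"
  show "(\<lambda>k. Suc k * (F (\<lambda>x. v x + ?t k *\<^sub>R h x) - F v)) \<longlonglongrightarrow> (\<integral>x. f' (v x) \<bullet> h x \<partial>lborel)"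
    by (intro F_directional_derivative D12_measurable[OF v(1)] D12_measurable[OF h(1)] D12_Np6_finite[OF v(1)] D12_Np6_finite[OF h(1)])
  have "(\<lambda>k. S * (?b k * (3 + 3 * (?t k * ?b k) + (?t k * ?b k)\<^sup>2))) \<longlonglongrightarrow> S * ((2 * ?x + 0 * ?y) * (3 + 3 * (0 * (2 * ?x + 0 * ?y)) + (0 * (2 * ?x + 0 * ?y))\<^sup>2))"
    by (intro tendsto_intros LIMSEQ_Suc[OF lim_1_over_n])
  then show "(\<lambda>k. S * (?b k * (3 + 3 * (?t k * ?b k) + (?t k * ?b k)\<^sup>2))) \<longlonglongrightarrow> 6 * S * ?x" by (simp add: mult_ac)
  have "Suc k * (F (\<lambda>x. v x + ?t k *\<^sub>R h x) - F v) \<le> S * (?b k * (3 + 3 * (?t k * ?b k) + (?t k * ?b k)\<^sup>2))" for k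
  proof -
    have "F (\<lambda>x. 1 *\<^sub>R v x + ?t k *\<^sub>R h x) \<le> S * (ip (\<lambda>x. 1 *\<^sub>R G x + ?t k *\<^sub>R H x) (\<lambda>x. 1 *\<^sub>R G x + ?t k *\<^sub>R H x)) ^ 3"
      by (intro max D12_lincomb invariant_lincomb v h \<Gamma>)
    also have "ip (\<lambda>x. 1 *\<^sub>R G x + ?t k *\<^sub>R H x) (\<lambda>x. 1 *\<^sub>R G x + ?t k *\<^sub>R H x) = 1 + ?t k * ?b k"
      unfolding ip_quadratic[OF D12_L2[OF v(1)] D12_L2[OF h(1)]] v(3) by (simp add: power2_eq_square algebra_simps)
    finally have "F (\<lambda>x. v x + ?t k *\<^sub>R h x) - F v \<le> S * (1 + ?t k * ?b k) ^ 3 - S" using v(4) by simp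
    also have "\<dots> = ?t k * (S * (?b k * (3 + 3 * (?t k * ?b k) + (?t k * ?b k)\<^sup>2)))"
      by (simp only: power3_eq_cube power2_eq_square) algebra
    finally have "Suc k * (F (\<lambda>x. v x + ?t k *\<^sub>R h x) - F v) \<le> Suc k * (?t k * (S * (?b k * (3 + 3 * (?t k * ?b k) + (?t k * ?b k)\<^sup>2))))"
      by (rule mult_left_mono) simp
    then show ?thesis by simp
  qed
  then show "\<exists>N. \<forall>k\<ge>N. Suc k * (F (\<lambda>x. v x + ?t k *\<^sub>R h x) - F v) \<le> S * (?b k * (3 + 3 * (?t k * ?b k) + (?t k * ?b k)\<^sup>2))" by blast
qed

lemma Euler_Lagrange:
  assumes \<Gamma>: "isometries \<Gamma>" and m: "maximiser \<Gamma> S v G" and h: "has_D12_gradient h H" "invariant \<Gamma> h"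
  shows "(\<integral>x. f' (v x) \<bullet> h x \<partial>lborel) = 6 * S * ip G H"
proof (rule antisym)
  have "has_D12_gradient (\<lambda>x. (-1) *\<^sub>R h x) (\<lambda>x. (-1) *\<^sub>R H x)" "invariant \<Gamma> (\<lambda>x. (-1) *\<^sub>R h x + 0 *\<^sub>R h x)"
    by (intro D12_scaleR h invariant_lincomb \<Gamma>)+
  from Euler_Lagrange_le[OF \<Gamma> m, of "\<lambda>x. (-1) *\<^sub>R h x" "\<lambda>x. (-1) *\<^sub>R H x"] this
  show "6 * S * ip G H \<le> (\<integral>x. f' (v x) \<bullet> h x \<partial>lborel)" by simp
qed (rule Euler_Lagrange_le[OF assms])

text \<open>Young's inequality splits the pairing with the difference into at most e / 2, carried by
  |v|^6 with a small weight, and a multiple of the sixth power of the L^6 distance.\<close>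

lemma f'_inner_tendsto:
  assumes v: "has_D12_gradient v G" and w: "\<And>k. has_D12_gradient (w k) (W k)" "has_D12_gradient u U"
    and lim: "(\<lambda>k. Np 6 (\<lambda>x. w k x - u x)) \<longlonglongrightarrow> 0"
  shows "(\<lambda>k. \<integral>x. f' (v x) \<bullet> w k x \<partial>lborel) \<longlonglongrightarrow> (\<integral>x. f' (v x) \<bullet> u x \<partial>lborel)"
proof (rule LIMSEQ_I)
  fix e :: real assume e: "e > 0"
  note [measurable] = D12_measurable[OF v] D12_measurable[OF w(1)] D12_measurable[OF w(2)]
  define B where "B = (\<integral>x. norm (v x) ^ 6 \<partial>lborel)"
  have B: "B \<ge> 0" by (simp add: B_def)
  have iv: "integrable lborel (\<lambda>x. norm (v x) ^ 6)" by (intro integrable_norm6 D12_measurable[OF v] D12_Np6_finite[OF v])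
  define \<tau> where "\<tau> = e / (2 * c * (B + 1))"
  have \<tau>: "\<tau> > 0" using e c B by (simp add: \<tau>_def)
  have \<tau>B: "c * \<tau> * B \<le> e / 2"
  proof -
    have "c * \<tau> * B \<le> c * \<tau> * (B + 1)" using c \<tau> by (intro mult_left_mono) auto
    also have "\<dots> = e / 2"
    proof -
      have "c * (e / (2 * c * D)) * D = e / 2" if "D \<noteq> 0" for D using that c by simp
      then show ?thesis unfolding \<tau>_def using B by simp
    qed
    finally show ?thesis .
  qed
  define \<kappa> where "\<kappa> = c * (1 / \<tau>) ^ 5"
  have \<kappa>: "\<kappa> > 0" using c \<tau> by (simp add: \<kappa>_def)
  have "e / (4 * \<kappa>) > 0" using e \<kappa> by simp
  from ennreal_tendsto_zeroD[OF lim this] obtain N where N: "\<And>k. k \<ge> N \<Longrightarrow> Np 6 (\<lambda>x. w k x - u x) \<le> ennreal (e / (4 * \<kappa>))" by blast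
  have "norm ((\<integral>x. f' (v x) \<bullet> w k x \<partial>lborel) - (\<integral>x. f' (v x) \<bullet> u x \<partial>lborel)) < e" if "k \<ge> N" for k
  proof -
    note du = D12_diff[OF w(1)[of k] w(2)]
    have iu: "integrable lborel (\<lambda>x. norm (w k x - u x) ^ 6)"
      by (intro integrable_norm6 D12_measurable(1)[OF du] D12_Np6_finite[OF du])
    have i: "integrable lborel (\<lambda>x. f' (v x) \<bullet> z x)" if "has_D12_gradient z Z" for z Z
      by (intro integrable_f'_inner D12_measurable[OF v] D12_measurable(1)[OF that] D12_Np6_finite[OF v] D12_Np6_finite[OF that])
    have "norm ((\<integral>x. f' (v x) \<bullet> w k x \<partial>lborel) - (\<integral>x. f' (v x) \<bullet> u x \<partial>lborel)) = norm (\<integral>x. f' (v x) \<bullet> (w k x - u x) \<partial>lborel)"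
      using i[OF w(1)[of k]] i[OF w(2)] by (simp add: inner_diff_right)
    also have "\<dots> \<le> (\<integral>x. norm (f' (v x) \<bullet> (w k x - u x)) \<partial>lborel)" by (rule integral_norm_bound)
    also have "\<dots> \<le> (\<integral>x. c * \<tau> * norm (v x) ^ 6 + \<kappa> * norm (w k x - u x) ^ 6 \<partial>lborel)"
    proof (rule integral_mono)
      fix x
      have "norm (f' (v x) \<bullet> (w k x - u x)) \<le> norm (f' (v x)) * norm (w k x - u x)" by (simp add: Cauchy_Schwarz_ineq2)
      also have "\<dots> \<le> c * norm (v x) ^ 5 * norm (w k x - u x)" by (intro mult_right_mono f'_bound) simp
      also have "\<dots> \<le> c * (\<tau> * norm (v x) ^ 6 + (1 / \<tau>) ^ 5 * norm (w k x - u x) ^ 6)"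
        unfolding mult.assoc using c \<tau> by (intro mult_left_mono Young_power) auto
      finally show "norm (f' (v x) \<bullet> (w k x - u x)) \<le> c * \<tau> * norm (v x) ^ 6 + \<kappa> * norm (w k x - u x) ^ 6"
        by (simp add: \<kappa>_def distrib_left mult_ac)
    qed (use iv iu i[OF du] in auto)
    also have "\<dots> = c * \<tau> * B + \<kappa> * (\<integral>x. norm (w k x - u x) ^ 6 \<partial>lborel)"
      using iv iu by (simp add: B_def)
    also have "\<dots> \<le> c * \<tau> * B + \<kappa> * (e / (4 * \<kappa>))"
      using \<kappa> e N[OF that] nn_integral_eq_integral[OF iu] by (intro add_left_mono mult_left_mono) auto
    also have "\<dots> = c * \<tau> * B + e / 4" using \<kappa> by simp
    finally show ?thesis using \<tau>B e by linarith
  qed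
  then show "\<exists>N. \<forall>k\<ge>N. norm ((\<integral>x. f' (v x) \<bullet> w k x \<partial>lborel) - (\<integral>x. f' (v x) \<bullet> u x \<partial>lborel)) < e" by blast
qed

text \<open>With D the difference of the gradients, nonnegativity of the energies of \<tau> G + D
  and \<tau> G - D bounds 2 \<tau> |<G, D>| by \<tau>^2 <G, G> + <D, D>. The weight \<tau> makes the
  first term at most \<tau> e.\<close>

lemma ip_tendsto:
  assumes G: "L2 G" and W: "\<And>k. L2 (W k)" and U: "L2 U" and lim: "(\<lambda>k. Np 2 (\<lambda>x. W k x - U x)) \<longlonglongrightarrow> 0"
  shows "(\<lambda>k. ip G (W k)) \<longlonglongrightarrow> ip G U"
proof (rule LIMSEQ_I)
  fix e :: real assume e: "e > 0"
  define \<tau> where "\<tau> = e / (ip G G + 1)"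
  have g: "ip G G \<ge> 0" by simp
  then have \<tau>: "\<tau> > 0" unfolding \<tau>_def using e by (intro divide_pos_pos) linarith+
  have \<tau>G: "\<tau> * ip G G \<le> e"
  proof -
    have "\<tau> * ip G G \<le> \<tau> * (ip G G + 1)" using \<tau> by (intro mult_left_mono) auto
    also have "\<dots> = e"
    proof -
      have "ip G G + 1 \<noteq> 0" using g by linarith
      then show ?thesis by (simp add: \<tau>_def)
    qed
    finally show ?thesis .
  qed
  have "\<tau> * e / 2 > 0" using \<tau> e by simp
  from ennreal_tendsto_zeroD[OF lim this] obtain N where N: "\<And>k. k \<ge> N \<Longrightarrow> Np 2 (\<lambda>x. W k x - U x) \<le> ennreal (\<tau> * e / 2)" by blast
  have "norm (ip G (W k) - ip G U) < e" if k: "k \<ge> N" for k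
  proof -
    let ?D = "\<lambda>x. W k x - U x"
    have D: "L2 ?D" by (intro L2_diff W U)
    have "ip ?D ?D \<le> \<tau> * e / 2" using N[OF k] \<tau> e unfolding Np2_eq_ip[OF D] by simp
    moreover have eq: "ip G (W k) - ip G U = ip G ?D"
      using L2_integrable[OF G W[of k]] L2_integrable[OF G U] by (simp add: inner_diff_right)
    moreover have "0 \<le> \<tau>\<^sup>2 * ip G G + 2 * \<tau> * s * ip G ?D + s\<^sup>2 * ip ?D ?D" for s
      unfolding ip_quadratic[OF G D, symmetric] by (rule ip_nonneg)
    from this[of 1] this[of "-1"] have "2 * \<tau> * \<bar>ip G ?D\<bar> \<le> \<tau>\<^sup>2 * ip G G + ip ?D ?D"
      by (auto simp: abs_if)
    moreover have "\<tau>\<^sup>2 * ip G G \<le> \<tau> * e" using mult_left_mono[OF \<tau>G, of \<tau>] \<tau> by (simp add: power2_eq_square mult.assoc)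
    ultimately have "2 * \<tau> * \<bar>ip G ?D\<bar> < 2 * \<tau> * e" using \<open>\<tau> * e / 2 > 0\<close> by argo
    then show ?thesis using eq \<tau> by simp
  qed
  then show "\<exists>N. \<forall>k\<ge>N. norm (ip G (W k) - ip G U) < e" by blast
qed

text \<open>The transformed gradient is again a gradient of \<open>v\<close>, of the same energy,
  and so is the average of the two. If they differed, the average would have energy below 1, against
  maximality. Uniqueness of the gradient is thus drawn from the variational problem itself.\<close>

lemma maximiser_gradient_invariant:
  assumes \<Gamma>: "isometries \<Gamma>" and m: "maximiser \<Gamma> S v G" and g: "(L, A) \<in> \<Gamma>"
  shows "AE x in lborel. pull L A (G (A x)) = G x"
proof -
  have v: "has_D12_gradient v G" "invariant \<Gamma> v" "ip G G = 1" "F v = S" "S > 0"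
    and max: "\<And>w W. has_D12_gradient w W \<Longrightarrow> invariant \<Gamma> w \<Longrightarrow> F w \<le> S * (ip W W) ^ 3"
    using m by (auto simp: maximiser_def)
  note L = isometriesD(1)[OF \<Gamma> g] and A = isometriesD(2)[OF \<Gamma> g]
  let ?H = "\<lambda>x. pull L A (G (A x))"
  have t: "has_D12_gradient (\<lambda>x. L (v (A x))) ?H" by (rule D12_transform[OF v(1) L A])
  have H: "has_D12_gradient v ?H"
    by (rule D12_AE_cong[OF t invariantD[OF v(2) g]]) (auto intro: D12_measurable[OF v(1)] D12_measurable[OF t])
  let ?M = "\<lambda>x. (1/2) *\<^sub>R G x + (1/2) *\<^sub>R ?H x"
  have "(\<lambda>x. (1/2) *\<^sub>R v x + (1/2) *\<^sub>R v x) = v" by (auto simp: scaleR_left.add[symmetric])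
  then have "has_D12_gradient v ?M" using D12_lincomb[OF v(1) H, of "1/2" "1/2"] by simp
  from max[OF this v(2)] have "1 \<le> (ip ?M ?M) ^ 3" using v(4,5) by simp
  then have "1 \<le> ip ?M ?M" using power_le_one[of "ip ?M ?M" 3] power_strict_mono[of "ip ?M ?M" 1 3] ip_nonneg[of ?M] by force
  moreover have "ip ?H ?H = 1" using ip_transform[OF D12_L2[OF v(1)] D12_L2[OF v(1)] L A] v(3) by simp
  ultimately have "ip (\<lambda>x. ?H x - G x) (\<lambda>x. ?H x - G x) = 0"
    using v(3) by (intro ip_minimal_eq[of _ _ 1] D12_L2[OF H] D12_L2[OF v(1)]) (auto simp: add.commute)
  from ip_zero_imp_AE[OF L2_diff[OF D12_L2[OF H] D12_L2[OF v(1)]] this] show ?thesis by simp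
qed

text \<open>Symmetric criticality: the functional vanishes on invariant functions, and the element of
  least energy in each of its level sets is invariant because its transforms compete with it.\<close>

theorem Euler_Lagrange_all:
  assumes \<Gamma>: "isometries \<Gamma>" and m: "maximiser \<Gamma> S v G" and h: "has_D12_gradient h H"
  shows "(\<integral>x. f' (v x) \<bullet> h x \<partial>lborel) = 6 * S * ip G H"
proof -
  have v: "has_D12_gradient v G" "invariant \<Gamma> v" using m by (auto simp: maximiser_def)
  define l where "l w W = (\<integral>x. f' (v x) \<bullet> w x \<partial>lborel) - 6 * S * ip G W" for w and W :: "real^3 \<Rightarrow> complex^3"
  have i: "integrable lborel (\<lambda>x. f' (v x) \<bullet> z x)" if "has_D12_gradient z Z" for z Z
    by (intro integrable_f'_inner D12_measurable[OF v(1)] D12_measurable(1)[OF that] D12_Np6_finite[OF v(1)] D12_Np6_finite[OF that])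
  define C where "C = {(w, W). has_D12_gradient w W \<and> l w W = l h H}"
  have mid: "((\<lambda>x. (1/2) *\<^sub>R w x + (1/2) *\<^sub>R w' x), (\<lambda>x. (1/2) *\<^sub>R W x + (1/2) *\<^sub>R W' x)) \<in> C"
    if "(w, W) \<in> C" "(w', W') \<in> C" for w W w' W'
  proof -
    have D: "has_D12_gradient w W" "has_D12_gradient w' W'" and e: "l w W = l h H" "l w' W' = l h H" using that by (auto simp: C_def)
    have e1: "ip G (\<lambda>x. (1/2) *\<^sub>R W x + (1/2) *\<^sub>R W' x) = 1/2 * ip G W + 1/2 * ip G W'"
      using ip_lincomb[OF D12_L2[OF D(1)] D12_L2[OF D(2)] D12_L2[OF v(1)], of "1/2" "1/2"] by (simp only: ip_commute[of G])
    have e2: "(\<integral>x. f' (v x) \<bullet> ((1/2) *\<^sub>R w x + (1/2) *\<^sub>R w' x) \<partial>lborel) = 1/2 * (\<integral>x. f' (v x) \<bullet> w x \<partial>lborel) + 1/2 * (\<integral>x. f' (v x) \<bullet> w' x \<partial>lborel)"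
      using i[OF D(1)] i[OF D(2)] by (simp add: inner_add_right)
    have "l (\<lambda>x. (1/2) *\<^sub>R w x + (1/2) *\<^sub>R w' x) (\<lambda>x. (1/2) *\<^sub>R W x + (1/2) *\<^sub>R W' x) = 1/2 * l w W + 1/2 * l w' W'"
      unfolding l_def e1 e2 by (simp add: algebra_simps)
    then show ?thesis using D12_lincomb[OF D] e by (simp add: C_def)
  qed
  obtain u U w W d \<delta> where u: "has_D12_gradient u U" and w: "\<And>k::nat. (w k, W k) \<in> C"
    and lim: "(\<lambda>k. Np 6 (\<lambda>x. w k x - u x)) \<longlonglongrightarrow> 0" "(\<lambda>k. Np 2 (\<lambda>x. W k x - U x)) \<longlonglongrightarrow> 0"
    and d: "\<And>(k::nat) w W. (w, W) \<in> C \<Longrightarrow> d k \<le> ip W W" "d \<longlonglongrightarrow> \<delta>" and U\<delta>: "ip U U \<le> \<delta>"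
  proof (rule D12_near_minimisers[of "\<lambda>_. C" "ip H H"])
    show "\<exists>w W. (w, W) \<in> C \<and> ip W W \<le> ip H H" using h by (auto simp: C_def)
    show "has_D12_gradient w W" if "(w, W) \<in> C" for w W using that by (simp add: C_def)
    show "(\<lambda>x. (1/2) *\<^sub>R w x + (1/2) *\<^sub>R w' x, \<lambda>x. (1/2) *\<^sub>R W x + (1/2) *\<^sub>R W' x) \<in> C"
      if "(w, W) \<in> C" "(w', W') \<in> C" for w W w' W' by (rule mid[OF that])
    show "C \<subseteq> C" ..
  qed blast
  have wD: "has_D12_gradient (w k) (W k)" "l (w k) (W k) = l h H" for k using w[of k] by (auto simp: C_def)
  have low: "\<delta> \<le> ip W W" if "(w, W) \<in> C" for w W
    using d(1)[OF that] d(2) by (intro LIMSEQ_le_const2) auto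
  have "(\<lambda>k. l (w k) (W k)) \<longlonglongrightarrow> l u U"
    unfolding l_def by (intro tendsto_intros f'_inner_tendsto[OF v(1) wD(1) u lim(1)] ip_tendsto[OF D12_L2[OF v(1)] D12_L2[OF wD(1)] D12_L2[OF u] lim(2)])
  then have lu: "l u U = l h H" unfolding wD(2) by (simp add: LIMSEQ_const_iff)
  then have uC: "(u, U) \<in> C" using u by (simp add: C_def)
  have "invariant \<Gamma> u"
    unfolding invariant_def
  proof (clarify)
    fix L A assume g: "(L, A) \<in> \<Gamma>"
    note L = isometriesD(1)[OF \<Gamma> g] and A = isometriesD(2)[OF \<Gamma> g]
    let ?u = "\<lambda>x. L (u (A x))" and ?U = "\<lambda>x. pull L A (U (A x))"
    have gu: "has_D12_gradient ?u ?U" by (rule D12_transform[OF u L A])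
    note [measurable] = D12_measurable[OF v(1)] D12_measurable[OF u] D12_measurable[OF gu] orthogonal_transformation_measurable[OF A]
      linear_borel_measurable[OF linear_pull[OF orthogonal_transformation_linear[OF L], of A]]
    \<comment> \<open>The transform of \<open>u\<close> stays on the level set: invariance of
      \<open>G\<close> takes care of the energy product, and equivariance of \<open>f'\<close> of
      the nonlinear term.\<close>
    have "ip G ?U = ip (\<lambda>x. pull L A (G (A x))) ?U"
      using maximiser_gradient_invariant[OF \<Gamma> m g] by (intro integral_cong_AE) (measurable, auto elim!: AE_mp)
    also have "\<dots> = ip G U" by (rule ip_transform[OF D12_L2[OF v(1)] D12_L2[OF u] L A])
    finally have 1: "ip G ?U = ip G U" .
    have "(\<integral>x. f' (v x) \<bullet> ?u x \<partial>lborel) = (\<integral>x. f' (v (A x)) \<bullet> u (A x) \<partial>lborel)"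
    proof (rule integral_cong_AE)
      show "AE x in lborel. f' (v x) \<bullet> ?u x = f' (v (A x)) \<bullet> u (A x)"
        using invariantD[OF v(2) g]
      proof eventually_elim
        case (elim x)
        have "f' (v x) = L (f' (v (A x)))" using f'_isometry[OF L, of "v (A x)"] elim by simp
        then show ?case using L by (simp add: orthogonal_transformation_def)
      qed
    qed measurable
    also have "\<dots> = (\<integral>x. f' (v x) \<bullet> u x \<partial>lborel)" by (rule integral_orthogonal[OF A]) measurable
    finally have "(?u, ?U) \<in> C" using 1 gu lu by (simp add: C_def l_def)
    moreover have "ip ?U ?U \<le> \<delta>" using U\<delta> ip_transform[OF D12_L2[OF u] D12_L2[OF u] L A] by simp
    ultimately have "ip (\<lambda>x. ?U x - U x) (\<lambda>x. ?U x - U x) = 0"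
      using U\<delta> low[OF mid[OF _ uC]] by (intro ip_minimal_eq D12_L2[OF gu] D12_L2[OF u]) auto
    from D12_zero_energy[OF D12_diff[OF gu u] this] show "AE x in lborel. L (u (A x)) = u x" by simp
  qed
  from Euler_Lagrange[OF \<Gamma> m u this] have "l u U = 0" by (simp add: l_def)
  with lu show ?thesis by (simp add: l_def)
qed

text \<open>Under dilation by \<sigma> the two gradients contribute \<open>\<sigma>\<^sup>2\<close>,
  equal to the multiplier 6 S, and the Jacobian \<open>1 / \<sigma> ^ 3\<close> is common to both
  sides. Test functions are dilated back by 1 / \<sigma>.\<close>

theorem maximiser_weak_solution:
  assumes \<Gamma>: "isometries \<Gamma>" and m: "maximiser \<Gamma> S v G"
  shows "weak_solution f' (\<lambda>x. v (sqrt (6 * S) *\<^sub>R x))"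
proof -
  have v: "has_D12_gradient v G" and S: "S > 0" using m by (auto simp: maximiser_def)
  define \<sigma> where "\<sigma> = sqrt (6 * S)"
  have \<sigma>: "\<sigma> > 0" "\<sigma>\<^sup>2 = 6 * S" using S by (auto simp: \<sigma>_def)
  have sc: "has_D12_gradient (\<lambda>x. w (s *\<^sub>R x)) (\<lambda>x. s *\<^sub>R W (s *\<^sub>R x))" if "has_D12_gradient w W" "s > 0" for w W s
    using D12_similarity[OF that(1) linear_id orthogonal_transformation_id that(2), of 0] by (simp add: pull_id id_def)
  have int: "(\<integral>x. g (\<sigma> *\<^sub>R x) \<partial>lborel) = (\<integral>x. g x \<partial>lborel) / \<sigma> ^ 3" if "g \<in> borel_measurable borel" for g :: "real^3 \<Rightarrow> real"
    using integral_similarity[OF orthogonal_transformation_id \<sigma>(1) that, of 0] by (simp add: divide_inverse mult.commute)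
  note vs = sc[OF v \<sigma>(1)]
  have "integrable lborel (\<lambda>x. (\<sigma> *\<^sub>R G (\<sigma> *\<^sub>R x)) \<bullet> H x) \<and> integrable lborel (\<lambda>x. f' (v (\<sigma> *\<^sub>R x)) \<bullet> h x) \<and>
     (\<integral>x. (\<sigma> *\<^sub>R G (\<sigma> *\<^sub>R x)) \<bullet> H x \<partial>lborel) = (\<integral>x. f' (v (\<sigma> *\<^sub>R x)) \<bullet> h x \<partial>lborel)" if h: "has_D12_gradient h H" for h H
  proof (intro conjI)
    show "integrable lborel (\<lambda>x. (\<sigma> *\<^sub>R G (\<sigma> *\<^sub>R x)) \<bullet> H x)" by (rule D12_integrable_inner[OF vs h])
    show "integrable lborel (\<lambda>x. f' (v (\<sigma> *\<^sub>R x)) \<bullet> h x)"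
      by (intro integrable_f'_inner D12_measurable[OF vs] D12_measurable(1)[OF h] D12_Np6_finite[OF vs] D12_Np6_finite[OF h])
    define k where "k x = h ((1 / \<sigma>) *\<^sub>R x)" for x
    define K where "K x = (1 / \<sigma>) *\<^sub>R H ((1 / \<sigma>) *\<^sub>R x)" for x
    have k: "has_D12_gradient k K" unfolding k_def K_def by (rule sc[OF h]) (use \<sigma> in simp)
    note [measurable] = D12_measurable[OF v] D12_measurable[OF k]
    have hk: "h x = k (\<sigma> *\<^sub>R x)" "H x = \<sigma> *\<^sub>R K (\<sigma> *\<^sub>R x)" for x using \<sigma>(1) by (auto simp: k_def K_def)
    have "(\<integral>x. (\<sigma> *\<^sub>R G (\<sigma> *\<^sub>R x)) \<bullet> H x \<partial>lborel) = (\<integral>x. \<sigma>\<^sup>2 * (G (\<sigma> *\<^sub>R x) \<bullet> K (\<sigma> *\<^sub>R x)) \<partial>lborel)"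
      by (simp add: hk(2) power2_eq_square mult.assoc)
    also have "\<dots> = \<sigma>\<^sup>2 * (ip G K / \<sigma> ^ 3)" using int[of "\<lambda>x. G x \<bullet> K x"] by simp
    also have "\<dots> = (6 * S * ip G K) / \<sigma> ^ 3" by (simp add: \<sigma>(2))
    also have "\<dots> = (\<integral>x. f' (v x) \<bullet> k x \<partial>lborel) / \<sigma> ^ 3" by (simp add: Euler_Lagrange_all[OF \<Gamma> m k])
    also have "\<dots> = (\<integral>x. f' (v (\<sigma> *\<^sub>R x)) \<bullet> k (\<sigma> *\<^sub>R x) \<partial>lborel)" using int[of "\<lambda>x. f' (v x) \<bullet> k x"] by simp
    finally show "(\<integral>x. (\<sigma> *\<^sub>R G (\<sigma> *\<^sub>R x)) \<bullet> H x \<partial>lborel) = (\<integral>x. f' (v (\<sigma> *\<^sub>R x)) \<bullet> h x \<partial>lborel)" by (simp only: hk(1))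
  qed
  with vs show ?thesis unfolding weak_solution_def \<sigma>_def by blast
qed

end

section \<open>Existence of a maximiser\<close>

definition rotz :: "real \<Rightarrow> real^3 \<Rightarrow> real^3" where
  "rotz \<alpha> x = vector [cos \<alpha> * x $ 1 - sin \<alpha> * x $ 2, sin \<alpha> * x $ 1 + cos \<alpha> * x $ 2, x $ 3]"

lemma norm_vec3: "norm (x :: real^3) = sqrt ((x $ 1)\<^sup>2 + (x $ 2)\<^sup>2 + (x $ 3)\<^sup>2)"
  by (simp add: norm_vec_def L2_set_def sum_3)

lemma orthogonal_rotz: "orthogonal_transformation (rotz \<alpha>)"
  unfolding orthogonal_transformation
proof (intro conjI allI)
  show "linear (rotz \<alpha>)"
    by (rule linearI) (auto simp: rotz_def vec_eq_iff forall_3 algebra_simps)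
  fix x :: "real^3"
  have "(cos \<alpha> * x $ 1 - sin \<alpha> * x $ 2)\<^sup>2 + (sin \<alpha> * x $ 1 + cos \<alpha> * x $ 2)\<^sup>2 =
      ((cos \<alpha>)\<^sup>2 + (sin \<alpha>)\<^sup>2) * ((x $ 1)\<^sup>2 + (x $ 2)\<^sup>2)"
    by (simp only: power2_eq_square) algebra
  then show "norm (rotz \<alpha> x) = norm x" by (simp add: norm_vec3 rotz_def)
qed

lemma norm_rotz_diff:
  "norm (rotz \<alpha> x - rotz \<beta> x) = sqrt ((x $ 1)\<^sup>2 + (x $ 2)\<^sup>2) * norm (cis \<alpha> - cis \<beta>)"
proof -
  let ?c = "cos \<alpha> - cos \<beta>" and ?s = "sin \<alpha> - sin \<beta>"
  have "(cos \<alpha> * x $ 1 - sin \<alpha> * x $ 2 - (cos \<beta> * x $ 1 - sin \<beta> * x $ 2))\<^sup>2 +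
      (sin \<alpha> * x $ 1 + cos \<alpha> * x $ 2 - (sin \<beta> * x $ 1 + cos \<beta> * x $ 2))\<^sup>2 =
      ((x $ 1)\<^sup>2 + (x $ 2)\<^sup>2) * (?c\<^sup>2 + ?s\<^sup>2)"
    by (simp only: power2_eq_square) algebra
  then show ?thesis by (simp add: norm_vec3 rotz_def cmod_def real_sqrt_mult)
qed

lemma superlevel_emeasure_le:
  fixes v :: "real^3 \<Rightarrow> complex"
  assumes [measurable]: "v \<in> borel_measurable borel" and "\<epsilon> > 0" and "Np 6 v \<le> ennreal S" "S \<ge> 0"
  shows "emeasure lborel {y. norm (v y) > \<epsilon>} \<le> ennreal (S / \<epsilon> ^ 6)"
proof -
  have m[measurable]: "{y. norm (v y) > \<epsilon>} \<in> sets borel" by measurable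
  have "emeasure lborel {y. norm (v y) > \<epsilon>} = (\<integral>\<^sup>+y. indicator {y. norm (v y) > \<epsilon>} y \<partial>lborel)" by simp
  also have "\<dots> \<le> (\<integral>\<^sup>+y. ennreal (1 / \<epsilon> ^ 6) * ennreal (norm (v y) ^ 6) \<partial>lborel)"
  proof (rule nn_integral_mono)
    fix y
    have "1 \<le> 1 / \<epsilon> ^ 6 * norm (v y) ^ 6" if "norm (v y) > \<epsilon>"
      using power_mono[of \<epsilon> "norm (v y)" 6] that \<open>\<epsilon> > 0\<close> by simp
    then show "indicator {y. norm (v y) > \<epsilon>} y \<le> ennreal (1 / \<epsilon> ^ 6) * ennreal (norm (v y) ^ 6)"
      using \<open>\<epsilon> > 0\<close> by (auto simp: indicator_def ennreal_mult[symmetric] simp flip: ennreal_1 intro!: ennreal_leI)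
  qed
  also have "\<dots> = ennreal (1 / \<epsilon> ^ 6) * Np 6 v" by (rule nn_integral_cmult) measurable
  also have "\<dots> \<le> ennreal (1 / \<epsilon> ^ 6) * ennreal S" by (intro mult_left_mono assms) simp
  also have "\<dots> = ennreal (S / \<epsilon> ^ 6)" using assms by (simp add: ennreal_mult[symmetric])
  finally show ?thesis .
qed

text \<open>A truncation of \<open>v\<close> oscillates little under small translations, so it cannot live on sets
  that are sparse in every small ball.\<close>

lemma superlevel_concentration:
  assumes v: "has_D12_gradient v G" "ip G G = 1" and pos: "\<epsilon> > 0" "\<mu> > 0" "l > 0" "8 * l\<^sup>2 < \<epsilon>\<^sup>2 * \<mu>"
    and \<mu>: "ennreal \<mu> \<le> emeasure lborel {y. norm (v y) > 2 * \<epsilon>}"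
  shows "\<exists>x. ennreal (ball_vol l / 2) \<le> emeasure lborel ({y. norm (v y) > \<epsilon>} \<inter> ball x l)"
proof (rule ccontr)
  note [measurable] = D12_measurable[OF v(1)]
  define E where "E = {y. norm (v y) > \<epsilon>}"
  have [measurable]: "E \<in> sets borel" unfolding E_def by measurable
  \<comment> \<open>The truncation varies no more than |v|, vanishes off \<open>E\<close>, and is at
    least \<epsilon> where |v| > 2 \<epsilon>.\<close>
  define w where "w y = max 0 (norm (v y) - \<epsilon>)" for y
  have [measurable]: "w \<in> borel_measurable borel" unfolding w_def by measurable
  define \<beta> where "\<beta> = ball_vol l"
  have \<beta>: "\<beta> > 0" using ball_vol_pos[OF pos(3)] by (simp add: \<beta>_def)
  assume "\<not> ?thesis"
  then have sp: "emeasure lborel (E \<inter> ball x l) < ennreal (\<beta> / 2)" for x by (auto simp: E_def \<beta>_def not_le)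
  let ?g = "\<lambda>x h. ennreal ((w (x + h) - w x)\<^sup>2) * indicator (ball 0 l) h"
  \<comment> \<open>If \<open>E\<close> fills less than half of the ball around x, then w (x + h) =
    0 for at least half of the shifts h in the ball, and each of these contributes
    \<open>(w x)\<^sup>2\<close>.\<close>
  have low: "ennreal (\<beta> / 2) * ennreal ((w x)\<^sup>2) \<le> (\<integral>\<^sup>+h. ?g x h \<partial>lborel)" for x
  proof -
    have fin: "emeasure lborel (E \<inter> ball x l) < \<infinity>" "emeasure lborel (ball x l - E) < \<infinity>"
      by (rule le_less_trans[OF emeasure_mono[of _ "ball x l"]]; auto simp: emeasure_ball_vol)+
    have "ennreal \<beta> = emeasure lborel (E \<inter> ball x l) + emeasure lborel (ball x l - E)"
      by (subst plus_emeasure) (auto simp: \<beta>_def emeasure_ball_vol[of x, symmetric] intro!: arg_cong[where f="emeasure lborel"])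
    moreover have "emeasure lborel (E \<inter> ball x l) = ennreal (measure lborel (E \<inter> ball x l))"
      "emeasure lborel (ball x l - E) = ennreal (measure lborel (ball x l - E))"
      using fin by (auto intro!: emeasure_eq_ennreal_measure)
    ultimately have "\<beta> = measure lborel (E \<inter> ball x l) + measure lborel (ball x l - E)"
      "measure lborel (E \<inter> ball x l) < \<beta> / 2"
      using sp[of x] \<beta> by (simp_all add: ennreal_less_iff flip: ennreal_plus)
    then have "ennreal (\<beta> / 2) \<le> emeasure lborel (ball x l - E)"
      using fin(2) by (subst emeasure_eq_ennreal_measure) (auto intro!: ennreal_leI)
    then have "ennreal (\<beta> / 2) * ennreal ((w x)\<^sup>2) \<le> emeasure lborel (ball x l - E) * ennreal ((w x)\<^sup>2)"
      by (rule mult_right_mono) simp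
    also have "\<dots> = (\<integral>\<^sup>+y. ennreal ((w x)\<^sup>2) * indicator (ball x l - E) y \<partial>lborel)"
      by (subst nn_integral_cmult) (auto simp: mult.commute)
    also have "\<dots> = (\<integral>\<^sup>+h. ennreal ((w x)\<^sup>2) * indicator (ball x l - E) (h + x) \<partial>lborel)"
      using nn_integral_similarity[OF orthogonal_transformation_id, of 1 "\<lambda>y. ennreal ((w x)\<^sup>2) * indicator (ball x l - E) y" x] by simp
    also have "\<dots> \<le> (\<integral>\<^sup>+h. ?g x h \<partial>lborel)"
      by (rule nn_integral_mono) (auto simp: indicator_def dist_norm E_def w_def add.commute)
    finally show ?thesis .
  qed
  have "ennreal (\<beta> / 2) * ennreal (\<epsilon>\<^sup>2 * \<mu>) \<le> ennreal (\<beta> / 2) * (\<integral>\<^sup>+x. ennreal ((w x)\<^sup>2) \<partial>lborel)"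
  proof (rule mult_left_mono)
    have "ennreal (\<epsilon>\<^sup>2 * \<mu>) = ennreal (\<epsilon>\<^sup>2) * ennreal \<mu>" using pos by (simp add: ennreal_mult)
    also have "\<dots> \<le> ennreal (\<epsilon>\<^sup>2) * emeasure lborel {y. norm (v y) > 2 * \<epsilon>}" by (intro mult_left_mono \<mu>) simp
    also have "\<dots> = (\<integral>\<^sup>+y. ennreal (\<epsilon>\<^sup>2) * indicator {y. norm (v y) > 2 * \<epsilon>} y \<partial>lborel)"
      by (subst nn_integral_cmult) auto
    also have "\<dots> \<le> (\<integral>\<^sup>+x. ennreal ((w x)\<^sup>2) \<partial>lborel)"
    proof (rule nn_integral_mono)
      fix y show "ennreal (\<epsilon>\<^sup>2) * indicator {y. norm (v y) > 2 * \<epsilon>} y \<le> ennreal ((w y)\<^sup>2)"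
        using pos(1) by (auto simp: indicator_def w_def intro!: ennreal_leI power_mono)
    qed
    finally show "ennreal (\<epsilon>\<^sup>2 * \<mu>) \<le> (\<integral>\<^sup>+x. ennreal ((w x)\<^sup>2) \<partial>lborel)" .
  qed simp
  also have "\<dots> = (\<integral>\<^sup>+x. ennreal (\<beta> / 2) * ennreal ((w x)\<^sup>2) \<partial>lborel)" by (rule nn_integral_cmult[symmetric]) measurable
  also have "\<dots> \<le> (\<integral>\<^sup>+x. \<integral>\<^sup>+h. ?g x h \<partial>lborel \<partial>lborel)" by (intro nn_integral_mono low)
  also have "\<dots> = (\<integral>\<^sup>+h. \<integral>\<^sup>+x. ?g x h \<partial>lborel \<partial>lborel)" by (rule lborel_pair.Fubini') measurable
  also have "\<dots> \<le> (\<integral>\<^sup>+h. ennreal (4 * l\<^sup>2) * indicator (ball (0::real^3) l) h \<partial>lborel)"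
  proof (rule nn_integral_mono)
    fix h :: "real^3"
    have "(\<integral>\<^sup>+x. ?g x h \<partial>lborel) = (\<integral>\<^sup>+x. ennreal ((w (x + h) - w x)\<^sup>2) \<partial>lborel) * indicator (ball 0 l) h"
      by (rule nn_integral_multc) measurable
    also have "\<dots> \<le> ennreal (4 * l\<^sup>2) * indicator (ball 0 l) h"
    proof (cases "h \<in> ball 0 l")
      case True
      have "(\<integral>\<^sup>+x. ennreal ((w (x + h) - w x)\<^sup>2) \<partial>lborel) \<le> Np 2 (\<lambda>x. v (x + h) - v x)"
      proof (intro nn_integral_mono ennreal_leI)
        fix x
        have "\<bar>w (x + h) - w x\<bar> \<le> \<bar>norm (v (x + h)) - norm (v x)\<bar>" by (auto simp: w_def max_def)
        also have "\<dots> \<le> norm (v (x + h) - v x)" by (rule norm_triangle_ineq3)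
        finally have "\<bar>w (x + h) - w x\<bar>\<^sup>2 \<le> (norm (v (x + h) - v x))\<^sup>2" by (rule power_mono) simp
        then show "(w (x + h) - w x)\<^sup>2 \<le> (norm (v (x + h) - v x))\<^sup>2" by simp
      qed
      also have "\<dots> \<le> ennreal (4 * (norm h)\<^sup>2) * Np 2 G" by (rule D12_translation_estimate[OF v(1)])
      also have "\<dots> = ennreal (4 * (norm h)\<^sup>2)" by (simp add: Np2_eq_ip[OF D12_L2[OF v(1)]] v(2))
      also have "\<dots> \<le> ennreal (4 * l\<^sup>2)" using True by (intro ennreal_leI mult_left_mono power_mono) auto
      finally show ?thesis by (rule mult_right_mono) simp
    qed simp
    finally show "(\<integral>\<^sup>+x. ?g x h \<partial>lborel) \<le> ennreal (4 * l\<^sup>2) * indicator (ball 0 l) h" .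
  qed
  also have "\<dots> = ennreal (4 * l\<^sup>2) * ennreal \<beta>"
    by (subst nn_integral_cmult) (auto simp: emeasure_ball_vol \<beta>_def)
  finally have "ennreal (\<beta> / 2 * (\<epsilon>\<^sup>2 * \<mu>)) \<le> ennreal (4 * l\<^sup>2 * \<beta>)"
    using \<beta> pos by (simp only: ennreal_mult[symmetric] less_imp_le mult_pos_pos zero_less_power half_gt_zero zero_le_power2 mult_nonneg_nonneg zero_le_numeral)
  then have "\<beta> / 2 * (\<epsilon>\<^sup>2 * \<mu>) \<le> 4 * l\<^sup>2 * \<beta>" using \<beta> by (subst (asm) ennreal_le_iff) auto
  also have "\<dots> = \<beta> / 2 * (8 * l\<^sup>2)" by simp
  also have "\<dots> < \<beta> / 2 * (\<epsilon>\<^sup>2 * \<mu>)" using \<beta> pos(4) by (intro mult_strict_left_mono) auto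
  finally show False by simp
qed

text \<open>The angles j / N lie between 0 and 1, where the cosine is injective, so the N points on
  the circle are distinct and finitely many.\<close>

lemma cis_separated:
  obtains \<delta> where "\<delta> > 0" "\<And>i j. i < N \<Longrightarrow> j < N \<Longrightarrow> i \<noteq> j \<Longrightarrow> \<delta> \<le> norm (cis (real i / real N) - cis (real j / real N))"
proof -
  \<comment> \<open>Inserting 1 keeps the minimum defined and positive when there are no
    pairs.\<close>
  define D where "D = insert 1 ((\<lambda>(i, j). norm (cis (real i / real N) - cis (real j / real N))) ` {(i, j). i < N \<and> j < N \<and> i \<noteq> j})"
  have "{(i, j). i < N \<and> j < N \<and> i \<noteq> j} \<subseteq> {..<N} \<times> {..<N}" by auto
  then have "finite {(i, j). i < N \<and> j < N \<and> i \<noteq> j}" by (rule finite_subset) simp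
  then have fin: "finite D" unfolding D_def by simp
  have ne: "cis (real i / real N) \<noteq> cis (real j / real N)" if "i < N" "j < N" "i \<noteq> j" for i j
  proof
    assume "cis (real i / real N) = cis (real j / real N)"
    from arg_cong[OF this, of Re] have "cos (real i / real N) = cos (real j / real N)" by (simp only: cis.sel)
    moreover have k: "0 \<le> real k / real N" "real k / real N \<le> pi" if "k < N" for k
    proof -
      have "real k / real N \<le> 1" using that by simp
      then show "real k / real N \<le> pi" using pi_gt3 by linarith
    qed simp
    ultimately have "real i / real N = real j / real N"
      using cos_inj_pi[OF k[OF that(1)] k[OF that(2)]] by blast
    then show False using that by (simp only: divide_cancel_right) simp
  qed
  have "Min D > 0" using fin ne by (subst Min_gr_iff) (auto simp: D_def)
  moreover have "Min D \<le> norm (cis (real i / real N) - cis (real j / real N))" if "i < N" "j < N" "i \<noteq> j" for i j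
    using that fin by (intro Min_le) (auto simp: D_def)
  ultimately show ?thesis by (rule that)
qed

text \<open>Far from the axis, N rotated copies of the ball are disjoint, and by symmetry each
  contains the measure \<kappa> of E; for N \<kappa> > Q this is more than E has. \<open>R\<close>
  must be the same for all E and x, hence the quantifiers inside the conclusion.\<close>

lemma rotation_invariant_concentration:
  assumes "\<kappa> > 0" "l > 0"
  obtains R where "\<forall>E x. E \<in> sets borel \<longrightarrow> (\<forall>\<alpha>. AE y in lborel. rotz \<alpha> y \<in> E \<longleftrightarrow> y \<in> E) \<longrightarrow>
    emeasure lborel E \<le> ennreal Q \<longrightarrow> ennreal \<kappa> \<le> emeasure lborel (E \<inter> ball x l) \<longrightarrow> sqrt ((x $ 1)\<^sup>2 + (x $ 2)\<^sup>2) \<le> R"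
proof -
  obtain N :: nat where N: "max 0 Q < real N * \<kappa>" using reals_Archimedean3[OF \<open>\<kappa> > 0\<close>] by blast
  obtain \<delta> where \<delta>: "\<delta> > 0" "\<And>i j. i < N \<Longrightarrow> j < N \<Longrightarrow> i \<noteq> j \<Longrightarrow> \<delta> \<le> norm (cis (real i / real N) - cis (real j / real N))"
    by (rule cis_separated[of N]) blast
  have "sqrt ((x $ 1)\<^sup>2 + (x $ 2)\<^sup>2) \<le> 2 * l / \<delta>"
    if [measurable]: "E \<in> sets borel" and inv: "\<And>\<alpha>. AE y in lborel. rotz \<alpha> y \<in> E \<longleftrightarrow> y \<in> E"
      and Q: "emeasure lborel E \<le> ennreal Q" and \<kappa>: "ennreal \<kappa> \<le> emeasure lborel (E \<inter> ball x l)" for E x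
  proof (rule ccontr)
    let ?r = "sqrt ((x $ 1)\<^sup>2 + (x $ 2)\<^sup>2)"
    assume "\<not> ?r \<le> 2 * l / \<delta>"
    then have r: "2 * l < ?r * \<delta>" using \<delta>(1) by (simp add: field_simps)
    define x' where "x' j = rotz (real j / real N) x" for j
    define B where "B j = E \<inter> ball (x' j) l" for j
    have disj: "disjoint_family_on B {..<N}"
      unfolding disjoint_family_on_def
    proof (intro ballI impI)
      fix i j assume ij: "i \<in> {..<N}" "j \<in> {..<N}" "i \<noteq> j"
      have "?r * \<delta> \<le> norm (x' i - x' j)" unfolding x'_def norm_rotz_diff using \<delta>(2) ij by (intro mult_left_mono) auto
      then have "2 * l < dist (x' i) (x' j)" using r by (simp add: dist_norm)
      show "B i \<inter> B j = {}"
      proof (rule equals0I)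
        fix y assume "y \<in> B i \<inter> B j"
        then have "dist (x' i) y < l" "dist (x' j) y < l" by (auto simp: B_def)
        with \<open>2 * l < dist (x' i) (x' j)\<close> dist_triangle2[of "x' i" "x' j" y] show False by linarith
      qed
    qed
    have eq: "emeasure lborel (B j) = emeasure lborel (E \<inter> ball x l)" for j
    proof -
      let ?A = "rotz (real j / real N)"
      have A: "orthogonal_transformation ?A" by (rule orthogonal_rotz)
      note [measurable] = orthogonal_transformation_measurable[OF A]
      have Am: "B j \<in> sets borel" unfolding B_def by measurable
      have "emeasure lborel (B j) = (\<integral>\<^sup>+y. indicator (B j) y \<partial>lborel)" using Am by simp
      also have "\<dots> = (\<integral>\<^sup>+y. indicator (B j) (?A y) \<partial>lborel)"
        using nn_integral_similarity[OF A, of 1 "indicator (B j)" 0] Am by simp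
      also have "\<dots> = (\<integral>\<^sup>+y. indicator (E \<inter> ball x l) y \<partial>lborel)"
      proof (rule nn_integral_cong_AE, rule AE_mp[OF inv[of "real j / real N"]], intro AE_I2 impI)
        fix y assume "?A y \<in> E \<longleftrightarrow> y \<in> E"
        moreover have "dist (x' j) (?A y) = dist x y"
          unfolding x'_def dist_norm using A by (simp add: orthogonal_transformation_norm linear_diff[OF orthogonal_transformation_linear[OF A], symmetric])
        ultimately show "indicator (B j) (?A y) = (indicator (E \<inter> ball x l) y :: ennreal)"
          by (auto simp: indicator_def B_def)
      qed
      finally show ?thesis by simp
    qed
    have "ennreal (real N * \<kappa>) = (\<Sum>j<N. ennreal \<kappa>)" using \<open>\<kappa> > 0\<close> by (simp add: ennreal_mult ennreal_of_nat_eq_real_of_nat)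
    also have "\<dots> \<le> (\<Sum>j<N. emeasure lborel (B j))" by (intro sum_mono) (simp add: eq \<kappa>)
    also have "\<dots> = emeasure lborel (\<Union>j<N. B j)"
      by (rule sum_emeasure[OF _ disj]) (auto simp: B_def)
    also have "\<dots> \<le> emeasure lborel E" by (rule emeasure_mono) (auto simp: B_def)
    also have "\<dots> \<le> ennreal (max 0 Q)" by (rule order_trans[OF Q]) (intro ennreal_leI max.cobounded2)
    finally show False using N by (subst (asm) ennreal_le_iff) auto
  qed
  note * = this
  show ?thesis by (rule that, intro allI impI, rule *) auto
qed

text \<open>Fixing the axis makes invariance stable under translations along it, which recentre the
  maximising sequence; containing every rotation, with whatever phase, forces concentration near the
  axis.\<close>

definition axial :: "symmetries \<Rightarrow> bool" where
  "axial \<Gamma> \<longleftrightarrow> isometries \<Gamma> \<and> (\<forall>(L, A)\<in>\<Gamma>. A (axis 3 1) = axis 3 1) \<and> (\<forall>\<alpha>. \<exists>L. (L, rotz \<alpha>) \<in> \<Gamma>)"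

lemma integral_scale:
  fixes g :: "real^3 \<Rightarrow> real"
  assumes "\<sigma> > 0" "g \<in> borel_measurable borel"
  shows "(\<integral>x. g (\<sigma> *\<^sub>R x + a) \<partial>lborel) = (\<integral>x. g x \<partial>lborel) / \<sigma> ^ 3"
  using integral_similarity[OF orthogonal_transformation_id assms, of a] by (simp add: divide_inverse mult.commute)

lemma D12_scale:
  assumes "has_D12_gradient w W" "\<sigma> > 0"
  shows "has_D12_gradient (\<lambda>x. w (\<sigma> *\<^sub>R x + a)) (\<lambda>x. \<sigma> *\<^sub>R W (\<sigma> *\<^sub>R x + a))"
  using D12_similarity[OF assms(1) linear_id orthogonal_transformation_id assms(2), of a] by (simp add: pull_id id_def)

lemma ip_scale:
  assumes "L2 W" "\<sigma> > 0"
  shows "ip (\<lambda>x. \<sigma> *\<^sub>R W (\<sigma> *\<^sub>R x + a)) (\<lambda>x. \<sigma> *\<^sub>R W (\<sigma> *\<^sub>R x + a)) = ip W W / \<sigma>"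
proof -
  note [measurable] = L2_measurable[OF assms(1)]
  have "ip (\<lambda>x. \<sigma> *\<^sub>R W (\<sigma> *\<^sub>R x + a)) (\<lambda>x. \<sigma> *\<^sub>R W (\<sigma> *\<^sub>R x + a)) = (\<integral>x. \<sigma>\<^sup>2 * (W (\<sigma> *\<^sub>R x + a) \<bullet> W (\<sigma> *\<^sub>R x + a)) \<partial>lborel)"
    by (simp add: power2_eq_square mult.assoc)
  also have "\<dots> = \<sigma>\<^sup>2 * (ip W W / \<sigma> ^ 3)" using integral_scale[OF assms(2), of "\<lambda>x. W x \<bullet> W x" a] by simp
  also have "\<dots> = ip W W / \<sigma>" using assms(2) by (simp add: eval_nat_numeral)
  finally show ?thesis .
qed

lemma cube_split:
  fixes \<tau> :: real
  assumes "1 \<le> \<tau> ^ 3 + (1 - \<tau>) ^ 3" "0 < \<tau>" "\<tau> \<le> 1" shows "\<tau> = 1"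
proof (rule ccontr)
  assume "\<tau> \<noteq> 1"
  then have "0 < 3 * (\<tau> * (1 - \<tau>))" using assms by (intro mult_pos_pos) auto
  moreover have "\<tau> ^ 3 + (1 - \<tau>) ^ 3 = 1 - 3 * (\<tau> * (1 - \<tau>))"
    by (simp only: power3_eq_cube) algebra
  ultimately show False using assms(1) by simp
qed

context nonlinearity
begin

lemma F_scale:
  assumes "w \<in> borel_measurable borel" "\<sigma> > 0"
  shows "F (\<lambda>x. w (\<sigma> *\<^sub>R x + a)) = F w / \<sigma> ^ 3"
  using integral_scale[OF assms(2), of "\<lambda>x. f (w x)" a] assms(1) by simp

text \<open>Off the band of moduli between \<open>\<epsilon>0\<close> and \<open>K\<close> the
  integrand is at most S / 2^26 times |v|^6, and \<open>Np 6 v \<le> 2 ^ 24\<close> limits this to S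
  / 4. The band must supply another S / 4 at height at most c K^6, which gives \<mu>. The level is
  called 2 \<epsilon> to leave room for a truncation at \<epsilon>.\<close>

lemma F_large_superlevel:
  assumes "S > 0"
  obtains \<epsilon> \<mu> where "\<epsilon> > 0" "\<mu> > 0"
    "\<And>v G. has_D12_gradient v G \<Longrightarrow> ip G G = 1 \<Longrightarrow> F v \<ge> S / 2 \<Longrightarrow> ennreal \<mu> \<le> emeasure lborel {y. norm (v y) > 2 * \<epsilon>}"
proof -
  have "S / 2 ^ 26 > 0" using assms by simp
  then obtain \<epsilon>0 K where K: "\<epsilon>0 > 0" "K > 0" "\<And>\<xi>. norm \<xi> \<le> \<epsilon>0 \<or> norm \<xi> \<ge> K \<Longrightarrow> \<bar>f \<xi>\<bar> \<le> S / 2 ^ 26 * norm \<xi> ^ 6"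
    by (rule f_small_off_compact) blast
  define \<mu> where "\<mu> = S / (4 * (c * K ^ 6))"
  have "\<mu> > 0" using assms c K by (simp add: \<mu>_def)
  moreover have "ennreal \<mu> \<le> emeasure lborel {y. norm (v y) > \<epsilon>0}"
    if v: "has_D12_gradient v G" and G: "ip G G = 1" and F: "F v \<ge> S / 2" for v G
  proof -
    note [measurable] = D12_measurable[OF v]
    define E where "E = {y. norm (v y) > \<epsilon>0}"
    have [measurable]: "E \<in> sets borel" unfolding E_def by measurable
    have v6: "Np 6 v \<le> ennreal (2 ^ 24)"
      using D12_Sobolev[OF v] by (simp add: Np2_eq_ip[OF D12_L2[OF v]] G)
    have fin: "emeasure lborel E < \<infinity>"
      using superlevel_emeasure_le[OF D12_measurable(1)[OF v] K(1) v6] unfolding E_def by (auto intro: le_less_trans)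
    have i6: "integrable lborel (\<lambda>x. norm (v x) ^ 6)" by (intro integrable_norm6 D12_measurable[OF v] D12_Np6_finite[OF v])
    have iE: "integrable lborel (indicator E :: _ \<Rightarrow> real)" using fin by (intro integrable_real_indicator) auto
    have "F v \<le> (\<integral>x. S / 2 ^ 26 * norm (v x) ^ 6 + c * K ^ 6 * indicator E x \<partial>lborel)"
    proof (rule integral_mono)
      show "integrable lborel (\<lambda>x. f (v x))" by (intro integrable_f D12_measurable[OF v] D12_Np6_finite[OF v])
      show "integrable lborel (\<lambda>x. S / 2 ^ 26 * norm (v x) ^ 6 + c * K ^ 6 * indicator E x)" using i6 iE by simp
      fix x
      show "f (v x) \<le> S / 2 ^ 26 * norm (v x) ^ 6 + c * K ^ 6 * indicator E x"
      proof (cases "norm (v x) \<le> \<epsilon>0 \<or> norm (v x) \<ge> K")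
        case True
        have "0 \<le> c * K ^ 6 * indicator E x" using c K by simp
        then show ?thesis using K(3)[OF True] by linarith
      next
        case False
        then have "c * norm (v x) ^ 6 \<le> c * K ^ 6" using c by (intro mult_left_mono power_mono) auto
        moreover have "0 \<le> S / 2 ^ 26 * norm (v x) ^ 6" using assms by simp
        moreover have "indicator E x = (1::real)" using False by (simp add: E_def)
        ultimately show ?thesis using f_bound[of "v x"] by simp
      qed
    qed
    also have "\<dots> = S / 2 ^ 26 * (\<integral>x. norm (v x) ^ 6 \<partial>lborel) + c * K ^ 6 * measure lborel E" using i6 iE by simp
    also have "\<dots> \<le> S / 2 ^ 26 * 2 ^ 24 + c * K ^ 6 * measure lborel E"
    proof (intro add_right_mono mult_left_mono)
      have "ennreal (\<integral>x. norm (v x) ^ 6 \<partial>lborel) \<le> ennreal (2 ^ 24)" using v6 nn_integral_eq_integral[OF i6] by simp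
      then show "(\<integral>x. norm (v x) ^ 6 \<partial>lborel) \<le> 2 ^ 24" by (subst (asm) ennreal_le_iff) auto
    qed (use assms in simp)
    finally have "S / 4 \<le> c * K ^ 6 * measure lborel E" using F by simp
    then have "\<mu> \<le> measure lborel E" using c K by (simp add: \<mu>_def field_simps)
    then show ?thesis using fin unfolding E_def[symmetric] by (subst emeasure_eq_ennreal_measure) (auto intro!: ennreal_leI)
  qed
  ultimately show ?thesis using that[of "\<epsilon>0 / 2" \<mu>] K(1) by simp
qed

text \<open>Sets of fixed measure sit in a ball of radius l whose centre is within R of the axis.
  The ball of radius R + l around the foot of that centre contains it, and an axial shift moves the
  foot to the origin.\<close>

lemma invariant_concentration:
  assumes \<Gamma>: "axial \<Gamma>" and "S > 0"
  obtains \<epsilon> \<kappa> \<rho> where "\<epsilon> > 0" "\<kappa> > 0"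
    "\<And>v G. has_D12_gradient v G \<Longrightarrow> invariant \<Gamma> v \<Longrightarrow> ip G G = 1 \<Longrightarrow> F v \<ge> S / 2 \<Longrightarrow>
      \<exists>s. ennreal \<kappa> \<le> emeasure lborel ({y. norm (v (y + s *\<^sub>R axis 3 1)) > \<epsilon>} \<inter> ball 0 \<rho>)"
proof -
  obtain \<epsilon> \<mu> where \<epsilon>: "\<epsilon> > 0" "\<mu> > 0"
    "\<And>v G. has_D12_gradient v G \<Longrightarrow> ip G G = 1 \<Longrightarrow> F v \<ge> S / 2 \<Longrightarrow> ennreal \<mu> \<le> emeasure lborel {y. norm (v y) > 2 * \<epsilon>}"
    by (rule F_large_superlevel[OF \<open>S > 0\<close>]) blast
  \<comment> \<open>With this choice \<open>8 * l\<^sup>2\<close> is half of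
    \<open>\<epsilon>\<^sup>2 * \<mu>\<close>.\<close>
  define l where "l = sqrt (\<epsilon>\<^sup>2 * \<mu>) / 4"
  have l: "l > 0" "8 * l\<^sup>2 < \<epsilon>\<^sup>2 * \<mu>" using \<epsilon> by (simp_all add: l_def power_divide)
  define \<kappa> where "\<kappa> = ball_vol l / 2"
  have \<kappa>: "\<kappa> > 0" using ball_vol_pos[OF l(1)] by (simp add: \<kappa>_def)
  obtain R where R: "\<forall>E x. E \<in> sets borel \<longrightarrow> (\<forall>\<alpha>. AE y in lborel. rotz \<alpha> y \<in> E \<longleftrightarrow> y \<in> E) \<longrightarrow>
    emeasure lborel E \<le> ennreal (2 ^ 24 / \<epsilon> ^ 6) \<longrightarrow> ennreal \<kappa> \<le> emeasure lborel (E \<inter> ball x l) \<longrightarrow> sqrt ((x $ 1)\<^sup>2 + (x $ 2)\<^sup>2) \<le> R"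
    by (rule rotation_invariant_concentration[OF \<kappa> l(1)])
  have "\<exists>s. ennreal \<kappa> \<le> emeasure lborel ({y. norm (v (y + s *\<^sub>R axis 3 1)) > \<epsilon>} \<inter> ball 0 (R + l))"
    if v: "has_D12_gradient v G" and inv: "invariant \<Gamma> v" and G: "ip G G = 1" and F: "F v \<ge> S / 2" for v G
  proof -
    note [measurable] = D12_measurable[OF v]
    define E where "E = {y. norm (v y) > \<epsilon>}"
    have [measurable]: "E \<in> sets borel" unfolding E_def by measurable
    obtain x where x: "ennreal \<kappa> \<le> emeasure lborel (E \<inter> ball x l)"
      using superlevel_concentration[OF v G \<epsilon>(1,2) l \<epsilon>(3)[OF v G F]] unfolding E_def \<kappa>_def by blast
    have v6: "Np 6 v \<le> ennreal (2 ^ 24)"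
      using D12_Sobolev[OF v] by (simp add: Np2_eq_ip[OF D12_L2[OF v]] G)
    have r: "sqrt ((x $ 1)\<^sup>2 + (x $ 2)\<^sup>2) \<le> R"
    proof (rule R[rule_format, OF _ _ _ x])
      show "emeasure lborel E \<le> ennreal (2 ^ 24 / \<epsilon> ^ 6)"
        unfolding E_def by (rule superlevel_emeasure_le[OF D12_measurable(1)[OF v] \<epsilon>(1) v6]) simp
      fix \<alpha>
      obtain L where L: "(L, rotz \<alpha>) \<in> \<Gamma>" using \<Gamma> by (auto simp: axial_def)
      then have n: "norm (L z) = norm z" for z
        using \<Gamma> isometriesD(1)[of \<Gamma> L "rotz \<alpha>"] by (simp add: axial_def orthogonal_transformation_norm)
      from invariantD[OF inv L] show "AE y in lborel. rotz \<alpha> y \<in> E \<longleftrightarrow> y \<in> E"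
      proof eventually_elim
        case (elim y)
        have "norm (v (rotz \<alpha> y)) = norm (v y)" using n[of "v (rotz \<alpha> y)"] elim by simp
        then show ?case by (simp add: E_def)
      qed
    qed measurable
    define a :: "real^3" where "a = (x $ 3) *\<^sub>R axis 3 1"
    have "norm (x - a) = sqrt ((x $ 1)\<^sup>2 + (x $ 2)\<^sup>2)" by (simp add: norm_vec3 a_def axis_def)
    then have xa: "norm (x - a) \<le> R" using r by simp
    have "ennreal \<kappa> \<le> emeasure lborel (E \<inter> ball a (R + l))"
    proof (rule order_trans[OF x], rule emeasure_mono)
      show "E \<inter> ball x l \<subseteq> E \<inter> ball a (R + l)"
      proof clarify
        fix y assume "y \<in> ball x l"
        then have "dist x y < l" by simp
        moreover have "dist a x \<le> R" using xa by (simp add: dist_norm norm_minus_commute)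
        ultimately show "y \<in> ball a (R + l)" using dist_triangle[of a y x] by simp
      qed
    qed measurable
    also have "\<dots> = (\<integral>\<^sup>+y. indicator (E \<inter> ball a (R + l)) y \<partial>lborel)" by simp
    also have "\<dots> = (\<integral>\<^sup>+y. indicator (E \<inter> ball a (R + l)) (y + a) \<partial>lborel)"
      using nn_integral_similarity[OF orthogonal_transformation_id, of 1 "indicator (E \<inter> ball a (R + l))" a] by simp
    also have "\<dots> = (\<integral>\<^sup>+y. indicator ({y. norm (v (y + a)) > \<epsilon>} \<inter> ball 0 (R + l)) y \<partial>lborel)"
      by (intro nn_integral_cong) (auto simp: indicator_def E_def dist_norm)
    also have "\<dots> = emeasure lborel ({y. norm (v (y + a)) > \<epsilon>} \<inter> ball 0 (R + l))"
      by (intro nn_integral_indicator) measurable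
    finally show ?thesis unfolding a_def by blast
  qed
  with \<epsilon>(1) \<kappa> show ?thesis by (rule that)
qed

theorem maximiser_exists:
  assumes \<Gamma>: "axial \<Gamma>" and w0: "has_D12_gradient w0 W0" "invariant \<Gamma> w0" "F w0 > 0"
  obtains S v G where "maximiser \<Gamma> S v G"
proof -
  have iso: "isometries \<Gamma>" using \<Gamma> by (simp add: axial_def)
  define Adm where "Adm = {F w |w W. has_D12_gradient w W \<and> invariant \<Gamma> w \<and> ip W W = 1}"
  \<comment> \<open>Dilation by the energy itself normalises the energy to 1 and divides
    \<open>F\<close> by its cube, so every quotient is also a value of \<open>F\<close> at energy
    1.\<close>
  have norm_in: "F w / (ip W W) ^ 3 \<in> Adm" if w: "has_D12_gradient w W" "invariant \<Gamma> w" "ip W W > 0" for w W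
  proof -
    have "invariant \<Gamma> (\<lambda>x. w (ip W W *\<^sub>R x + 0))"
      by (rule invariant_similarity[OF iso w(2,3)]) (simp add: linear_0[OF isometriesD(4)[OF iso]])
    then show ?thesis using D12_scale[OF w(1,3), of 0] ip_scale[OF D12_L2[OF w(1)] w(3), of 0]
        F_scale[OF D12_measurable(1)[OF w(1)] w(3), of 0] w(3) unfolding Adm_def by force
  qed
  have Np6: "Np 6 w \<le> ennreal (2 ^ 24)" if "has_D12_gradient w W" "ip W W = 1" for w W
    using D12_Sobolev[OF that(1)] by (simp add: Np2_eq_ip[OF D12_L2[OF that(1)]] that(2))
  have bdd: "bdd_above Adm"
  proof (rule bdd_aboveI)
    fix y assume "y \<in> Adm"
    then obtain w W where w: "y = F w" "has_D12_gradient w W" "ip W W = 1" by (auto simp: Adm_def)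
    show "y \<le> c * 2 ^ 24" unfolding w(1) by (rule F_le[OF D12_measurable(1)[OF w(2)] Np6[OF w(2,3)]]) simp
  qed
  have zero: "F w = 0" if "has_D12_gradient w W" "ip W W = 0" for w W
    using F_zero[OF D12_zero_energy[OF that]] D12_measurable[OF that(1)] by simp
  have pos0: "ip W0 W0 > 0" by (rule le_neq_trans[OF ip_nonneg]) (use zero[OF w0(1)] w0(3) in auto)
  define S where "S = Sup Adm"
  have le: "F w \<le> S * (ip W W) ^ 3" if w: "has_D12_gradient w W" "invariant \<Gamma> w" for w W
  proof (cases "ip W W = 0")
    case False
    have p: "ip W W > 0" by (rule le_neq_trans[OF ip_nonneg]) (use False in auto)
    have "F w / (ip W W) ^ 3 \<le> S" unfolding S_def by (rule cSup_upper[OF norm_in[OF w p] bdd])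
    then show ?thesis using p by (simp add: divide_le_eq)
  qed (use zero[OF w(1)] in simp)
  have S: "S > 0"
  proof -
    have "0 < F w0 / (ip W0 W0) ^ 3" using w0(3) pos0 by simp
    also have "\<dots> \<le> S" unfolding S_def by (rule cSup_upper[OF norm_in[OF w0(1,2) pos0] bdd])
    finally show ?thesis .
  qed
  obtain \<epsilon> \<kappa> \<rho> where \<epsilon>: "\<epsilon> > 0" "\<kappa> > 0"
    and conc: "\<And>v G. has_D12_gradient v G \<Longrightarrow> invariant \<Gamma> v \<Longrightarrow> ip G G = 1 \<Longrightarrow> F v \<ge> S / 2 \<Longrightarrow>
      \<exists>s. ennreal \<kappa> \<le> emeasure lborel ({y. norm (v (y + s *\<^sub>R axis 3 1)) > \<epsilon>} \<inter> ball 0 \<rho>)"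
    by (rule invariant_concentration[OF \<Gamma> S]) blast
  \<comment> \<open>The slack never exceeds \<open>S / 2\<close>, so each member meets the threshold
    \<open>S / 2\<close> of the concentration result. The shift along the axis is already included,
    so the mass sits in one fixed ball.\<close>
  define good where "good k p \<longleftrightarrow> has_D12_gradient (fst p) (snd p) \<and> invariant \<Gamma> (fst p) \<and> ip (snd p) (snd p) = 1 \<and>
    S - S / 2 * (1 / Suc k) < F (fst p) \<and> ennreal \<kappa> \<le> emeasure lborel ({y. norm (fst p y) > \<epsilon>} \<inter> ball 0 \<rho>)" for k and p :: "(real^3 \<Rightarrow> complex) \<times> (real^3 \<Rightarrow> complex^3)"
  have "\<forall>k. \<exists>p. good k p"
  proof
    fix k
    have ne: "Adm \<noteq> {}" using norm_in[OF w0(1,2) pos0] by blast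
    have "S / 2 * (1 / Suc k) > 0" using S by simp
    then have "S - S / 2 * (1 / Suc k) < Sup Adm" unfolding S_def[symmetric] by linarith
    then obtain w W where w: "has_D12_gradient w W" "invariant \<Gamma> w" "ip W W = 1" "S - S / 2 * (1 / Suc k) < F w"
      by (subst (asm) less_cSup_iff[OF ne bdd]) (auto simp: Adm_def)
    have "S / 2 * (1 / Suc k) \<le> S / 2 * 1" using S by (intro mult_left_mono) auto
    then have "F w \<ge> S / 2" using w(4) by linarith
    from conc[OF w(1-3) this] obtain s where s: "ennreal \<kappa> \<le> emeasure lborel ({y. norm (w (y + s *\<^sub>R axis 3 1)) > \<epsilon>} \<inter> ball 0 \<rho>)" by blast
    let ?a = "s *\<^sub>R axis 3 1 :: real^3"
    have "invariant \<Gamma> (\<lambda>x. w (1 *\<^sub>R x + ?a))"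
    proof (rule invariant_similarity[OF iso w(2)])
      fix L A assume g: "(L, A) \<in> \<Gamma>"
      then show "A ?a = ?a" using \<Gamma> linear_cmul[OF isometriesD(4)[OF iso g]] by (auto simp: axial_def)
    qed simp
    then have "good k (\<lambda>x. w (1 *\<^sub>R x + ?a), \<lambda>x. 1 *\<^sub>R W (1 *\<^sub>R x + ?a))"
      using D12_scale[OF w(1), of 1 ?a] ip_scale[OF D12_L2[OF w(1)], of 1 ?a]
        F_scale[OF D12_measurable(1)[OF w(1)], of 1 ?a] w s by (simp add: good_def)
    then show "\<exists>p. good k p" by blast
  qed
  from choice[OF this] obtain p where p: "\<And>k. good k (p k)" by blast
  define V where "V k = fst (p k)" for k
  define W where "W k = snd (p k)" for k
  have V: "has_D12_gradient (V k) (W k)" "invariant \<Gamma> (V k)" "ip (W k) (W k) = 1" "S - S / 2 * (1 / Suc k) < F (V k)"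
    and mass: "ennreal \<kappa> \<le> emeasure lborel ({y. norm (V k y) > \<epsilon>} \<inter> ball 0 \<rho>)" for k
    using p[of k] by (auto simp: V_def W_def good_def)
  have W1: "Np 2 (W k) \<le> ennreal 1" for k by (simp add: Np2_eq_ip[OF D12_L2[OF V(1)]] V(3))
  obtain r :: "nat \<Rightarrow> nat" and v G where r: "strict_mono r" and v: "has_D12_gradient v G"
    and AE: "AE x in lborel. (\<lambda>k. V (r k) x) \<longlonglongrightarrow> v x"
    and liminf: "\<And>e. e > 0 \<Longrightarrow> \<forall>\<^sub>F k in sequentially. ip G G - e \<le> ip G (W (r k))"
    by (rule D12_compact[where V=V and W=W, OF V(1) W1]) auto
  note [measurable] = D12_measurable[OF v] D12_measurable[OF V(1)]
  have inv: "invariant \<Gamma> v" by (rule invariant_limit[OF iso V(2) AE])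
  \<comment> \<open>Were the limit 0, dominated convergence on the fixed ball would send the
    measures of the superlevel sets to 0, although they stay above \<kappa>.\<close>
  have nz: "\<not> (AE x in lborel. v x = 0)"
  proof
    assume z: "AE x in lborel. v x = 0"
    define E where "E k = {y. norm (V (r k) y) > \<epsilon>} \<inter> ball 0 \<rho>" for k
    have [measurable]: "E k \<in> sets borel" for k unfolding E_def by measurable
    have "(\<lambda>k. \<integral>\<^sup>+y. indicator (E k) y \<partial>lborel) \<longlonglongrightarrow> (\<integral>\<^sup>+y. 0 \<partial>(lborel :: (real^3) measure))"
    proof (rule nn_integral_dominated_convergence[where w="indicator (ball 0 \<rho>)"])
      show "AE y in lborel. (\<lambda>k. indicator (E k) y :: ennreal) \<longlonglongrightarrow> 0"
        using AE z
      proof eventually_elim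
        case (elim y)
        then have "(\<lambda>k. norm (V (r k) y)) \<longlonglongrightarrow> 0" by (simp add: tendsto_norm_zero_iff)
        then have "\<forall>\<^sub>F k in sequentially. norm (V (r k) y) < \<epsilon>" using \<epsilon>(1) by (rule order_tendstoD)
        then have "\<forall>\<^sub>F k in sequentially. indicator (E k) y = (0 :: ennreal)" by (rule eventually_mono) (simp add: E_def)
        then show ?case by (rule tendsto_eventually)
      qed
      show "(\<integral>\<^sup>+y. indicator (ball 0 \<rho>) y \<partial>(lborel :: (real^3) measure)) < \<infinity>" by (simp add: emeasure_ball_vol)
    qed (auto simp: E_def indicator_def)
    then have "(\<lambda>k. emeasure lborel (E k)) \<longlonglongrightarrow> 0" by simp
    moreover have "\<forall>k. ennreal \<kappa> \<le> emeasure lborel (E k)" using mass by (simp add: E_def)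
    ultimately have "ennreal \<kappa> \<le> 0" by (intro LIMSEQ_le_const) auto
    then show False using \<epsilon>(2) by simp
  qed
  define \<tau> where "\<tau> = ip G G"
  have \<tau>: "\<tau> > 0" unfolding \<tau>_def by (rule le_neq_trans[OF ip_nonneg]) (use nz D12_zero_energy[OF v] in auto)
  have FV: "(\<lambda>k. F (V (r k))) \<longlonglongrightarrow> S"
  proof (rule tendsto_sandwich)
    have "(\<lambda>k. S - S / 2 * (1 / Suc k)) \<longlonglongrightarrow> S - S / 2 * 0" by (intro tendsto_intros LIMSEQ_Suc[OF lim_1_over_n])
    then show "(\<lambda>k. S - S / 2 * (1 / Suc k)) \<longlonglongrightarrow> S" by simp
    show "\<forall>\<^sub>F k in sequentially. S - S / 2 * (1 / Suc k) \<le> F (V (r k))"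
    proof (intro always_eventually allI)
      fix k
      have "1 / real (Suc (r k)) \<le> 1 / real (Suc k)"
        using strict_mono_imp_increasing[OF r, of k] by (intro divide_left_mono) auto
      then have "S / 2 * (1 / real (Suc (r k))) \<le> S / 2 * (1 / real (Suc k))" using S by (intro mult_left_mono) auto
      then show "S - S / 2 * (1 / real (Suc k)) \<le> F (V (r k))" using V(4)[of "r k"] by linarith
    qed
    show "\<forall>\<^sub>F k in sequentially. F (V (r k)) \<le> S" using le[OF V(1,2)] V(3) by simp
  qed simp
  have "(\<lambda>k. F (V (r k)) - F (\<lambda>x. V (r k) x - v x)) \<longlonglongrightarrow> F v"
    by (rule F_Brezis_Lieb[where S="2 ^ 24", OF _ _ Np6[OF V(1,3)] _ AE]) auto
  from tendsto_diff[OF FV this] have FD: "(\<lambda>k. F (\<lambda>x. V (r k) x - v x)) \<longlonglongrightarrow> S - F v" by simp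
  \<comment> \<open>The one-sided weak limit makes the energy of \<open>V (r k) - v\<close>
    eventually at most \<open>1 - \<tau> + 2 * e\<close>; the definition of \<open>S\<close> is then
    applied to this remainder, which is again invariant.\<close>
  have key: "0 \<le> 1 - \<tau> + 2 * e \<and> S - F v \<le> S * (1 - \<tau> + 2 * e) ^ 3" if e: "e > 0" for e
  proof -
    have ev: "\<forall>\<^sub>F k in sequentially. 0 \<le> 1 - \<tau> + 2 * e \<and> F (\<lambda>x. V (r k) x - v x) \<le> S * (1 - \<tau> + 2 * e) ^ 3"
      using liminf[OF e]
    proof eventually_elim
      case (elim k)
      let ?D = "\<lambda>x. 1 *\<^sub>R W (r k) x + (-1) *\<^sub>R G x"
      have D: "has_D12_gradient (\<lambda>x. 1 *\<^sub>R V (r k) x + (-1) *\<^sub>R v x) ?D" by (rule D12_lincomb[OF V(1) v])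
      have "ip ?D ?D = 1 - 2 * ip G (W (r k)) + \<tau>"
        unfolding ip_quadratic[OF D12_L2[OF V(1)] D12_L2[OF v]] ip_commute[of "W (r k)" G] V(3) \<tau>_def by simp
      moreover have "\<tau> - e \<le> ip G (W (r k))" using elim by (simp only: \<tau>_def)
      ultimately have d2: "ip ?D ?D \<le> 1 - \<tau> + 2 * e" by argo
      have d1: "0 \<le> ip ?D ?D" by (rule ip_nonneg)
      have "F (\<lambda>x. 1 *\<^sub>R V (r k) x + (-1) *\<^sub>R v x) \<le> S * (ip ?D ?D) ^ 3"
        by (rule le[OF D invariant_lincomb[OF iso V(2) inv]])
      also have "\<dots> \<le> S * (1 - \<tau> + 2 * e) ^ 3" using S by (intro mult_left_mono power_mono d1 d2) auto
      finally show ?case using order_trans[OF d1 d2] by simp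
    qed
    then have "0 \<le> 1 - \<tau> + 2 * e" using eventually_happens[OF ev] by auto
    moreover have "S - F v \<le> S * (1 - \<tau> + 2 * e) ^ 3"
      by (rule tendsto_upperbound[OF FD]) (use ev in \<open>auto elim: eventually_mono\<close>)
    ultimately show ?thesis ..
  qed
  have lim0: "(\<lambda>k. 1 - \<tau> + 2 * (1 / real (Suc k))) \<longlonglongrightarrow> 1 - \<tau> + 2 * 0" by (intro tendsto_intros LIMSEQ_Suc[OF lim_1_over_n])
  have kpos: "1 / real (Suc k) > 0" for k by simp
  have "0 \<le> 1 - \<tau> + 2 * 0" by (rule LIMSEQ_le_const[OF lim0]) (use key[OF kpos] in blast)
  then have \<tau>1: "\<tau> \<le> 1" by simp
  have "S - F v \<le> S * (1 - \<tau> + 2 * 0) ^ 3"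
    by (rule LIMSEQ_le_const[OF tendsto_mult_left[OF tendsto_power[OF lim0]]]) (use key[OF kpos] in blast)
  then have Fl: "S - F v \<le> S * (1 - \<tau>) ^ 3" by simp
  have Fu: "F v \<le> S * \<tau> ^ 3" using le[OF v inv] by (simp add: \<tau>_def)
  have "S * 1 \<le> S * (\<tau> ^ 3 + (1 - \<tau>) ^ 3)" using Fl Fu by (simp add: distrib_left)
  then have "\<tau> = 1" using S \<tau> \<tau>1 by (intro cube_split) auto
  then have "maximiser \<Gamma> S v G" unfolding maximiser_def using v inv S le Fl Fu by (auto simp: \<tau>_def)
  then show ?thesis by (rule that)
qed

end

section \<open>An admissible test function\<close>

text \<open>Differentiating exp (-1/t) produces powers of 1/t; with these included the family is
  closed under differentiation up to linear combinations.\<close>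

definition flat_exp :: "nat \<Rightarrow> real \<Rightarrow> real" where
  "flat_exp m t = (if t > 0 then (1 / t) ^ m * exp (- (1 / t)) else 0)"

text \<open>From exp s >= (1 + s / n)^n with s = 1 / t and n = m + 2. The 2 in n supplies the
  quadratic decay, which makes the derivative at 0 exist and vanish.\<close>

lemma flat_exp_le: "\<bar>flat_exp m t\<bar> \<le> real (m + 2) ^ (m + 2) * t\<^sup>2"
proof (cases "t > 0")
  case True
  define s where "s = 1 / t"
  have s: "s > 0" using True by (simp add: s_def)
  have "(s / real (m + 2)) ^ (m + 2) \<le> (1 + s / real (m + 2)) ^ (m + 2)" using s by (intro power_mono) auto
  also have "\<dots> \<le> exp s" by (rule exp_ge_one_plus_x_over_n_power_n) (use s in auto)
  finally have "s ^ (m + 2) \<le> real (m + 2) ^ (m + 2) * exp s" by (simp add: power_divide divide_le_eq mult.commute)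
  then have le: "s ^ m * s\<^sup>2 \<le> real (m + 2) ^ (m + 2) * exp s" unfolding power_add[of s m 2] .
  have e: "exp s * exp (- s) = 1" by (simp flip: exp_add)
  have "s\<^sup>2 * (s ^ m * exp (- s)) = (s ^ m * s\<^sup>2) * exp (- s)" by (simp only: mult_ac)
  also have "\<dots> \<le> (real (m + 2) ^ (m + 2) * exp s) * exp (- s)" by (rule mult_right_mono[OF le]) simp
  also have "\<dots> = real (m + 2) ^ (m + 2)" unfolding mult.assoc e by (rule mult_1_right)
  finally have "s\<^sup>2 * (s ^ m * exp (- s)) \<le> real (m + 2) ^ (m + 2)" .
  then have "t\<^sup>2 * (s\<^sup>2 * (s ^ m * exp (- s))) \<le> t\<^sup>2 * real (m + 2) ^ (m + 2)" by (rule mult_left_mono) simp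
  moreover have "t\<^sup>2 * (s\<^sup>2 * (s ^ m * exp (- s))) = s ^ m * exp (- s)" using True by (simp add: s_def power_divide)
  ultimately show ?thesis using True s by (simp add: flat_exp_def s_def[symmetric] mult.commute)
qed (simp add: flat_exp_def)

lemma flat_exp_deriv:
  "(flat_exp m has_real_derivative (flat_exp (m + 2) t - real m * flat_exp (m + 1) t)) (at t)"
proof -
  consider "t > 0" | "t < 0" | "t = 0" by linarith
  then show ?thesis
  proof cases
    case 1
    have "((\<lambda>t. (1 / t) ^ m * exp (- (1 / t))) has_real_derivative
       (real m * (1 / t) ^ (m - 1) * (- (1 / t\<^sup>2))) * exp (- (1 / t)) + (1 / t) ^ m * (exp (- (1 / t)) * (1 / t\<^sup>2))) (at t)"
      using 1 by (auto intro!: derivative_eq_intros simp: power2_eq_square)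
    also have "(real m * (1 / t) ^ (m - 1) * (- (1 / t\<^sup>2))) * exp (- (1 / t)) + (1 / t) ^ m * (exp (- (1 / t)) * (1 / t\<^sup>2)) =
       flat_exp (m + 2) t - real m * flat_exp (m + 1) t"
      using 1 by (cases m) (auto simp: flat_exp_def power_add power_divide power2_eq_square field_simps)
    finally show ?thesis
      by (rule has_field_derivative_transform_within_open[where S="{0<..}"]) (use 1 in \<open>auto simp: flat_exp_def\<close>)
  next
    case 2
    have "((\<lambda>t. 0) has_real_derivative 0) (at t)" by simp
    then have "(flat_exp m has_real_derivative 0) (at t)"
      by (rule has_field_derivative_transform_within_open[where S="{..<0}"]) (use 2 in \<open>auto simp: flat_exp_def\<close>)
    then show ?thesis using 2 by (simp add: flat_exp_def)
  next
    case 3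
    let ?C = "real (m + 2) ^ (m + 2)"
    have "((\<lambda>h. (flat_exp m h - flat_exp m 0) / h) \<longlongrightarrow> 0) (at 0)"
    proof (rule Lim_null_comparison)
      show "\<forall>\<^sub>F h in at 0. norm ((flat_exp m h - flat_exp m 0) / h) \<le> ?C * \<bar>h\<bar>"
      proof (rule always_eventually, rule allI)
        fix h :: real
        have "\<bar>flat_exp m h\<bar> / \<bar>h\<bar> \<le> ?C * h\<^sup>2 / \<bar>h\<bar>" by (intro divide_right_mono flat_exp_le) simp
        also have "\<dots> = ?C * \<bar>h\<bar>" by (cases "h = 0") (auto simp: power2_eq_square abs_if)
        finally show "norm ((flat_exp m h - flat_exp m 0) / h) \<le> ?C * \<bar>h\<bar>" by (simp add: flat_exp_def)
      qed
      have "((\<lambda>h. ?C * \<bar>h\<bar>) \<longlongrightarrow> ?C * \<bar>0\<bar>) (at 0)" by (intro tendsto_intros)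
      then show "((\<lambda>h. ?C * \<bar>h\<bar>) \<longlongrightarrow> 0) (at 0)" by simp
    qed
    then have "(flat_exp m has_real_derivative 0) (at 0)" by (simp add: has_field_derivative_iff)
    then show ?thesis using 3 by (simp add: flat_exp_def)
  qed
qed

text \<open>A class of smooth functions that contains cut-off functions and is visibly closed under
  partial derivatives; closure implies \<open>C_diff\<close> of every order.\<close>

inductive elementary :: "(real^3 \<Rightarrow> complex) \<Rightarrow> bool" where
  const: "elementary (\<lambda>x. c)"
| coord: "elementary (\<lambda>x. of_real (x $ i))"
| add: "elementary a \<Longrightarrow> elementary b \<Longrightarrow> elementary (\<lambda>x. a x + b x)"
| mult: "elementary a \<Longrightarrow> elementary b \<Longrightarrow> elementary (\<lambda>x. a x * b x)"
| flat: "elementary a \<Longrightarrow> (\<And>x. Im (a x) = 0) \<Longrightarrow> elementary (\<lambda>x. of_real (flat_exp m (Re (a x))))"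

lemma elementary_derivative:
  assumes "elementary a"
  shows "\<exists>D. (\<forall>x. (a has_derivative D x) (at x)) \<and> (\<forall>i. elementary (\<lambda>x. D x (axis i 1)))"
  using assms
proof induction
  case (const c)
  show ?case by (intro exI[of _ "\<lambda>x h. 0"]) (auto intro: elementary.const)
next
  case (coord i)
  have "((\<lambda>x. of_real (x $ i) :: complex) has_derivative (\<lambda>h. of_real (h $ i))) (at x)" for x :: "real^3"
    by (intro bounded_linear_imp_has_derivative bounded_linear_compose[OF bounded_linear_of_real bounded_linear_vec_nth])
  then show ?case by (intro exI[of _ "\<lambda>x h. of_real (h $ i)"]) (auto intro: elementary.const)
next
  case (add a b)
  then obtain A B where AB: "\<And>x. (a has_derivative A x) (at x)" "\<And>x. (b has_derivative B x) (at x)"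
    "\<And>i. elementary (\<lambda>x. A x (axis i 1))" "\<And>i. elementary (\<lambda>x. B x (axis i 1))" by blast
  show ?case by (intro exI[of _ "\<lambda>x h. A x h + B x h"]) (auto intro: elementary.add AB has_derivative_add)
next
  case (mult a b)
  then obtain A B where AB: "\<And>x. (a has_derivative A x) (at x)" "\<And>x. (b has_derivative B x) (at x)"
    "\<And>i. elementary (\<lambda>x. A x (axis i 1))" "\<And>i. elementary (\<lambda>x. B x (axis i 1))" by blast
  have "((\<lambda>x. a x * b x) has_derivative (\<lambda>h. a x * B x h + A x h * b x)) (at x)" for x
    by (rule has_derivative_mult[OF AB(1,2)])
  moreover have "elementary (\<lambda>x. a x * B x (axis i 1) + A x (axis i 1) * b x)" for i
    by (rule elementary.add[OF elementary.mult[OF mult.hyps(1) AB(4)] elementary.mult[OF AB(3) mult.hyps(2)]])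
  ultimately show ?case by (intro exI[of _ "\<lambda>x h. a x * B x h + A x h * b x"]) blast
next
  case (flat a m)
  then obtain A where A: "\<And>x. (a has_derivative A x) (at x)" "\<And>i. elementary (\<lambda>x. A x (axis i 1))" by blast
  let ?e = "\<lambda>x. flat_exp (m + 2) (Re (a x)) - real m * flat_exp (m + 1) (Re (a x))"
  \<comment> \<open>A real-valued \<open>a\<close> has a real derivative, so
    \<open>Re (A x h)\<close> may be replaced by \<open>A x h\<close>; the class has no rule for
    taking real parts.\<close>
  have Im0: "Im (A x h) = 0" for x h
  proof -
    have "((\<lambda>x. Im (a x)) has_derivative (\<lambda>h. Im (A x h))) (at x)" by (rule has_derivative_Im[OF A(1)])
    moreover have "((\<lambda>x. Im (a x)) has_derivative (\<lambda>h. 0)) (at x)" using flat.hyps(2) by simp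
    ultimately have "(\<lambda>h. Im (A x h)) = (\<lambda>h. 0)" by (rule has_derivative_unique)
    from fun_cong[OF this, of h] show ?thesis .
  qed
  have hd: "((\<lambda>x. of_real (flat_exp m (Re (a x))) :: complex) has_derivative (\<lambda>h. of_real (?e x * Re (A x h)))) (at x)" for x
  proof -
    have 1: "((\<lambda>x. Re (a x)) has_derivative (\<lambda>h. Re (A x h))) (at x)" by (rule has_derivative_Re[OF A(1)])
    have 2: "(flat_exp m has_derivative (*) (?e x)) (at (Re (a x)))"
      using flat_exp_deriv[of m "Re (a x)"] unfolding has_field_derivative_def .
    have "((\<lambda>x. flat_exp m (Re (a x))) has_derivative (\<lambda>h. ?e x * Re (A x h))) (at x)"
      using has_derivative_compose[OF 1 2] .
    then show ?thesis by (rule has_derivative_of_real)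
  qed
  have eq: "(of_real (?e x * Re (A x h)) :: complex) =
      (of_real (flat_exp (m + 2) (Re (a x))) + of_real (- real m) * of_real (flat_exp (m + 1) (Re (a x)))) * A x h" for x h
  proof -
    have "A x h = of_real (Re (A x h))" using Im0 by (simp add: complex_eq_iff)
    then have "(of_real (?e x * Re (A x h)) :: complex) = of_real (?e x) * A x h" by simp
    then show ?thesis by simp
  qed
  have el: "elementary (\<lambda>x. (of_real (flat_exp (m + 2) (Re (a x))) + of_real (- real m) * of_real (flat_exp (m + 1) (Re (a x)))) * A x (axis i 1))" for i
    by (rule elementary.mult[OF elementary.add[OF elementary.flat[OF flat.hyps] elementary.mult[OF elementary.const elementary.flat[OF flat.hyps]]] A(2)])
  show ?case
  proof (intro exI conjI allI)
    show "((\<lambda>x. of_real (flat_exp m (Re (a x))) :: complex) has_derivative (\<lambda>h. of_real (?e x * Re (A x h)))) (at x)" for x by (rule hd)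
    show "elementary (\<lambda>x. of_real (?e x * Re (A x (axis i 1))))" for i unfolding eq by (rule el)
  qed
qed

lemma elementary_C_diff: "elementary a \<Longrightarrow> C_diff k a"
proof (induction k arbitrary: a)
  case 0
  obtain D where "\<And>x. (a has_derivative D x) (at x)" using elementary_derivative[OF 0] by blast
  then show ?case by (auto intro: has_derivative_continuous_on)
next
  case (Suc k)
  obtain D where D: "\<And>x. (a has_derivative D x) (at x)" "\<And>i. elementary (\<lambda>x. D x (axis i 1))"
    using elementary_derivative[OF Suc.prems] by blast
  have "frechet_derivative a (at x) = D x" for x using frechet_derivative_at[OF D(1)] by simp
  then show ?case using D Suc.IH by (auto simp: differentiable_def)
qed

lemma elementary_power: "elementary a \<Longrightarrow> elementary (\<lambda>x. a x ^ m)"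
  by (induction m) (auto intro: elementary.const elementary.mult)

section \<open>Cut-off vortices on a solid torus around the axis\<close>

definition cyl :: "real^3 \<Rightarrow> real" where "cyl x = (x $ 1)\<^sup>2 + (x $ 2)\<^sup>2"

text \<open>In cylindrical coordinates this is r e^(i s \<theta>) for s = 1 or s = -1. Its m-th
  power is a polynomial with angular factor e^(i s m \<theta>), so negative n are reached by the
  sign s and not by division.\<close>

definition plane :: "real \<Rightarrow> real^3 \<Rightarrow> complex" where "plane s x = Complex (x $ 1) (s * x $ 2)"

definition torus :: "real \<Rightarrow> (real^3) set" where
  "torus \<delta> = {x. 1 < cyl x \<and> cyl x < 1 + \<delta> \<and> 0 < x $ 3 \<and> x $ 3 < 1}"

text \<open>Each factor exp (-1/(k t)) tends to 1 as k grows where t > 0, and is 0 where t <= 0. The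
  four factors belong to the four faces of the torus, so its indicator is the limit.\<close>

definition cutoff :: "real \<Rightarrow> nat \<Rightarrow> real^3 \<Rightarrow> real" where
  "cutoff \<delta> k x = flat_exp 0 (k * (cyl x - 1)) * flat_exp 0 (k * (1 + \<delta> - cyl x)) * (flat_exp 0 (k * x $ 3) * flat_exp 0 (k * (1 - x $ 3)))"

definition torus_fun :: "real \<Rightarrow> real \<Rightarrow> real \<Rightarrow> nat \<Rightarrow> nat \<Rightarrow> real^3 \<Rightarrow> complex" where
  "torus_fun M \<delta> s m k x = of_real M * plane s x ^ m * of_real (cutoff \<delta> k x)"

lemma flat_exp_0: "0 \<le> flat_exp 0 t" "flat_exp 0 t \<le> 1" "t \<le> 0 \<Longrightarrow> flat_exp 0 t = 0"
  by (auto simp: flat_exp_def)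

lemma cutoff_bounds: "0 \<le> cutoff \<delta> k x" "cutoff \<delta> k x \<le> 1"
  unfolding cutoff_def by (intro mult_nonneg_nonneg flat_exp_0, intro mult_le_one mult_nonneg_nonneg flat_exp_0)

lemma cutoff_zero: "x \<notin> torus \<delta> \<Longrightarrow> cutoff \<delta> k x = 0"
  unfolding torus_def cutoff_def by (auto simp: not_less flat_exp_0(3) mult_nonneg_nonpos)

lemma norm_plane: "\<bar>s\<bar> = 1 \<Longrightarrow> norm (plane s x) = sqrt (cyl x)"
proof -
  assume "\<bar>s\<bar> = 1"
  then have "s\<^sup>2 = 1" using power2_abs[of s] by simp
  then show ?thesis by (simp add: plane_def cmod_def cyl_def power_mult_distrib)
qed

lemma torus_bounded: "0 < \<delta> \<Longrightarrow> x \<in> torus \<delta> \<Longrightarrow> norm x \<le> 2 + \<delta>"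
proof -
  assume "0 < \<delta>" "x \<in> torus \<delta>"
  then have "cyl x \<le> 1 + \<delta>" "(x $ 3)\<^sup>2 \<le> 1" by (auto simp: torus_def power_le_one)
  then have "(norm x)\<^sup>2 \<le> 2 + \<delta>" by (simp add: norm_vec3 cyl_def)
  also have "\<dots> \<le> (2 + \<delta>)\<^sup>2" using \<open>0 < \<delta>\<close> by (simp add: power2_eq_square algebra_simps)
  finally show ?thesis by (rule power2_le_imp_le) (use \<open>0 < \<delta>\<close> in simp)
qed

lemma torus_plane:
  assumes "\<delta> > 0" "\<bar>s\<bar> = 1" "x \<in> torus \<delta>"
  shows "1 \<le> norm (plane s x)" "norm (plane s x) \<le> 1 + \<delta>"
proof -
  show "1 \<le> norm (plane s x)" using assms(3) by (simp add: norm_plane[OF assms(2)] torus_def)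
  have "cyl x \<le> (1 + \<delta>)\<^sup>2" using assms self_le_power[of "1 + \<delta>" 2] by (auto simp: torus_def)
  then show "norm (plane s x) \<le> 1 + \<delta>" unfolding norm_plane[OF assms(2)] using assms(1) by (intro real_le_lsqrt) auto
qed

lemma torus_fun_test:
  assumes "\<delta> > 0" shows "test_function (torus_fun M \<delta> s m k)"
proof -
  have c: "elementary (\<lambda>x. of_real (x $ i))" for i :: 3 by (rule elementary.coord)
  have cyl: "elementary (\<lambda>x. of_real (cyl x))"
    using elementary.add[OF elementary_power[OF c[of 1], of 2] elementary_power[OF c[of 2], of 2]] by (simp add: cyl_def)
  have fl: "elementary (\<lambda>x. of_real (flat_exp 0 (g x)))" if "elementary (\<lambda>x. of_real (g x))" for g
    using elementary.flat[OF that, of 0] by simp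
  have aff: "elementary (\<lambda>x. of_real (a * g x + b))" if "elementary (\<lambda>x. of_real (g x))" for a b g
    using elementary.add[OF elementary.mult[OF elementary.const[of "of_real a"] that] elementary.const[of "of_real b"]] by simp
  have "elementary (\<lambda>x. of_real (flat_exp 0 (k * cyl x + - k)) * of_real (flat_exp 0 (- k * cyl x + k * (1 + \<delta>))) *
     (of_real (flat_exp 0 (k * x $ 3 + 0)) * of_real (flat_exp 0 (- k * x $ 3 + k))))"
    by (intro elementary.mult fl aff cyl c)
  then have cut: "elementary (\<lambda>x. of_real (cutoff \<delta> k x))" by (simp add: cutoff_def algebra_simps)
  have "elementary (\<lambda>x. of_real (x $ 1) + (\<i> * of_real s) * of_real (x $ 2))" by (intro elementary.add elementary.mult elementary.const c)
  also have "(\<lambda>x. of_real (x $ 1) + (\<i> * of_real s) * of_real (x $ 2)) = plane s" by (auto simp: plane_def complex_eq_iff)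
  finally have "elementary (torus_fun M \<delta> s m k)" unfolding torus_fun_def[abs_def]
    by (intro elementary.mult elementary.const elementary_power cut)
  moreover have "bounded {x. torus_fun M \<delta> s m k x \<noteq> 0}"
  proof (rule boundedI[of _ "2 + \<delta>"])
    fix x assume "x \<in> {x. torus_fun M \<delta> s m k x \<noteq> 0}"
    then have "x \<in> torus \<delta>" using cutoff_zero[of x \<delta> k] by (auto simp: torus_fun_def)
    then show "norm x \<le> 2 + \<delta>" by (rule torus_bounded[OF assms])
  qed
  ultimately show ?thesis by (simp add: test_function_iff elementary_C_diff)
qed

lemma norm_torus_fun_le:
  assumes "M > 0" "\<delta> > 0" "\<bar>s\<bar> = 1"
  shows "norm (torus_fun M \<delta> s m k x) \<le> M * (1 + \<delta>) ^ m * indicator (torus \<delta>) x"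
proof (cases "x \<in> torus \<delta>")
  case True
  have "norm (plane s x) \<le> 1 + \<delta>" using torus_plane[OF assms(2,3) True] by blast
  then have "norm (plane s x) ^ m * cutoff \<delta> k x \<le> (1 + \<delta>) ^ m * 1"
    using \<open>\<delta> > 0\<close> cutoff_bounds by (intro mult_mono power_mono) auto
  then show ?thesis using True assms cutoff_bounds[of \<delta> k x] by (simp add: torus_fun_def norm_mult norm_power mult.assoc)
qed (simp add: torus_fun_def cutoff_zero)

lemma torus_measurable: "torus \<delta> \<in> sets borel"
proof -
  have "open (torus \<delta>)" unfolding torus_def cyl_def
    by (intro open_Collect_conj open_Collect_less continuous_intros)
  then show ?thesis by simp
qed

lemma torus_emeasure: "\<delta> > 0 \<Longrightarrow> 0 < emeasure lborel (torus \<delta>)" "\<delta> > 0 \<Longrightarrow> emeasure lborel (torus \<delta>) < \<infinity>"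
proof -
  assume d: "\<delta> > 0"
  have o: "open (torus \<delta>)" unfolding torus_def cyl_def
    by (intro open_Collect_conj open_Collect_less continuous_intros)
  define y :: "real^3" where "y = vector [sqrt (1 + \<delta> / 2), 0, 1 / 2]"
  have "y \<in> torus \<delta>" using d by (simp add: torus_def cyl_def y_def)
  then obtain e where e: "e > 0" "ball y e \<subseteq> torus \<delta>" using o open_contains_ball by blast
  have "0 < ennreal (ball_vol e)" using ball_vol_pos[OF e(1)] by simp
  also have "\<dots> \<le> emeasure lborel (torus \<delta>)"
    unfolding emeasure_ball_vol[of y, symmetric] by (intro emeasure_mono e) (simp add: torus_measurable)
  finally show "0 < emeasure lborel (torus \<delta>)" .
  have "torus \<delta> \<subseteq> ball 0 (3 + \<delta>)" using torus_bounded[OF d] by force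
  then have "emeasure lborel (torus \<delta>) \<le> emeasure lborel (ball (0::real^3) (3 + \<delta>))" by (intro emeasure_mono) auto
  then show "emeasure lborel (torus \<delta>) < \<infinity>" by (auto simp: emeasure_ball_vol intro: le_less_trans)
qed

lemma cutoff_limit: "x \<in> torus \<delta> \<Longrightarrow> (\<lambda>k. cutoff \<delta> (Suc k) x) \<longlonglongrightarrow> 1"
proof -
  assume x: "x \<in> torus \<delta>"
  have l: "(\<lambda>k. flat_exp 0 (Suc k * t)) \<longlonglongrightarrow> 1" if "t > 0" for t :: real
  proof -
    have "(\<lambda>k. exp (- ((1 / Suc k) * (1 / t)))) \<longlonglongrightarrow> exp (- (0 * (1 / t)))"
      by (intro tendsto_intros LIMSEQ_Suc[OF lim_1_over_n])
    moreover have "flat_exp 0 (Suc k * t) = exp (- ((1 / Suc k) * (1 / t)))" for k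
      using that by (simp add: flat_exp_def)
    ultimately show ?thesis by (simp only: mult_zero_left minus_zero exp_zero)
  qed
  have "(\<lambda>k. cutoff \<delta> (Suc k) x) \<longlonglongrightarrow> 1 * 1 * (1 * 1)"
    unfolding cutoff_def by (intro tendsto_mult l) (use x in \<open>auto simp: torus_def\<close>)
  then show ?thesis by simp
qed

context nonlinearity
begin

text \<open>On a thin torus r^m is close to 1, so the modulus M r^m stays where f is positive, and f
  depends on the modulus alone. The cut-off values of \<open>F\<close> tend by dominated convergence
  to the integral of a function that is positive on the torus.\<close>

lemma torus_fun_positive:
  assumes "M > 0" "f (of_real M) > 0" "\<bar>s\<bar> = 1"
  obtains \<delta> k where "\<delta> > 0" "F (torus_fun M \<delta> s m k) > 0"
proof -
  have "isCont f (of_real M)" using cont_f by (simp add: continuous_on_eq_continuous_at)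
  then have "\<forall>\<^sub>F z in nhds (of_real M). f z > 0" using assms(2) by (simp add: isCont_def tendsto_at_iff_tendsto_nhds order_tendstoD)
  then obtain d where d: "d > 0" "\<And>z. dist z (of_real M) < d \<Longrightarrow> f z > 0" by (auto simp: eventually_nhds_metric)
  have "(\<lambda>k. M * (1 + 1 / real (Suc k)) ^ m) \<longlonglongrightarrow> M * (1 + 0) ^ m" by (intro tendsto_intros LIMSEQ_Suc[OF lim_1_over_n])
  then have "\<forall>\<^sub>F k in sequentially. M * (1 + 1 / real (Suc k)) ^ m < M + d" by (rule order_tendstoD) (use d in simp)
  then obtain j where j: "M * (1 + 1 / real (Suc j)) ^ m < M + d" by (auto simp: eventually_sequentially)
  define \<delta> where "\<delta> = 1 / real (Suc j)"
  have \<delta>: "\<delta> > 0" by (simp add: \<delta>_def)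
  define g where "g x = f (of_real M * plane s x ^ m) * indicator (torus \<delta>) x" for x
  have gpos: "f (of_real M * plane s x ^ m) > 0" if x: "x \<in> torus \<delta>" for x
  proof -
    let ?n = "norm (of_real M * plane s x ^ m)"
    note r = torus_plane[OF \<delta> assms(3) x]
    have "?n = M * norm (plane s x) ^ m" using assms(1) by (simp add: norm_mult norm_power)
    moreover have "M * 1 \<le> M * norm (plane s x) ^ m" using assms(1) r by (intro mult_left_mono one_le_power) auto
    moreover have "M * norm (plane s x) ^ m \<le> M * (1 + \<delta>) ^ m" using assms(1) r by (intro mult_left_mono power_mono) auto
    ultimately have "dist (of_real ?n) (of_real M :: complex) < d" using j unfolding \<delta>_def[symmetric] dist_of_real by (simp add: dist_real_def)
    then show ?thesis using d(2) f_norm[of "of_real M * plane s x ^ m"] by simp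
  qed
  have [measurable]: "torus \<delta> \<in> sets borel" by (rule torus_measurable)
  have cp: "continuous_on UNIV (plane s)"
  proof -
    have "plane s = (\<lambda>x. of_real (x $ 1) + (\<i> * of_real s) * of_real (x $ 2))" by (auto simp: plane_def complex_eq_iff)
    then show ?thesis by (simp only:) (intro continuous_intros)
  qed
  have [measurable]: "plane s \<in> borel_measurable borel" by (rule borel_measurable_continuous_onI[OF cp])
  have [measurable]: "g \<in> borel_measurable borel" unfolding g_def by measurable
  let ?B = "\<lambda>x. c * (M * (1 + \<delta>) ^ m) ^ 6 * indicator (torus \<delta>) x"
  have iB: "integrable lborel ?B"
    using torus_emeasure(2)[OF \<delta>] by (intro integrable_mult_right integrable_real_indicator) auto
  have tm: "torus_fun M \<delta> s m k \<in> borel_measurable borel" for k using test_function_measurable[OF torus_fun_test[OF \<delta>]] by blast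
  note [measurable] = tm
  have dom: "AE x in lborel. (\<lambda>k. f (torus_fun M \<delta> s m (Suc k) x)) \<longlonglongrightarrow> g x"
  proof (rule AE_I2)
    fix x
    show "(\<lambda>k. f (torus_fun M \<delta> s m (Suc k) x)) \<longlonglongrightarrow> g x"
    proof (cases "x \<in> torus \<delta>")
      case True
      have "(\<lambda>k. torus_fun M \<delta> s m (Suc k) x) \<longlonglongrightarrow> of_real M * plane s x ^ m * of_real 1"
        unfolding torus_fun_def by (intro tendsto_intros cutoff_limit True)
      then have "(\<lambda>k. f (torus_fun M \<delta> s m (Suc k) x)) \<longlonglongrightarrow> f (of_real M * plane s x ^ m * of_real 1)"
        using cont_f by (intro isCont_tendsto_compose[where g=f]) (auto simp: continuous_on_eq_continuous_at)
      then show ?thesis using True by (simp add: g_def)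
    qed (simp add: g_def torus_fun_def cutoff_zero f0)
  qed
  have bnd: "AE x in lborel. norm (f (torus_fun M \<delta> s m (Suc k) x)) \<le> ?B x" for k
  proof (rule AE_I2)
    fix x
    have "norm (f (torus_fun M \<delta> s m (Suc k) x)) \<le> c * norm (torus_fun M \<delta> s m (Suc k) x) ^ 6" using f_bound by simp
    also have "\<dots> \<le> c * (M * (1 + \<delta>) ^ m * indicator (torus \<delta>) x) ^ 6"
      using c by (intro mult_left_mono power_mono norm_torus_fun_le assms \<delta>) auto
    finally show "norm (f (torus_fun M \<delta> s m (Suc k) x)) \<le> ?B x" by (auto simp: indicator_def)
  qed
  have ig: "integrable lborel g" by (rule integrable_dominated_convergence[OF _ _ iB dom bnd]) measurable
  have lim: "(\<lambda>k. F (torus_fun M \<delta> s m (Suc k))) \<longlonglongrightarrow> (\<integral>x. g x \<partial>lborel)"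
    by (rule integral_dominated_convergence[OF _ _ iB dom bnd]) measurable
  have g0: "0 \<le> g x" for x using gpos[of x] by (auto simp: g_def indicator_def)
  have "(\<integral>x. g x \<partial>lborel) \<noteq> 0"
  proof
    assume "(\<integral>x. g x \<partial>lborel) = 0"
    then have "AE x in lborel. g x = 0" using integral_nonneg_eq_0_iff_AE[OF ig] g0 by simp
    then have "AE x in lborel. x \<notin> torus \<delta>"
    proof eventually_elim
      case (elim x)
      then show ?case using gpos[of x] by (auto simp: g_def)
    qed
    then have "emeasure lborel (torus \<delta>) = 0" by (subst (asm) AE_iff_measurable[OF _ refl]) auto
    then show False using torus_emeasure(1)[OF \<delta>] by simp
  qed
  moreover have "(\<integral>x. g x \<partial>lborel) \<ge> 0" using g0 by (intro integral_nonneg_AE) auto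
  ultimately have "(\<integral>x. g x \<partial>lborel) > 0" by simp
  from order_tendstoD(1)[OF lim this] obtain k where "F (torus_fun M \<delta> s m (Suc k)) > 0"
    by (auto simp: eventually_sequentially)
  with \<delta> show ?thesis by (rule that)
qed

end

section \<open>Solutions with angular dependence\<close>

definition reflect2 :: "real^3 \<Rightarrow> real^3" where "reflect2 x = vector [x $ 1, - x $ 2, x $ 3]"

text \<open>The first family says that rotating by \<alpha> multiplies the value by e^(i n
  \<alpha>). The last pair turns the reflection into conjugation and so makes the values real on the
  half-plane \<theta> = 0, which it fixes; equivariance alone would leave u complex.\<close>

definition vortex :: "int \<Rightarrow> symmetries" where
  "vortex n = {(\<lambda>z. cis (- (of_int n * \<alpha>)) * z, rotz \<alpha>) |\<alpha>. True} \<union> {(cnj, reflect2)}"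

lemma orthogonal_reflect2: "orthogonal_transformation reflect2"
  unfolding orthogonal_transformation
proof (intro conjI allI)
  show "linear reflect2" by (rule linearI) (auto simp: reflect2_def vec_eq_iff forall_3)
qed (simp add: norm_vec3 reflect2_def)

lemma axial_vortex: "axial (vortex n)"
proof -
  have "orthogonal_transformation (\<lambda>z. cis a * z)" for a
    unfolding orthogonal_transformation
    by (intro conjI allI linearI) (auto simp: algebra_simps norm_mult)
  moreover have "orthogonal_transformation cnj"
    unfolding orthogonal_transformation by (intro conjI allI linearI) auto
  moreover have "rotz \<alpha> (axis 3 1) = axis 3 1" "reflect2 (axis 3 1) = axis 3 1" for \<alpha>
    by (auto simp: rotz_def reflect2_def axis_def vec_eq_iff forall_3)
  ultimately show ?thesis
    by (auto simp: axial_def isometries_def vortex_def orthogonal_rotz orthogonal_reflect2)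
qed

lemma plane_rotz:
  assumes "s = 1 \<or> s = -1" shows "plane s (rotz \<alpha> x) = cis (s * \<alpha>) * plane s x"
  using assms by (auto simp: plane_def rotz_def complex_eq_iff algebra_simps)

lemma cyl_rotz: "cyl (rotz \<alpha> x) = cyl x"
proof -
  have "cyl (rotz \<alpha> x) = ((cos \<alpha>)\<^sup>2 + (sin \<alpha>)\<^sup>2) * cyl x"
    unfolding cyl_def rotz_def vector_3 by (simp only: power2_eq_square) algebra
  then show ?thesis by simp
qed

lemma torus_fun_invariant: "invariant (vortex n) (torus_fun M \<delta> (if n \<ge> 0 then 1 else -1) (nat \<bar>n\<bar>) k)"
proof -
  define s :: real where "s = (if n \<ge> 0 then 1 else -1)"
  define m where "m = nat \<bar>n\<bar>"
  \<comment> \<open>With s the sign and m the modulus of n, the power \<open>plane s x ^ m\<close>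
    picks up the phase s m \<alpha> = n \<alpha>.\<close>
  have s: "s = 1 \<or> s = -1" "real m * s = of_int n" by (auto simp: s_def m_def)
  have "cis (- (of_int n * \<alpha>)) * torus_fun M \<delta> s m k (rotz \<alpha> x) = torus_fun M \<delta> s m k x" for \<alpha> x
  proof -
    have "cutoff \<delta> k (rotz \<alpha> x) = cutoff \<delta> k x" by (simp add: cutoff_def cyl_rotz) (simp add: rotz_def)
    moreover have "cis (s * \<alpha>) ^ m = cis (of_int n * \<alpha>)" unfolding Complex.DeMoivre s(2)[symmetric] mult.assoc ..
    moreover have "cis (- (of_int n * \<alpha>)) * cis (of_int n * \<alpha>) = 1" by (simp add: cis_mult)
    ultimately show ?thesis
      by (simp add: torus_fun_def plane_rotz[OF s(1)] power_mult_distrib mult_ac)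
  qed
  moreover have "cnj (torus_fun M \<delta> s m k (reflect2 x)) = torus_fun M \<delta> s m k x" for x
  proof -
    have "cnj (plane s (reflect2 x)) = plane s x" by (simp add: plane_def reflect2_def complex_eq_iff)
    moreover have "cutoff \<delta> k (reflect2 x) = cutoff \<delta> k x" by (simp add: cutoff_def cyl_def reflect2_def)
    ultimately show ?thesis by (simp add: torus_fun_def)
  qed
  ultimately show ?thesis unfolding s_def[symmetric] m_def[symmetric] by (auto simp: invariant_def vortex_def)
qed

section \<open>Representatives with exact symmetry\<close>

lemma rotz_add: "rotz \<alpha> (rotz \<beta> x) = rotz (\<alpha> + \<beta>) x"
  by (simp add: rotz_def vec_eq_iff forall_3 cos_add sin_add algebra_simps)

lemma rotz_measurable[measurable (raw)]:
  assumes [measurable]: "a \<in> borel_measurable M" "b \<in> borel_measurable M"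
  shows "(\<lambda>x. rotz (a x) (b x)) \<in> borel_measurable M"
proof -
  have [measurable]: "(\<lambda>y. y $ i) \<in> borel_measurable borel" for i :: 3
    by (intro borel_measurable_continuous_onI continuous_intros)
  show ?thesis unfolding rotz_def by measurable
qed

lemma cis_measurable[measurable]: "cis \<in> borel_measurable borel"
  by (intro borel_measurable_continuous_onI continuous_on_cis continuous_on_id)

lemma AE_lborel_shift:
  fixes P :: "real \<Rightarrow> bool"
  assumes "AE \<alpha> in lborel. P \<alpha>" shows "AE \<alpha> in lborel. P (\<alpha> + \<beta>)"
proof -
  obtain N where N: "N \<in> null_sets lborel" "{\<alpha>. \<not> P \<alpha>} \<subseteq> N" using assms by (auto simp: eventually_ae_filter)
  then have "AE \<alpha> in distr lborel borel ((+) \<beta>). \<alpha> \<notin> N" unfolding lborel_distr_plus by (simp add: AE_not_in)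
  then have "AE \<alpha> in lborel. \<beta> + \<alpha> \<notin> N" using N by (subst (asm) AE_distr_iff) (auto simp: null_sets_def)
  then show ?thesis using N(2) by (auto elim!: AE_mp simp: add.commute)
qed

text \<open>An almost everywhere equivariant function is corrected on the null set of circles along
  which it fails to be equivariant for almost every angle.\<close>

lemma equivariant_representative:
  fixes w :: "real^3 \<Rightarrow> complex"
  assumes [measurable]: "w \<in> borel_measurable borel"
    and inv: "\<And>\<alpha>. AE x in lborel. w (rotz \<alpha> x) = cis (k * \<alpha>) * w x"
  obtains v where "v \<in> borel_measurable borel" "AE x in lborel. v x = w x" "\<And>\<beta> x. v (rotz \<beta> x) = cis (k * \<beta>) * v x"
proof -
  define good where "good x c \<longleftrightarrow> (AE \<alpha> in lborel. w (rotz \<alpha> x) = cis (k * \<alpha>) * c)" for x c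
  \<comment> \<open>At a good point the integrand is the constant \<open>c\<close> for almost every
    angle, and the interval has length 1, so \<open>B\<close> recovers \<open>c\<close>, and does so
    measurably in x.\<close>
  define B where "B x = (\<integral>\<alpha>. indicator {0..1::real} \<alpha> *\<^sub>R (cis (- (k * \<alpha>)) * w (rotz \<alpha> x)) \<partial>lborel)" for x
  have [measurable]: "B \<in> borel_measurable borel" unfolding B_def by measurable
  have cc: "cis (- a) * (cis a * c) = c" for a c by (simp add: mult.assoc[symmetric] cis_mult)
  have goodB: "B x = c" if "good x c" for x c
  proof -
    have "B x = (\<integral>\<alpha>. indicator {0..1::real} \<alpha> *\<^sub>R c \<partial>lborel)"
      unfolding B_def
    proof (rule integral_cong_AE)
      show "AE \<alpha> in lborel. indicator {0..1::real} \<alpha> *\<^sub>R (cis (- (k * \<alpha>)) * w (rotz \<alpha> x)) = indicator {0..1::real} \<alpha> *\<^sub>R c"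
        using that unfolding good_def by eventually_elim (simp add: cc)
    qed measurable
    then show ?thesis by simp
  qed
  have good_rot: "good (rotz \<beta> x) (cis (k * \<beta>) * c)" if "good x c" for x c \<beta>
    using AE_lborel_shift[OF that[unfolded good_def], of \<beta>] unfolding good_def
    by eventually_elim (simp add: rotz_add distrib_left flip: cis_mult)
  define v where "v x = (if good x (B x) then B x else 0)" for x
  have good_iff: "good x (B x) \<longleftrightarrow> (\<integral>\<^sup>+\<alpha>. ennreal (norm (w (rotz \<alpha> x) - cis (k * \<alpha>) * B x)) \<partial>lborel) = 0" for x
    unfolding good_def by (subst nn_integral_0_iff_AE) auto
  have "v \<in> borel_measurable borel" unfolding v_def good_iff by measurable
  moreover have "AE x in lborel. v x = w x"
  proof -
    \<comment> \<open>Fubini for null sets: equivariance at almost every point for each angle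
      becomes, at almost every point, equivariance for almost every angle.\<close>
    have "AE \<alpha> in (lborel :: real measure). AE x in lborel. w (rotz \<alpha> x) = cis (k * \<alpha>) * w x" using inv by simp
    then have "AE x in lborel. AE \<alpha> in (lborel :: real measure). w (rotz \<alpha> x) = cis (k * \<alpha>) * w x"
      by (subst lborel_pair.AE_commute) measurable
    then show ?thesis
    proof eventually_elim
      case (elim x)
      then have g: "good x (w x)" by (simp add: good_def)
      with goodB[OF g] show ?case by (simp add: v_def)
    qed
  qed
  moreover have "v (rotz \<beta> x) = cis (k * \<beta>) * v x" for \<beta> x
  proof (cases "good x (B x)")
    case True
    have g: "good (rotz \<beta> x) (cis (k * \<beta>) * B x)" by (rule good_rot[OF True])
    show ?thesis using goodB[OF g] g True by (simp add: v_def)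
  next
    case False
    \<comment> \<open>Goodness passes back under the opposite rotation, so it belongs to whole
      circles, and the value 0 is consistent on the bad ones.\<close>
    have "\<not> good (rotz \<beta> x) (B (rotz \<beta> x))"
    proof
      assume "good (rotz \<beta> x) (B (rotz \<beta> x))"
      from good_rot[OF this, of "- \<beta>"] have g: "good x (cis (k * - \<beta>) * B (rotz \<beta> x))"
        by (simp add: rotz_add) (simp add: rotz_def vec_eq_iff forall_3 good_def)
      with goodB[OF g] False show False by simp
    qed
    then show ?thesis using False by (simp add: v_def)
  qed
  ultimately show ?thesis by (rule that)
qed

text \<open>The half-plane \<theta> = 0 is a null set, so reality there cannot be read off from the
  reflection symmetry directly. At almost every x the symmetry holds, and exact equivariance carries
  it to the half-plane along the circle through x. Circles with a nonreal value there fill a null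
  set, on which the function is reset to 0.\<close>

lemma cylindrical_representative:
  fixes w :: "real^3 \<Rightarrow> complex"
  assumes w[measurable]: "w \<in> borel_measurable borel" and inv: "invariant (vortex n) w"
  obtains v u where "v \<in> borel_measurable borel" "AE x in lborel. w x = v x"
    "\<And>r \<theta> z. r > 0 \<Longrightarrow> v (vector [r * cos \<theta>, r * sin \<theta>, z]) = of_real (u r z) * exp (\<i> * of_int n * of_real \<theta>)"
proof -
  let ?k = "of_int n :: real"
  have "AE x in lborel. w (rotz \<alpha> x) = cis (?k * \<alpha>) * w x" for \<alpha>
  proof -
    have "(\<lambda>z. cis (- (?k * \<alpha>)) * z, rotz \<alpha>) \<in> vortex n" by (auto simp: vortex_def)
    from invariantD[OF inv this] show ?thesis
    proof eventually_elim
      case (elim x)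
      have "cis (?k * \<alpha>) * (cis (- (?k * \<alpha>)) * w (rotz \<alpha> x)) = w (rotz \<alpha> x)" by (simp add: mult.assoc[symmetric] cis_mult)
      then show ?case using elim by simp
    qed
  qed
  then obtain y where y[measurable]: "y \<in> borel_measurable borel" and yw: "AE x in lborel. y x = w x"
    and rot: "\<And>\<beta> x. y (rotz \<beta> x) = cis (?k * \<beta>) * y x"
    by (rule equivariant_representative[OF w]) blast
  have rv: "vector [r * cos \<theta>, r * sin \<theta>, z] = rotz \<theta> (vector [r, 0, z])" for r \<theta> z
    by (simp add: rotz_def mult.commute)
  have yv: "y (vector [r * cos \<theta>, r * sin \<theta>, z]) = cis (?k * \<theta>) * y (vector [r, 0, z])" for r \<theta> z
    unfolding rv by (rule rot)
  have yv0: "y (vector [r, 0, z]) = cis (?k * 0) * y (vector [r, 0, z])" for r z by simp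
  \<comment> \<open>The point of the circle through x that lies in the half-plane \<theta> =
    0.\<close>
  define base where "base x = (vector [sqrt (cyl x), 0, x $ 3] :: real^3)" for x :: "real^3"
  have [measurable]: "base \<in> borel_measurable borel"
  proof -
    have [measurable]: "(\<lambda>y. y $ i) \<in> borel_measurable borel" for i :: 3
      by (intro borel_measurable_continuous_onI continuous_intros)
    show ?thesis unfolding base_def cyl_def by measurable
  qed
  define v where "v x = (if Im (y (base x)) = 0 then y x else 0)" for x
  define u where "u r z = (if Im (y (vector [r, 0, z])) = 0 then Re (y (vector [r, 0, z])) else 0)" for r z
  have polar: "\<exists>\<theta>. x = vector [sqrt (cyl x) * cos \<theta>, sqrt (cyl x) * sin \<theta>, x $ 3]" for x :: "real^3"
  proof -
    let ?c = "Complex (x $ 1) (x $ 2)"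
    have n: "norm ?c = sqrt (cyl x)" by (simp add: cmod_def cyl_def)
    have "?c = of_real (norm ?c) * cis (Arg ?c)" using rcis_cmod_Arg[of ?c] by (simp only: rcis_def)
    then have "x $ 1 = sqrt (cyl x) * cos (Arg ?c)" "x $ 2 = sqrt (cyl x) * sin (Arg ?c)"
      unfolding n by (auto simp: complex_eq_iff)
    then show ?thesis by (intro exI[of _ "Arg ?c"]) (simp add: vec_eq_iff forall_3)
  qed
  show ?thesis
  proof (rule that[of v u])
    show "v \<in> borel_measurable borel" unfolding v_def by measurable
    have "AE x in lborel. cnj (w (reflect2 x)) = w x" by (rule invariantD[OF inv]) (simp add: vortex_def)
    with yw AE_orthogonal[OF orthogonal_reflect2 yw] show "AE x in lborel. w x = v x"
    proof eventually_elim
      case (elim x)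
      obtain \<theta> where \<theta>: "x = vector [sqrt (cyl x) * cos \<theta>, sqrt (cyl x) * sin \<theta>, x $ 3]" using polar by blast
      have "reflect2 x = vector [sqrt (cyl x) * cos (- \<theta>), sqrt (cyl x) * sin (- \<theta>), x $ 3]"
        by (subst \<theta>) (simp add: reflect2_def)
      then have 1: "y (reflect2 x) = cis (?k * - \<theta>) * y (base x)" using yv[of "sqrt (cyl x)" "- \<theta>" "x $ 3"] by (simp add: base_def)
      have 2: "y x = cis (?k * \<theta>) * y (base x)" by (subst \<theta>) (simp only: yv base_def)
      have "cnj (y (reflect2 x)) = y x" using elim by simp
      then have "cis (?k * \<theta>) * cnj (y (base x)) = cis (?k * \<theta>) * y (base x)" unfolding 1 2 by (simp add: cis_cnj)
      then have "cnj (y (base x)) = y (base x)" by simp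
      then have "Im (y (base x)) = 0" by (simp add: complex_eq_iff)
      then show ?case using elim(1) by (simp add: v_def)
    qed
    fix r \<theta> z :: real assume r: "r > 0"
    have "sqrt (cyl (vector [r * cos \<theta>, r * sin \<theta>, z])) = r"
    proof -
      have "cyl (vector [r * cos \<theta>, r * sin \<theta>, z]) = r\<^sup>2 * ((cos \<theta>)\<^sup>2 + (sin \<theta>)\<^sup>2)"
        unfolding cyl_def vector_3 by (simp only: power_mult_distrib distrib_left)
      then show ?thesis using r by simp
    qed
    then have b: "base (vector [r * cos \<theta>, r * sin \<theta>, z]) = vector [r, 0, z]" by (simp add: base_def)
    have "y (vector [r, 0, z]) = of_real (Re (y (vector [r, 0, z])))" if "Im (y (vector [r, 0, z])) = 0"
      using that by (simp add: complex_eq_iff)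
    then show "v (vector [r * cos \<theta>, r * sin \<theta>, z]) = of_real (u r z) * exp (\<i> * of_int n * of_real \<theta>)"
      unfolding v_def u_def b yv by (auto simp: cis_conv_exp mult_ac)
  qed
qed

lemma weak_solution_AE_cong:
  assumes "weak_solution g w" "AE x in lborel. w x = v x" and [measurable]: "v \<in> borel_measurable borel" "g \<in> borel_measurable borel"
  shows "weak_solution g v"
proof -
  obtain G where G: "has_D12_gradient w G" and *: "\<And>h H. has_D12_gradient h H \<Longrightarrow>
      integrable lborel (\<lambda>x. G x \<bullet> H x) \<and> integrable lborel (\<lambda>x. g (w x) \<bullet> h x) \<and>
      (\<integral>x. G x \<bullet> H x \<partial>lborel) = (\<integral>x. g (w x) \<bullet> h x \<partial>lborel)"
    using assms(1) unfolding weak_solution_def by blast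
  note [measurable] = D12_measurable[OF G]
  have v: "has_D12_gradient v G" by (rule D12_AE_cong[OF G assms(2)]) auto
  have "integrable lborel (\<lambda>x. G x \<bullet> H x) \<and> integrable lborel (\<lambda>x. g (v x) \<bullet> h x) \<and>
      (\<integral>x. G x \<bullet> H x \<partial>lborel) = (\<integral>x. g (v x) \<bullet> h x \<partial>lborel)" if h: "has_D12_gradient h H" for h H
  proof -
    note [measurable] = D12_measurable[OF h]
    have ae: "AE x in lborel. g (w x) \<bullet> h x = g (v x) \<bullet> h x" using assms(2) by (auto elim!: AE_mp)
    have "integrable lborel (\<lambda>x. g (v x) \<bullet> h x)"
      using *[OF h] by (subst integrable_cong_AE[OF _ _ ae, symmetric]) auto
    moreover have "(\<integral>x. g (w x) \<bullet> h x \<partial>lborel) = (\<integral>x. g (v x) \<bullet> h x \<partial>lborel)"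
      by (rule integral_cong_AE[OF _ _ ae]) measurable
    ultimately show ?thesis using *[OF h] by simp
  qed
  with v show ?thesis unfolding weak_solution_def by blast
qed

text \<open>Nontriviality comes from \<open>F v = S > 0\<close>, since \<open>F\<close> vanishes on
  null functions; the dilation and the change of representative preserve it together with the
  equation.\<close>

lemma (in nonlinearity) vortex_solution:
  assumes "M > 0" "f (of_real M) > 0"
  shows "\<exists>v u. weak_solution f' v \<and> \<not> (AE x in lborel. v x = 0) \<and>
    (\<forall>r \<theta> z. r > 0 \<longrightarrow> v (vector [r * cos \<theta>, r * sin \<theta>, z]) = of_real (u r z) * exp (\<i> * of_int n * of_real \<theta>))"
proof -
  have iso: "isometries (vortex n)" using axial_vortex[of n] by (simp add: axial_def)
  obtain \<delta> k where \<delta>: "\<delta> > 0" "F (torus_fun M \<delta> (if n \<ge> 0 then 1 else -1) (nat \<bar>n\<bar>) k) > 0"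
    by (rule torus_fun_positive[OF assms, of "if n \<ge> 0 then 1 else -1" "nat \<bar>n\<bar>"]) auto
  obtain S v G where m: "maximiser (vortex n) S v G"
    by (rule maximiser_exists[OF axial_vortex D12_test_function[OF torus_fun_test[OF \<delta>(1)]] torus_fun_invariant \<delta>(2)])
  have v: "has_D12_gradient v G" "invariant (vortex n) v" "F v = S" "S > 0" using m by (auto simp: maximiser_def)
  define \<sigma> where "\<sigma> = sqrt (6 * S)"
  have \<sigma>: "\<sigma> > 0" using v(4) by (simp add: \<sigma>_def)
  define w where "w x = v (\<sigma> *\<^sub>R x)" for x
  have sol: "weak_solution f' w" unfolding w_def \<sigma>_def by (rule maximiser_weak_solution[OF iso m])
  have wm: "w \<in> borel_measurable borel" using D12_measurable(1)[OF v(1)] unfolding w_def by measurable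
  have "invariant (vortex n) (\<lambda>x. v (\<sigma> *\<^sub>R x + 0))"
    by (rule invariant_similarity[OF iso v(2) \<sigma>]) (simp add: linear_0[OF isometriesD(4)[OF iso]])
  then have inv: "invariant (vortex n) w" by (simp add: w_def[abs_def])
  have nz: "\<not> (AE x in lborel. w x = 0)"
  proof
    assume "AE x in lborel. w x = 0"
    then have "AE x in lborel. w ((1 / \<sigma>) *\<^sub>R x + 0) = 0"
      using AE_similarity[OF orthogonal_transformation_id, of "1 / \<sigma>" "\<lambda>x. w x = 0" 0] \<sigma> by simp
    then have "AE x in lborel. v x = 0" using \<sigma> by (simp add: w_def)
    from F_zero[OF this D12_measurable(1)[OF v(1)]] show False using v(3,4) by simp
  qed
  obtain v' u where v': "v' \<in> borel_measurable borel" "AE x in lborel. w x = v' x"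
    "\<And>r \<theta> z. r > 0 \<Longrightarrow> v' (vector [r * cos \<theta>, r * sin \<theta>, z]) = of_real (u r z) * exp (\<i> * of_int n * of_real \<theta>)"
    by (rule cylindrical_representative[OF wm inv]) blast
  have "weak_solution f' v'" by (rule weak_solution_AE_cong[OF sol v'(2,1)]) measurable
  moreover have "\<not> (AE x in lborel. v' x = 0)"
  proof
    assume "AE x in lborel. v' x = 0"
    with v'(2) have "AE x in lborel. w x = 0" by eventually_elim simp
    with nz show False by blast
  qed
  ultimately show ?thesis using v'(3) by blast
qed

theorem theorem1p1:
  fixes p q c :: real
    and f :: "complex \<Rightarrow> real" and f' :: "complex \<Rightarrow> complex"
  assumes "1 < p" and "p < 6" and "6 < q" and "c > 0"
    and C1: "\<And>\<xi>. GDERIV f \<xi> :> f' \<xi>" "continuous_on UNIV f'"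
    and i: "f 0 = 0"
    and ii: "\<exists>M::real. M > 0 \<and> f (of_real M) > 0"
    and iii: "\<And>\<xi>. norm (f' \<xi>) \<le> c * min (norm \<xi> powr (p - 1)) (norm \<xi> powr (q - 1))"
    and iv: "\<And>(\<rho>::real) (\<alpha>::real). \<rho> \<ge> 0 \<Longrightarrow>
      f (exp (\<i> * of_real \<alpha>) * of_real \<rho>) = f (of_real \<rho>)"
  shows "\<exists>(v :: int \<Rightarrow> real^3 \<Rightarrow> complex) (u :: int \<Rightarrow> real \<Rightarrow> real \<Rightarrow> real).
    \<forall>n. weak_solution f' (v n) \<and>
        \<not> (AE x in lborel. v n x = 0) \<and>
        (\<forall>r \<theta> z. r > 0 \<longrightarrow>
           v n (vector [r * cos \<theta>, r * sin \<theta>, z]) =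
             of_real (u n r z) * exp (\<i> * of_int n * of_real \<theta>))"
proof -
  interpret nonlinearity p q c f f' by unfold_locales (use assms in auto)
  obtain M where M: "M > 0" "f (of_real M) > 0" using ii by blast
  have "\<forall>n. \<exists>v u. weak_solution f' v \<and> \<not> (AE x in lborel. v x = 0) \<and>
    (\<forall>r \<theta> z. r > 0 \<longrightarrow> v (vector [r * cos \<theta>, r * sin \<theta>, z]) = of_real (u r z) * exp (\<i> * of_int n * of_real \<theta>))"
    using vortex_solution[OF M] by blast
  from choice[OF this] obtain v where "\<forall>n. \<exists>u. weak_solution f' (v n) \<and> \<not> (AE x in lborel. v n x = 0) \<and>
    (\<forall>r \<theta> z. r > 0 \<longrightarrow> v n (vector [r * cos \<theta>, r * sin \<theta>, z]) = of_real (u r z) * exp (\<i> * of_int n * of_real \<theta>))" ..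
  from choice[OF this] show ?thesis by blast
qed

end
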